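(* Let $n\ge 1$ be an integer and let $\mu$ be an $n$-Ahlfors regular Radon measure in $\mathbb{R}^{n+1}$. Suppose that $\mu$ satisfies the BAUPP condition (bilateral approximation by unions of parallel planes) and that the $n$-dimensional Riesz transform $\mathcal{R}_\mu$ is bounded in $L^2(\mu)$. Then $\mu$ satisfies the BWGL (bilateral weak geometric lemma).
   Context: Ahlfors regularity. A (positive) Radon measure $\mu$ in $\mathbb{R}^{d}$ is $n$-Ahlfors regular if there is a constant $C\geq 1$ such that $C^{-1}r^n\le \mu(B(x,r))\le C r^n$ for all $x\in\operatorname{supp}\mu$ and $0<r\le \operatorname{diam}(\operatorname{supp}\mu)$ (if the diameter is infinite, this means all $0<r<\infty$). Here $d=n+1$. Riesz transform. For $\varepsilon>0$ and $f\in L^2(\mu)$ put $$\mathcal{R}_{\mu,\varepsilon}f(x)=\int_{|x-y|>\varepsilon}\frac{x-y}{|x-y|^{n+1}}\,f(y)\,d\mu(y).$$ One says that $\mathcal{R}_\mu$ is bounded in $L^2(\mu)$ if the operators $\mathcal{R}_{\mu,\varepsilon}$ are bounded in $L^2(\mu)$ uniformly in $\varepsilon>0$, i.e. $\sup_{\varepsilon>0}\|\mathcal{R}_{\mu,\varepsilon}\|_{L^2(\mu)\to L^2(\mu)}<\infty$. BAUPP. An $n$-plane is an $n$-dimensional affine subspace of $\mathbb{R}^{n+1}$. For $\varepsilon>0$, $x\in\operatorname{supp}\mu$ and $r>0$, write $(x,r)\in\mathsf{BAUPP}(\varepsilon)$ if there exists a (nonempty) family $I_{x,r}$ of parallel $n$-planes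 such that, with $H_{x,r}=\bigcup_{L\in I_{x,r}}L$, $$\sup_{y\in\operatorname{supp}\mu\cap B(x,r)}\frac{\operatorname{dist}(y,H_{x,r})}{r}+\sup_{y\in H_{x,r}\cap B(x,r)}\frac{\operatorname{dist}(y,\operatorname{supp}\mu)}{r}\le\varepsilon$$ (a supremum over the empty set is $0$). The measure $\mu$ satisfies the BAUPP condition if for every $\varepsilon>0$ there is a constant $C(\varepsilon)<\infty$ such that $$\int_B\int_0^{r(B)}\chi_{\{(x,t)\notin\mathsf{BAUPP}(\varepsilon)\}}\,\frac{dt}{t}\,d\mu(x)\le C(\varepsilon)\,\mu(B)$$ for every ball $B$ centered at $\operatorname{supp}\mu$ with radius $r(B)$, $0<r(B)\le\operatorname{diam}(\operatorname{supp}\mu)$ (with $r(B)<\infty$). BWGL. The BWGL is defined in the same way, with the family of planes required to consist of a single $n$-plane. That is, write $(x,r)\in\mathsf{BWGL}(\varepsilon)$ if there is an $n$-plane $L$ such that $$\sup_{y\in\operatorname{supp}\mu\cap B(x,r)}\frac{\operatorname{dist}(y,L)}{r}+\sup_{y\in L\cap B(x,r)}\frac{\operatorname{dist}(y,\operatorname{supp}\mu)}{r}\le\varepsilon;$$ then $\mu$ satisfies the BWGL if for every $\varepsilon>0$ there is a constant $C(\varepsilon)<\infty$ such that $$\int_B\int_0^{r(B)}\chi_{\{(x,t)\notin\mathsf{BWGL}(\varepsilon)\}}\,\frac{dt}{t}\,d\mu(x)\le C(\varepsilon)\,\mu(B)$$ for every ball $B$ centered at $\operatorname{supp}\mu$ with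 radius $0<r(B)\le\operatorname{diam}(\operatorname{supp}\mu)$ (with $r(B)<\infty$). *)

theory Defs
  imports "HOL-Analysis.Analysis"
begin

definition radon_measure :: "'a::euclidean_space measure \<Rightarrow> bool" where
  "radon_measure M \<longleftrightarrow>
     sets M = sets borel \<and>
     (\<forall>K. compact K \<longrightarrow> emeasure M K < \<infinity>) \<and>
     (\<forall>U. open U \<longrightarrow> emeasure M U = (SUP K\<in>{K. compact K \<and> K \<subseteq> U}. emeasure M K)) \<and>
     (\<forall>A\<in>sets borel. emeasure M A = (INF U\<in>{U. open U \<and> A \<subseteq> U}. emeasure M U))"

definition msupp :: "'a::euclidean_space measure \<Rightarrow> 'a set" where
  "msupp M = {x. \<forall>U. open U \<and> x \<in> U \<longrightarrow> emeasure M U > 0}"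

text \<open>The condition \<open>0 < r \<le> diam S\<close>, \<open>r < \<infinity>\<close>, with \<open>diam S = \<infinity>\<close> for unbounded \<open>S\<close>
  (the library constant \<^const>\<open>diameter\<close> is meaningful only for bounded sets).\<close>

definition admissible_radius :: "'a::euclidean_space set \<Rightarrow> real \<Rightarrow> bool" where
  "admissible_radius S r \<longleftrightarrow> 0 < r \<and> (bounded S \<longrightarrow> r \<le> diameter S)"

definition ahlfors_regular :: "nat \<Rightarrow> 'a::euclidean_space measure \<Rightarrow> bool" where
  "ahlfors_regular n M \<longleftrightarrow>
     (\<exists>C::real. C \<ge> 1 \<and>
       (\<forall>x\<in>msupp M. \<forall>r. admissible_radius (msupp M) r \<longrightarrow>
          ennreal (inverse C * r ^ n) \<le> emeasure M (ball x r) \<and>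
          emeasure M (ball x r) \<le> ennreal (C * r ^ n)))"

definition L2_space :: "'a measure \<Rightarrow> ('a \<Rightarrow> 'b::euclidean_space) set" where
  "L2_space M = {f. f \<in> borel_measurable M \<and> integrable M (\<lambda>x. (norm (f x))\<^sup>2)}"

definition L2_norm :: "'a measure \<Rightarrow> ('a \<Rightarrow> 'b::euclidean_space) \<Rightarrow> real" where
  "L2_norm M f = sqrt (\<integral>x. (norm (f x))\<^sup>2 \<partial>M)"

text \<open>For \<open>f\<close> in \<open>L\<^sup>2\<close> of an \<open>n\<close>-Ahlfors regular measure the integral converges absolutely for
  every \<open>x\<close>, by Cauchy-Schwarz, so the default value of the Bochner integral plays no role.\<close>

definition riesz_trunc ::
    "nat \<Rightarrow> 'a::euclidean_space measure \<Rightarrow> real \<Rightarrow> ('a \<Rightarrow> real) \<Rightarrow> 'a \<Rightarrow> 'a" where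
  "riesz_trunc n M \<epsilon> f x =
     (LINT y:{y. norm (x - y) > \<epsilon>}|M. (f y / norm (x - y) ^ (n + 1)) *\<^sub>R (x - y))"

definition riesz_L2_bounded :: "nat \<Rightarrow> 'a::euclidean_space measure \<Rightarrow> bool" where
  "riesz_L2_bounded n M \<longleftrightarrow>
     (\<exists>C::real. \<forall>\<epsilon>>0. \<forall>f\<in>L2_space M.
        riesz_trunc n M \<epsilon> f \<in> L2_space M \<and>
        L2_norm M (riesz_trunc n M \<epsilon> f) \<le> C * L2_norm M f)"

definition is_plane :: "nat \<Rightarrow> 'a::euclidean_space set \<Rightarrow> bool" where
  "is_plane n L \<longleftrightarrow> affine L \<and> aff_dim L = int n"

text \<open>The suprema are taken in \<^typ>\<open>ennreal\<close>, where the supremum over the empty set is \<open>0\<close>.\<close>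

definition bilateral_dev :: "'a::euclidean_space set \<Rightarrow> 'a set \<Rightarrow> 'a \<Rightarrow> real \<Rightarrow> ennreal" where
  "bilateral_dev S H x r =
     (SUP y\<in>S \<inter> ball x r. ennreal (infdist y H / r)) +
     (SUP y\<in>H \<inter> ball x r. ennreal (infdist y S / r))"

definition BAUPP :: "nat \<Rightarrow> 'a::euclidean_space measure \<Rightarrow> real \<Rightarrow> ('a \<times> real) set" where
  "BAUPP n M \<epsilon> = {(x, r). x \<in> msupp M \<and> r > 0 \<and>
     (\<exists>I. I \<noteq> {} \<and> (\<forall>L\<in>I. is_plane n L) \<and> (\<forall>L\<in>I. \<forall>L'\<in>I. affine_parallel L L') \<and>
          bilateral_dev (msupp M) (\<Union>I) x r \<le> ennreal \<epsilon>)}"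

definition BWGL :: "nat \<Rightarrow> 'a::euclidean_space measure \<Rightarrow> real \<Rightarrow> ('a \<times> real) set" where
  "BWGL n M \<epsilon> = {(x, r). x \<in> msupp M \<and> r > 0 \<and>
     (\<exists>L. is_plane n L \<and> bilateral_dev (msupp M) L x r \<le> ennreal \<epsilon>)}"

text \<open>\<open>G\<close> is the set of good pairs \<open>(x, t)\<close>. Points \<open>x\<close> outside the support, which are never good,
  form a null set and do not contribute to the outer integral.
  With open balls the sets \<^const>\<open>BAUPP\<close> and \<^const>\<open>BWGL\<close> are relatively closed in
  \<open>msupp M \<times> {0<..}\<close>, so the integrands below are Borel.\<close>

definition bad_set_carleson :: "'a::euclidean_space measure \<Rightarrow> ('a \<times> real) set \<Rightarrow> bool" where
  "bad_set_carleson M G \<longleftrightarrow>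
     (\<exists>C::real. \<forall>z\<in>msupp M. \<forall>r. admissible_radius (msupp M) r \<longrightarrow>
        (\<integral>\<^sup>+x\<in>ball z r. (\<integral>\<^sup>+t\<in>{0<..<r}. indicator (- G) (x, t) * ennreal (1 / t) \<partial>lborel) \<partial>M)
          \<le> ennreal C * emeasure M (ball z r))"

definition BAUPP_condition :: "nat \<Rightarrow> 'a::euclidean_space measure \<Rightarrow> bool" where
  "BAUPP_condition n M \<longleftrightarrow> (\<forall>\<epsilon>>0. bad_set_carleson M (BAUPP n M \<epsilon>))"

definition BWGL_condition :: "nat \<Rightarrow> 'a::euclidean_space measure \<Rightarrow> bool" where
  "BWGL_condition n M \<longleftrightarrow> (\<forall>\<epsilon>>0. bad_set_carleson M (BWGL n M \<epsilon>))"

end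

theory Submission
  imports Defs
begin

text \<open>Let \<open>E\<close> be the support. Suppose that at scale \<open>t\<close> around \<open>x\<close> the set \<open>E\<close> is not close to one
  plane, while at a much larger scale it is close to a union of planes with common normal \<open>\<nu>\<close>.
  By regularity only boundedly many separated planes occur, so by pigeonholing over scales one finds
  \<open>\<rho>\<close> comparable to \<open>t\<close> such that, in a ball of radius \<open>A \<rho>\<close> with \<open>A\<close> large, \<open>E\<close> lies in a slab of
  width \<open>O(\<rho>)\<close> and every point of \<open>E\<close> sees points of \<open>E\<close> at height difference \<open>\<ge> \<rho>/4\<close> nearby.
  Let \<open>h\<close> be the height in direction \<open>\<nu>\<close> and test the \<open>\<nu>\<close>-component of the Riesz transform against
  \<open>\<psi> = \<phi> (h - m)\<close>, with a cutoff \<open>\<phi>\<close> and \<open>m\<close> making the mean vanish. After antisymmetrization the main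
  term is the integral of \<open>(h u - h y)\<^sup>2 / |u - y|\<^bsup>n+1\<^esup>\<close>, which is nonnegative and large; the slab condition
  controls the cutoff errors, and the vanishing mean controls the far field. These test functions are
  almost orthogonal, being Lipschitz with mean zero, so the \<open>L\<^sup>2\<close> bound yields the packing of all such
  pairs \<open>(x, t)\<close>. The remaining pairs fail the BAUPP at a comparable scale.\<close>

section \<open>The Riesz kernel and upper regular measures\<close>

text \<open>The cutoff leaves the error \<open>(\<phi> u - \<phi> y) * (h y - m) * (h u - h y) /
  norm (u - y) ^ Suc n\<close>. Let \<open>\<phi>\<close> live at radius \<open>B * \<rho>\<close>
  and the slab reach to \<open>A * \<rho>\<close>. Bounding \<open>h u - h y\<close> by the distance
  gives an error of order A / B relative to the main term; bounding it by the slab width gives a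
  logarithmic divergence on the diagonal. The geometric mean of the two bounds gives sqrt A / B,
  while the far field costs B / A. Hence two separate radii with sqrt A << B << A, and a slab
  condition required far beyond the support of the test function. \<open>A\<close> is thus fixed
  before the pigeonholing, whose ratio of scales depends on it. The Carleson integral is replaced by
  sums over separated nets at dyadic levels. Only finitely many levels are treated at a time, so
  that a single truncation lies below all of them, while no constant depends on their number. All
  pairs in a ball are tested against one function, the transform of the indicator of a larger ball;
  as normals vary from pair to pair, the tests are assembled into a vector field.\<close>

lemma inverse_power_diff_le:
  fixes a b m :: real
  assumes "0 < m" "m \<le> a" "m \<le> b"
  shows "\<bar>1 / a ^ k - 1 / b ^ k\<bar> \<le> real k * \<bar>a - b\<bar> / m ^ Suc k"
proof (induction k)
  case (Suc k)
  have ab: "0 < a" "0 < b" using assms by auto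
  have eq: "1 / a ^ Suc k - 1 / b ^ Suc k
      = (1 / a) * (1 / a ^ k - 1 / b ^ k) + (1 / b ^ k) * ((b - a) / (a * b))"
    using ab by (simp add: field_simps)
  have 1: "\<bar>(1 / a) * (1 / a ^ k - 1 / b ^ k)\<bar> \<le> (1 / m) * (real k * \<bar>a - b\<bar> / m ^ Suc k)"
    unfolding abs_mult using Suc assms ab by (intro mult_mono) (auto simp: field_simps)
  have 2: "\<bar>(1 / b ^ k) * ((b - a) / (a * b))\<bar> \<le> (1 / m ^ k) * (\<bar>a - b\<bar> / (m * m))"
    unfolding abs_mult abs_divide using assms ab
    by (intro mult_mono divide_left_mono frac_le power_mono)
      (auto simp: abs_mult intro!: mult_mono power_mono)
  have "\<bar>1 / a ^ Suc k - 1 / b ^ Suc k\<bar>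
      \<le> (1 / m) * (real k * \<bar>a - b\<bar> / m ^ Suc k) + (1 / m ^ k) * (\<bar>a - b\<bar> / (m * m))"
    unfolding eq using 1 2 by linarith
  also have "\<dots> = real (Suc k) * \<bar>a - b\<bar> / m ^ Suc (Suc k)"
    using \<open>0 < m\<close> by (simp add: field_simps)
  finally show ?case .
qed simp

text \<open>The Calderon-Zygmund smoothness of the kernel away from its pole. Both
  \<open>norm v\<close> and \<open>norm (v + w)\<close> are at least \<open>m\<close>, half of
  \<open>norm v\<close>. Varying the numerator costs \<open>norm w / m ^ Suc n\<close>, varying the
  denominator \<open>2 * (n + 1)\<close> times as much, hence \<open>2 * n + 3\<close>. This turns
  the vanishing mean of a test function into decay of the far field.\<close>

lemma riesz_kernel_diff_le:
  fixes \<nu> v w :: "'a::real_inner"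
  assumes "norm \<nu> = 1" "v \<noteq> 0" "norm w \<le> norm v / 2"
  shows "\<bar>\<nu> \<bullet> (v + w) / norm (v + w) ^ Suc n - \<nu> \<bullet> v / norm v ^ Suc n\<bar>
    \<le> (2 * real n + 3) * 2 ^ Suc n * norm w / norm v ^ Suc n"
proof -
  define m where "m = norm v / 2"
  have m: "0 < m" "m \<le> norm v" using assms by (auto simp: m_def)
  have vw: "m \<le> norm (v + w)"
    using norm_triangle_ineq4[of "v + w" w] assms(3) unfolding m_def by simp
  have eq: "\<nu> \<bullet> (v + w) / norm (v + w) ^ Suc n - \<nu> \<bullet> v / norm v ^ Suc n
     = (\<nu> \<bullet> w) * (1 / norm (v + w) ^ Suc n)
       + (\<nu> \<bullet> v) * (1 / norm (v + w) ^ Suc n - 1 / norm v ^ Suc n)"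
    by (simp add: inner_add_right divide_inverse algebra_simps)
  have 1: "\<bar>(\<nu> \<bullet> w) * (1 / norm (v + w) ^ Suc n)\<bar> \<le> norm w * (1 / m ^ Suc n)"
    unfolding abs_mult using m vw assms(1) Cauchy_Schwarz_ineq2[of \<nu> w]
    by (intro mult_mono) (auto simp del: power_Suc intro!: frac_le power_mono zero_less_power)
  have "\<bar>norm (v + w) - norm v\<bar> \<le> norm w"
    using norm_triangle_ineq3[of "v + w" v] by simp
  then have "\<bar>1 / norm (v + w) ^ Suc n - 1 / norm v ^ Suc n\<bar> \<le> real (Suc n) * norm w / m ^ Suc (Suc n)"
    using m vw
    by (intro order_trans[OF inverse_power_diff_le[of m]] divide_right_mono mult_left_mono) auto
  then have 2: "\<bar>(\<nu> \<bullet> v) * (1 / norm (v + w) ^ Suc n - 1 / norm v ^ Suc n)\<bar>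
      \<le> (2 * m) * (real (Suc n) * norm w / m ^ Suc (Suc n))"
    unfolding abs_mult using assms(1) Cauchy_Schwarz_ineq2[of \<nu> v]
    by (intro mult_mono) (auto simp: m_def)
  have "\<bar>\<nu> \<bullet> (v + w) / norm (v + w) ^ Suc n - \<nu> \<bullet> v / norm v ^ Suc n\<bar>
    \<le> norm w * (1 / m ^ Suc n) + (2 * m) * (real (Suc n) * norm w / m ^ Suc (Suc n))"
    unfolding eq using 1 2 by linarith
  also have "\<dots> = (2 * real n + 3) * norm w / m ^ Suc n"
    using m(1) by (simp add: field_simps)
  also have "\<dots> = (2 * real n + 3) * 2 ^ Suc n * norm w / norm v ^ Suc n"
    by (simp add: m_def power_divide)
  finally show ?thesis .
qed

lemma geometric_bracket:
  fixes d q :: real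
  assumes "1 \<le> d" "1 < q"
  obtains j :: nat where "q ^ j \<le> d" "d < q ^ Suc j"
proof -
  obtain m where "d < q ^ m" using real_arch_pow[OF assms(2)] by blast
  define k where "k = (LEAST m. d < q ^ m)"
  have k: "d < q ^ k" unfolding k_def by (rule LeastI) fact
  then have "k \<noteq> 0" using assms by (intro notI) auto
  then obtain j where j: "k = Suc j" using not0_implies_Suc by blast
  have "\<not> d < q ^ j" using not_less_Least[of j "\<lambda>m. d < q ^ m"] j k_def by simp
  then show thesis using that[of j] k j by (simp add: not_less)
qed

text \<open>The strict inequality sits at the lower end, so that for the quotient
  \<open>r / dist u y\<close> the point \<open>y\<close> falls into the open ball of radius
  \<open>r / q ^ j\<close>.\<close>

lemma geometric_bracket':
  fixes d q :: real
  assumes "1 < d" "1 < q"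
  obtains j :: nat where "q ^ j < d" "d \<le> q ^ Suc j"
proof -
  obtain j where j: "q ^ j \<le> d" "d < q ^ Suc j"
    using geometric_bracket[of d q] assms by auto
  show thesis
  proof (cases "q ^ j = d")
    case True
    then obtain i where "j = Suc i" using assms by (cases j) auto
    with True show ?thesis using that[of i] assms \<open>j = Suc i\<close> zero_less_power[of q i] by (auto simp: mult_less_cancel_right1 not_le)
  qed (use j that[of j] in auto)
qed

text \<open>Meant for the restriction of the given measure to a ball. Such a restriction is finite,
  which makes bounded kernels integrable and Fubini available, and it inherits the upper growth
  bound for all balls. A lower bound survives only for balls inside the restricting one and is
  therefore passed as a hypothesis to the lemmas that use it.\<close>

locale upper_regular = finite_measure M for M :: "'a::euclidean_space measure" +
  fixes E :: "'a set" and n :: nat and C :: real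
  assumes sets_M [measurable_cong]: "sets M = sets borel"
    and AE_E: "AE y in M. y \<in> E"
    and upper: "\<And>u r. u \<in> E \<Longrightarrow> 0 < r \<Longrightarrow> measure M (ball u r) \<le> C * r ^ n"
    and C_pos: "0 < C" and closed_E: "closed E"
begin

lemma upper_emeasure:
  assumes "u \<in> E" "0 < r"
  shows "emeasure M (ball u r) \<le> ennreal (C * r ^ n)"
  using upper[OF assms] by (simp add: emeasure_eq_measure ennreal_leI)

text \<open>Dyadic decomposition with balls instead of annuli: one suitable index per point suffices
  for \<open>f\<close> to be dominated by the sum of \<open>a j\<close> times the indicators, and
  level \<open>j\<close> contributes at most \<open>c / 2 ^ j\<close>.\<close>

lemma nn_integral_weighted_balls_le:
  fixes f :: "'a \<Rightarrow> real" and a \<rho> :: "nat \<Rightarrow> real"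
  assumes u: "u \<in> E" and nonneg: "\<And>j. 0 \<le> a j" "\<And>j. 0 < \<rho> j"
    and bd: "\<And>y. 0 < f y \<Longrightarrow> \<exists>j. y \<in> ball u (\<rho> j) \<and> f y \<le> a j"
    and wt: "\<And>j. a j * (C * \<rho> j ^ n) \<le> c * (1/2) ^ j" and "0 \<le> c"
  shows "(\<integral>\<^sup>+y. ennreal (f y) \<partial>M) \<le> ennreal (2 * c)"
proof -
  have "ennreal (f y) \<le> (\<Sum>j. ennreal (a j) * indicator (ball u (\<rho> j)) y)" for y
  proof (cases "0 < f y")
    case True
    then obtain j where j: "y \<in> ball u (\<rho> j)" "f y \<le> a j" using bd by blast
    then have "ennreal (f y) \<le> ennreal (a j) * indicator (ball u (\<rho> j)) y"
      by (simp add: ennreal_leI)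
    also have "\<dots> = (\<Sum>i\<in>{j}. ennreal (a i) * indicator (ball u (\<rho> i)) y)"
      by (simp del: sum_mult_indicator)
    also have "\<dots> \<le> (\<Sum>j. ennreal (a j) * indicator (ball u (\<rho> j)) y)"
      by (rule sum_le_suminf) auto
    finally show ?thesis .
  qed (simp add: ennreal_neg)
  then have "(\<integral>\<^sup>+y. ennreal (f y) \<partial>M) \<le> (\<integral>\<^sup>+y. (\<Sum>j. ennreal (a j) * indicator (ball u (\<rho> j)) y) \<partial>M)"
    by (rule nn_integral_mono)
  also have "\<dots> = (\<Sum>j. \<integral>\<^sup>+y. ennreal (a j) * indicator (ball u (\<rho> j)) y \<partial>M)"
    by (intro nn_integral_suminf borel_measurable_times_ennreal borel_measurable_const
        borel_measurable_indicator) (simp add: sets_M)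
  also have "\<dots> = (\<Sum>j. ennreal (a j) * emeasure M (ball u (\<rho> j)))"
    by (intro suminf_cong nn_integral_cmult_indicator) (simp add: sets_M)
  also have "\<dots> \<le> (\<Sum>j. ennreal (c * (1/2) ^ j))"
  proof (rule suminf_le)
    fix j
    have "ennreal (a j) * emeasure M (ball u (\<rho> j)) \<le> ennreal (a j) * ennreal (C * \<rho> j ^ n)"
      by (intro mult_left_mono upper_emeasure u nonneg) simp
    also have "\<dots> = ennreal (a j * (C * \<rho> j ^ n))"
      using nonneg C_pos by (simp add: ennreal_mult' less_imp_le)
    also have "\<dots> \<le> ennreal (c * (1/2) ^ j)" by (intro ennreal_leI wt)
    finally show "ennreal (a j) * emeasure M (ball u (\<rho> j)) \<le> ennreal (c * (1/2) ^ j)" .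
  qed auto
  also have "\<dots> = ennreal (\<Sum>j. c * (1/2) ^ j)"
    using \<open>0 \<le> c\<close> by (intro suminf_ennreal2 summable_mult summable_geometric) auto
  also have "(\<Sum>j. c * (1/2) ^ j) = 2 * c"
    using suminf_mult[OF summable_geometric[of "1/2::real"], of c] suminf_geometric[of "1/2::real"]
    by simp
  finally show ?thesis .
qed

text \<open>The kernel is half a power better than the critical \<open>1 / dist u y ^ n\<close>,
  which gives convergence at the centre. The radii shrink by 4 so that the square root halves at
  each level.\<close>

lemma integral_near_le:
  assumes u: "u \<in> E" and r: "0 < r"
    and f0: "\<And>y. dist u y \<ge> r \<or> y = u \<Longrightarrow> f y \<le> 0"
    and f1: "\<And>y. f y \<le> sqrt (dist u y) / dist u y ^ n"
  shows "(\<integral>y. f y \<partial>M) \<le> 2 * (C * 4 ^ n * sqrt r)"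
proof (rule integral_real_bounded)
  show "(\<integral>\<^sup>+y. ennreal (f y) \<partial>M) \<le> ennreal (2 * (C * 4 ^ n * sqrt r))"
  proof (rule nn_integral_weighted_balls_le[OF u, where
        a = "\<lambda>j. (sqrt r / 2 ^ j) * (4 ^ Suc j / r) ^ n" and \<rho> = "\<lambda>j. r / 4 ^ j"])
    fix y assume "0 < f y"
    then have d: "0 < dist u y" "dist u y < r" using f0[of y] by force+
    then obtain j where j: "4 ^ j < r / dist u y" "r / dist u y \<le> 4 ^ Suc j"
      using geometric_bracket'[of "r / dist u y" 4] by auto
    have j1: "dist u y < r / 4 ^ j" using j(1) d by (simp add: field_simps)
    have j2: "1 / dist u y \<le> 4 ^ Suc j / r" using j(2) d r by (simp add: field_simps)
    have "sqrt (dist u y) \<le> sqrt (r / 4 ^ j)" using j1 by simp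
    also have "\<dots> = sqrt r / 2 ^ j"
      using real_sqrt_power[of 4 j] by (simp add: real_sqrt_divide)
    finally have s: "sqrt (dist u y) \<le> sqrt r / 2 ^ j" .
    have "f y \<le> sqrt (dist u y) * (1 / dist u y) ^ n"
      using f1[of y] by (simp add: power_one_over)
    also have "\<dots> \<le> (sqrt r / 2 ^ j) * (4 ^ Suc j / r) ^ n"
      using r by (intro mult_mono s power_mono j2) auto
    finally show "\<exists>j. y \<in> ball u (r / 4 ^ j) \<and> f y \<le> (sqrt r / 2 ^ j) * (4 ^ Suc j / r) ^ n"
      using j1 by auto
  next
    fix j
    show "(sqrt r / 2 ^ j) * (4 ^ Suc j / r) ^ n * (C * (r / 4 ^ j) ^ n) \<le> C * 4 ^ n * sqrt r * (1/2) ^ j"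
      using r by (simp add: power_divide power_mult_distrib power_one_over field_simps)
  qed (use r C_pos in auto)
qed (use r C_pos in auto)

lemma integral_far_le:
  assumes u: "u \<in> E" and r: "0 < r"
    and f0: "\<And>y. dist u y < r \<Longrightarrow> f y \<le> 0"
    and f1: "\<And>y. f y \<le> 1 / dist u y ^ Suc n"
  shows "(\<integral>y. f y \<partial>M) \<le> 2 * (C * 2 ^ n / r)"
proof (rule integral_real_bounded)
  show "(\<integral>\<^sup>+y. ennreal (f y) \<partial>M) \<le> ennreal (2 * (C * 2 ^ n / r))"
  proof (rule nn_integral_weighted_balls_le[OF u, where
        a = "\<lambda>j. 1 / (2 ^ j * r) ^ Suc n" and \<rho> = "\<lambda>j. 2 ^ Suc j * r"])
    fix y assume "0 < f y"
    then have d: "r \<le> dist u y" using f0[of y] by force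
    then obtain j where j: "2 ^ j \<le> dist u y / r" "dist u y / r < 2 ^ Suc j"
      using geometric_bracket[of "dist u y / r" 2] r by auto
    have j1: "dist u y < 2 ^ Suc j * r" using j(2) r by (simp add: field_simps)
    have j2: "2 ^ j * r \<le> dist u y" using j(1) r by (simp add: field_simps)
    have "f y \<le> 1 / dist u y ^ Suc n" by fact
    also have "\<dots> \<le> 1 / (2 ^ j * r) ^ Suc n"
      using r j2 by (intro frac_le power_mono zero_less_power) auto
    finally show "\<exists>j. y \<in> ball u (2 ^ Suc j * r) \<and> f y \<le> 1 / (2 ^ j * r) ^ Suc n"
      using j1 by auto
  next
    fix j
    show "1 / (2 ^ j * r) ^ Suc n * (C * (2 ^ Suc j * r) ^ n) \<le> C * 2 ^ n / r * (1/2) ^ j"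
      using r by (simp add: power_divide power_mult_distrib power_one_over field_simps)
  qed (use r C_pos in auto)
qed (use r C_pos in auto)


lemma integrable_bounded:
  fixes f :: "'a \<Rightarrow> real"
  assumes "f \<in> borel_measurable M" "\<And>y. \<bar>f y\<bar> \<le> K"
  shows "integrable M f"
  using assms by (intro integrable_const_bound[of _ K]) auto

lemma integrable_pair_bounded:
  fixes f :: "'a \<times> 'a \<Rightarrow> real"
  assumes "f \<in> borel_measurable (M \<Otimes>\<^sub>M M)" "\<And>p. \<bar>f p\<bar> \<le> K"
  shows "integrable (M \<Otimes>\<^sub>M M) f"
proof -
  interpret Q: finite_measure "M \<Otimes>\<^sub>M M"
    by (intro finite_measure_pair_measure finite_measure_axioms)
  show ?thesis using assms by (intro Q.integrable_const_bound[of _ K]) auto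
qed

lemma AE_pair_E: "AE p in M \<Otimes>\<^sub>M M. fst p \<in> E \<and> snd p \<in> E"
proof -
  interpret P: pair_sigma_finite M M ..
  have E: "E \<in> sets M" using closed_E by (simp add: sets_M)
  have [measurable]: "E \<in> sets M" by fact
  show ?thesis
  proof (rule P.AE_pair_measure)
    show "{p \<in> space (M \<Otimes>\<^sub>M M). fst p \<in> E \<and> snd p \<in> E} \<in> sets (M \<Otimes>\<^sub>M M)"
      by measurable
    show "AE u in M. AE y in M. fst (u, y) \<in> E \<and> snd (u, y) \<in> E"
      using AE_E by (auto elim!: eventually_mono)
  qed
qed

text \<open>\<open>m\<close> is the \<open>\<phi>\<close>-weighted average of the height. As an
  average over the slab it is at most \<open>3 * \<rho>\<close>, so \<open>h - m\<close> has the
  size of \<open>\<rho>\<close> on \<open>E\<close> although the cutoff has a support of radius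
  \<open>2 * B * \<rho>\<close>.\<close>

lemma mean_zero_bump:
  fixes x \<nu> :: 'a and \<rho> B :: real
  defines "h \<equiv> \<lambda>y. \<nu> \<bullet> (y - x)"
    and "\<phi> \<equiv> \<lambda>y. max 0 (min 1 (2 - dist x y / (B * \<rho>)))"
  assumes pos: "0 < \<rho>" "0 < B"
    and G1: "\<And>y. y \<in> E \<Longrightarrow> dist x y < 2 * B * \<rho> \<Longrightarrow> \<bar>h y\<bar> \<le> 3 * \<rho>"
    and mass: "0 < measure M (ball x (B * \<rho>))"
    and \<nu>: "norm \<nu> = 1"
  obtains m where "\<bar>m\<bar> \<le> 3 * \<rho>" "(\<integral>y. \<phi> y * (h y - m) \<partial>M) = 0"
proof -
  have [measurable]: "h \<in> borel_measurable M" "\<phi> \<in> borel_measurable M"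
    unfolding h_def \<phi>_def by measurable
  have \<phi>: "0 \<le> \<phi> y" "\<phi> y \<le> 1" for y by (auto simp: \<phi>_def)
  have \<phi>0: "\<phi> y = 0" if "2 * B * \<rho> \<le> dist x y" for y
  proof -
    have "2 \<le> dist x y / (B * \<rho>)" using that pos by (simp add: field_simps)
    then show ?thesis by (simp add: \<phi>_def)
  qed
  have \<phi>1: "\<phi> y = 1" if "dist x y \<le> B * \<rho>" for y
    using that pos by (auto simp: \<phi>_def field_simps)
  have hle: "\<bar>h y\<bar> \<le> dist x y" for y
    unfolding h_def using Cauchy_Schwarz_ineq2[of \<nu> "y - x"] \<nu> by (simp add: dist_norm norm_minus_commute)
  have int\<phi>: "integrable M \<phi>" using \<phi> by (intro integrable_bounded[of _ 1]) auto
  have bd: "\<bar>\<phi> y * h y\<bar> \<le> 2 * B * \<rho>" for y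
  proof (cases "2 * B * \<rho> \<le> dist x y")
    case False
    have "\<bar>\<phi> y * h y\<bar> \<le> 1 * dist x y"
      unfolding abs_mult using \<phi>[of y] hle[of y] by (intro mult_mono) auto
    with False show ?thesis by simp
  qed (use \<phi>0 pos in auto)
  have int\<phi>h: "integrable M (\<lambda>y. \<phi> y * h y)" using bd by (intro integrable_bounded) auto
  have "measure M (ball x (B * \<rho>)) = (\<integral>y. indicator (ball x (B * \<rho>)) y \<partial>M)"
    by (simp add: sets_M)
  also have "\<dots> \<le> (\<integral>y. \<phi> y \<partial>M)"
    using \<phi> \<phi>1 by (intro integral_mono int\<phi> integrable_bounded[of _ 1])
      (auto simp: indicator_def sets_M)
  finally have I: "0 < (\<integral>y. \<phi> y \<partial>M)" using mass by linarith
  define m where "m = (\<integral>y. \<phi> y * h y \<partial>M) / (\<integral>y. \<phi> y \<partial>M)"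
  have "\<bar>\<integral>y. \<phi> y * h y \<partial>M\<bar> \<le> (\<integral>y. \<bar>\<phi> y * h y\<bar> \<partial>M)" by simp
  also have "\<dots> \<le> (\<integral>y. 3 * \<rho> * \<phi> y \<partial>M)"
  proof (rule integral_mono_AE)
    show "AE y in M. \<bar>\<phi> y * h y\<bar> \<le> 3 * \<rho> * \<phi> y"
      using AE_E
    proof eventually_elim
      case (elim y)
      show ?case
      proof (cases "2 * B * \<rho> \<le> dist x y")
        case False
        then have "\<bar>h y\<bar> \<le> 3 * \<rho>" using G1 elim by simp
        then show ?thesis using \<phi>[of y] by (simp add: abs_mult mult.commute mult_left_mono)
      qed (use \<phi>0 in auto)
    qed
  qed (use int\<phi> int\<phi>h in auto)
  finally have "\<bar>m\<bar> \<le> 3 * \<rho>" using I unfolding m_def by (simp add: field_simps)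
  have "(\<integral>y. \<phi> y * (h y - m) \<partial>M) = (\<integral>y. \<phi> y * h y - m * \<phi> y \<partial>M)"
    by (simp add: algebra_simps)
  also have "\<dots> = 0" using int\<phi> int\<phi>h I by (simp add: m_def)
  finally show thesis by (rule that[OF \<open>\<bar>m\<bar> \<le> 3 * \<rho>\<close>])
qed

lemma pair_integral_le:
  fixes f :: "'a \<times> 'a \<Rightarrow> real"
  assumes f: "f \<in> borel_measurable (M \<Otimes>\<^sub>M M)" "\<And>p. \<bar>f p\<bar> \<le> K"
    and x: "x \<in> E" "0 < r" and c: "0 \<le> c"
    and bd: "\<And>u. u \<in> E \<Longrightarrow> (\<integral>y. f (u, y) \<partial>M) \<le> c * indicator (ball x r) u"
  shows "(\<integral>p. f p \<partial>(M \<Otimes>\<^sub>M M)) \<le> c * (C * r ^ n)"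
proof -
  interpret P: pair_sigma_finite M M ..
  have int: "integrable (M \<Otimes>\<^sub>M M) f" by (rule integrable_pair_bounded[OF f])
  have "(\<integral>p. f p \<partial>(M \<Otimes>\<^sub>M M)) = (\<integral>u. (\<integral>y. f (u, y) \<partial>M) \<partial>M)"
    using P.integral_fst'[OF int] by simp
  also have "\<dots> \<le> (\<integral>u. c * indicator (ball x r) u \<partial>M)"
  proof (rule integral_mono_AE)
    show "integrable M (\<lambda>u. c * indicator (ball x r) u)"
      using c by (intro integrable_bounded[of _ c]) (auto simp: sets_M indicator_def)
  qed (use AE_E P.integrable_fst'[OF int] bd in \<open>auto elim!: eventually_mono\<close>)
  also have "\<dots> = c * measure M (ball x r)" by (simp add: sets_M)
  also have "\<dots> \<le> c * (C * r ^ n)" using upper x c by (intro mult_left_mono) auto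
  finally show ?thesis .
qed

lemma pair_integral_ge:
  fixes f :: "'a \<times> 'a \<Rightarrow> real"
  assumes f: "f \<in> borel_measurable (M \<Otimes>\<^sub>M M)" "\<And>p. \<bar>f p\<bar> \<le> K"
    and c: "0 \<le> c"
    and bd: "\<And>u. u \<in> E \<Longrightarrow> c * indicator (ball x r) u \<le> (\<integral>y. f (u, y) \<partial>M)"
  shows "c * measure M (ball x r) \<le> (\<integral>p. f p \<partial>(M \<Otimes>\<^sub>M M))"
proof -
  interpret P: pair_sigma_finite M M ..
  have int: "integrable (M \<Otimes>\<^sub>M M) f" by (rule integrable_pair_bounded[OF f])
  have "c * measure M (ball x r) = (\<integral>u. c * indicator (ball x r) u \<partial>M)" by (simp add: sets_M)
  also have "\<dots> \<le> (\<integral>u. (\<integral>y. f (u, y) \<partial>M) \<partial>M)"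
  proof (rule integral_mono_AE)
    show "integrable M (\<lambda>u. c * indicator (ball x r) u)"
      using c by (intro integrable_bounded[of _ c]) (auto simp: sets_M indicator_def)
  qed (use AE_E P.integrable_fst'[OF int] bd in \<open>auto elim!: eventually_mono\<close>)
  also have "\<dots> = (\<integral>p. f p \<partial>(M \<Otimes>\<^sub>M M))" using P.integral_fst'[OF int] by simp
  finally show ?thesis .
qed

end

lemma ball_in_borel [measurable]: "ball x r \<in> sets borel"
  by simp

lemma Compl_ball_in_borel [measurable]: "- ball x r \<in> sets borel"
  by (simp add: borel_closed closed_Compl)

text \<open>The component in direction \<open>\<nu>\<close> of the truncated Riesz kernel. It is
  antisymmetric and bounded by \<open>1 / \<epsilon> ^ n\<close>, so it can be integrated over the
  square of a finite measure and the variables can be swapped.\<close>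

definition riesz_comp :: "nat \<Rightarrow> 'a::euclidean_space \<Rightarrow> real \<Rightarrow> 'a \<Rightarrow> 'a \<Rightarrow> real" where
  "riesz_comp n \<nu> \<epsilon> u y = (if \<epsilon> < norm (u - y) then \<nu> \<bullet> (u - y) / norm (u - y) ^ Suc n else 0)"

lemma riesz_comp_commute: "riesz_comp n \<nu> \<epsilon> y u = - riesz_comp n \<nu> \<epsilon> u y"
proof -
  have "\<nu> \<bullet> (y - u) = - (\<nu> \<bullet> (u - y))" by (simp add: inner_diff_right)
  then show ?thesis by (simp add: riesz_comp_def norm_minus_commute)
qed

lemma riesz_comp_measurable [measurable]:
  "(\<lambda>p. riesz_comp n \<nu> \<epsilon> (fst p) (snd p)) \<in> borel_measurable (borel \<Otimes>\<^sub>M borel)"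
  unfolding riesz_comp_def by measurable

lemma abs_riesz_comp_le:
  assumes "norm \<nu> = 1" "0 < \<epsilon>"
  shows "\<bar>riesz_comp n \<nu> \<epsilon> u y\<bar> \<le> 1 / \<epsilon> ^ n"
proof (cases "\<epsilon> < norm (u - y)")
  case True
  then have "\<bar>riesz_comp n \<nu> \<epsilon> u y\<bar> \<le> norm (u - y) / norm (u - y) ^ Suc n"
    using Cauchy_Schwarz_ineq2[of \<nu> "u - y"] assms
    by (simp add: riesz_comp_def abs_mult divide_right_mono del: power_Suc)
  also have "\<dots> = 1 / norm (u - y) ^ n" using True assms by auto
  also have "\<dots> \<le> 1 / \<epsilon> ^ n" using True assms by (intro frac_le power_mono) auto
  finally show ?thesis .
qed (use assms in \<open>simp add: riesz_comp_def\<close>)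

section \<open>Double integrals: main term, cutoff error, far field\<close>

context upper_regular
begin

lemma pair_measurable_borel:
  "f \<in> borel_measurable (borel \<Otimes>\<^sub>M borel) \<Longrightarrow> f \<in> borel_measurable (M \<Otimes>\<^sub>M M)"
  using measurable_cong_sets[OF sets_pair_measure_cong[OF sets_M sets_M] refl, of borel] by blast

text \<open>\<open>G\<close> is a minorant of the main term after antisymmetrization; it keeps only
  pairs at distance below \<open>7 * \<rho>\<close> whose heights differ by more than
  \<open>\<rho> / 8\<close>. For each \<open>u\<close>, \<open>G2\<close> provides a point
  \<open>e\<close> at distance at most \<open>6 * \<rho>\<close> and height difference at least
  \<open>\<rho> / 4\<close>, and every point of the ball of radius \<open>\<rho> / 8\<close> around
  \<open>e\<close> still forms such a pair with \<open>u\<close>.\<close>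

lemma bump_main_term:
  fixes x \<nu> :: 'a and \<rho> B A :: real
  defines "h \<equiv> \<lambda>y. \<nu> \<bullet> (y - x)"
  defines "G \<equiv> \<lambda>(u, y). indicator (ball x (B * \<rho>)) u * indicator (ball x (A * \<rho>)) y
      * (if dist u y < 7 * \<rho> \<and> \<rho> / 8 < \<bar>h u - h y\<bar> then (\<rho> / 8)\<^sup>2 / (7 * \<rho>) ^ Suc n else 0)"
  assumes pos: "0 < \<rho>" "1 \<le> B" "8 * B \<le> A"
    and x: "x \<in> E" and \<nu>: "norm \<nu> = 1"
    and lower: "\<And>u r. u \<in> E \<Longrightarrow> 0 < r \<Longrightarrow> ball u r \<subseteq> ball x (A * \<rho>) \<Longrightarrow> r ^ n / C \<le> measure M (ball u r)"
    and G2: "\<And>y. y \<in> E \<Longrightarrow> dist x y < B * \<rho> \<Longrightarrow> \<exists>e\<in>E. dist y e \<le> 6 * \<rho> \<and> \<rho> / 4 \<le> \<bar>h y - h e\<bar>"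
  shows "\<rho> * (B * \<rho>) ^ n / (64 * 8 ^ n * 7 ^ Suc n * C\<^sup>2) \<le> (\<integral>p. G p \<partial>(M \<Otimes>\<^sub>M M))"
    and "integrable (M \<Otimes>\<^sub>M M) G"
proof -
  define cm where "cm = (\<rho> / 8)\<^sup>2 / (7 * \<rho>) ^ Suc n"
  have cm: "0 < cm" using pos by (simp add: cm_def)
  have G_meas: "G \<in> borel_measurable (M \<Otimes>\<^sub>M M)"
    unfolding G_def h_def case_prod_beta by (rule pair_measurable_borel) measurable
  have G_bd: "\<bar>G p\<bar> \<le> cm" for p
  proof -
    have "G p = indicator (ball x (B * \<rho>)) (fst p) * indicator (ball x (A * \<rho>)) (snd p)
      * (if dist (fst p) (snd p) < 7 * \<rho> \<and> \<rho> / 8 < \<bar>h (fst p) - h (snd p)\<bar> then cm else 0)"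
      by (simp add: G_def cm_def case_prod_beta)
    then show ?thesis using cm by (auto simp: indicator_def)
  qed
  show int: "integrable (M \<Otimes>\<^sub>M M) G"
    using G_meas G_bd by (rule integrable_pair_bounded)
  have hlip: "\<bar>h u - h y\<bar> \<le> dist u y" for u y
    using Cauchy_Schwarz_ineq2[of \<nu> "u - y"] \<nu> by (simp add: h_def dist_norm inner_diff_right)
  have "cm * ((\<rho> / 8) ^ n / C) * indicator (ball x (B * \<rho>)) u \<le> (\<integral>y. G (u, y) \<partial>M)" if "u \<in> E" for u
  proof (cases "u \<in> ball x (B * \<rho>)")
    case True
    then obtain e where e: "e \<in> E" "dist u e \<le> 6 * \<rho>" "\<rho> / 4 \<le> \<bar>h u - h e\<bar>"
      using G2 \<open>u \<in> E\<close> by auto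
    have sub: "ball e (\<rho> / 8) \<subseteq> ball x (A * \<rho>)"
    proof
      fix y assume "y \<in> ball e (\<rho> / 8)"
      then have "dist x y < B * \<rho> + 6 * \<rho> + \<rho> / 8"
        using dist_triangle[of x y u] dist_triangle[of u y e] True e by auto
      also have "\<dots> \<le> (8 * B) * \<rho>"
        using mult_right_mono[OF \<open>1 \<le> B\<close>, of \<rho>] pos by (simp add: algebra_simps)
      also have "\<dots> \<le> A * \<rho>" using pos by (intro mult_right_mono) auto
      finally show "y \<in> ball x (A * \<rho>)" by simp
    qed
    have "cm * ((\<rho> / 8) ^ n / C) \<le> cm * measure M (ball e (\<rho> / 8))"
      using lower[OF e(1) _ sub] pos cm by (intro mult_left_mono) auto
    also have "\<dots> = (\<integral>y. cm * indicator (ball e (\<rho> / 8)) y \<partial>M)" by (simp add: sets_M)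
    also have "\<dots> \<le> (\<integral>y. G (u, y) \<partial>M)"
    proof (rule integral_mono)
      show "integrable M (\<lambda>y. cm * indicator (ball e (\<rho> / 8)) y)"
        using cm by (intro integrable_bounded[of _ cm]) (auto simp: sets_M indicator_def)
      have "(\<lambda>y. G (u, y)) \<in> borel_measurable M"
        using G_meas sets_eq_imp_space_eq[OF sets_M] by (intro measurable_Pair2) auto
      then show "integrable M (\<lambda>y. G (u, y))"
        using G_bd by (intro integrable_bounded[of _ cm]) auto
      fix y
      show "cm * indicator (ball e (\<rho> / 8)) y \<le> G (u, y)"
      proof (cases "y \<in> ball e (\<rho> / 8)")
        case y: True
        have "dist u y < 7 * \<rho>" using dist_triangle[of u y e] y e pos by auto
        moreover have "\<rho> / 8 < \<bar>h u - h y\<bar>" using hlip[of e y] y e(3) unfolding mem_ball by linarith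
        ultimately show ?thesis using y True sub by (auto simp: G_def cm_def)
      qed (use cm in \<open>auto simp: G_def indicator_def cm_def\<close>)
    qed
    finally show ?thesis using True by simp
  next
    case False
    then show ?thesis by (auto simp: G_def)
  qed
  then have "cm * ((\<rho> / 8) ^ n / C) * measure M (ball x (B * \<rho>)) \<le> (\<integral>p. G p \<partial>(M \<Otimes>\<^sub>M M))"
    using cm pos C_pos by (intro pair_integral_ge[OF G_meas G_bd]) auto
  moreover have "(B * \<rho>) ^ n / C \<le> measure M (ball x (B * \<rho>))"
  proof (rule lower[OF x])
    have "B * \<rho> \<le> A * \<rho>" using pos by (intro mult_right_mono) auto
    then show "ball x (B * \<rho>) \<subseteq> ball x (A * \<rho>)" by (rule subset_ball)
  qed (use pos in auto)
  then have "cm * ((\<rho> / 8) ^ n / C) * ((B * \<rho>) ^ n / C)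
      \<le> cm * ((\<rho> / 8) ^ n / C) * measure M (ball x (B * \<rho>))"
    using cm pos C_pos by (intro mult_left_mono) auto
  moreover have "cm * ((\<rho> / 8) ^ n / C) * ((B * \<rho>) ^ n / C)
      = \<rho> * (B * \<rho>) ^ n / (64 * 8 ^ n * 7 ^ Suc n * C\<^sup>2)"
    using pos C_pos by (simp add: cm_def power_divide power_mult_distrib power2_eq_square field_simps)
  ultimately show "\<rho> * (B * \<rho>) ^ n / (64 * 8 ^ n * 7 ^ Suc n * C\<^sup>2) \<le> (\<integral>p. G p \<partial>(M \<Otimes>\<^sub>M M))"
    by linarith
qed

text \<open>\<open>u\<close> runs over the support of the cutoff and \<open>y\<close> over the whole
  slab ball: the inner integral gives \<open>sqrt (2 * R)\<close>, the outer one
  \<open>r ^ n\<close>. That \<open>R\<close> and not \<open>r\<close> stands under the root is what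
  brings \<open>A\<close> into the cutoff error.\<close>

lemma bump_cutoff_error:
  fixes x :: 'a and R r \<epsilon> :: real
  defines "w \<equiv> \<lambda>(u, y). indicator (ball x r) u * indicator (ball x R) y
      * (if \<epsilon> < dist u y then sqrt (dist u y) / dist u y ^ n else 0)"
  assumes pos: "0 < r" "r \<le> R" "0 < \<epsilon>" and x: "x \<in> E"
  shows "(\<integral>p. w p \<partial>(M \<Otimes>\<^sub>M M)) \<le> 2 * (C * 4 ^ n * sqrt (2 * R)) * (C * r ^ n)"
    and "integrable (M \<Otimes>\<^sub>M M) w"
proof -
  have w_meas: "w \<in> borel_measurable (M \<Otimes>\<^sub>M M)"
    unfolding w_def case_prod_beta by (rule pair_measurable_borel) measurable
  have w_bd: "\<bar>w p\<bar> \<le> sqrt (2 * R) / \<epsilon> ^ n" for p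
  proof -
    obtain u y where p: "p = (u, y)" by fastforce
    show ?thesis
    proof (cases "u \<in> ball x r \<and> y \<in> ball x R \<and> \<epsilon> < dist u y")
      case True
      have "dist u y \<le> 2 * R" using dist_triangle2[of u y x] True pos by (auto simp: dist_commute)
      then have "sqrt (dist u y) / dist u y ^ n \<le> sqrt (2 * R) / \<epsilon> ^ n"
        using True pos by (intro frac_le power_mono) auto
      then show ?thesis using True by (simp add: p w_def)
    qed (use pos in \<open>auto simp: p w_def\<close>)
  qed
  show "integrable (M \<Otimes>\<^sub>M M) w" using w_meas w_bd by (rule integrable_pair_bounded)
  show "(\<integral>p. w p \<partial>(M \<Otimes>\<^sub>M M)) \<le> 2 * (C * 4 ^ n * sqrt (2 * R)) * (C * r ^ n)"
  proof (rule pair_integral_le[OF w_meas w_bd x])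
    fix u assume u: "u \<in> E"
    show "(\<integral>y. w (u, y) \<partial>M) \<le> 2 * (C * 4 ^ n * sqrt (2 * R)) * indicator (ball x r) u"
    proof (cases "u \<in> ball x r")
      case True
      have "(\<integral>y. w (u, y) \<partial>M) \<le> 2 * (C * 4 ^ n * sqrt (2 * R))"
      proof (rule integral_near_le[OF u])
        fix y assume y: "2 * R \<le> dist u y \<or> y = u"
        have "dist u y < 2 * R" if "y \<in> ball x R"
          using that True dist_triangle2[of u y x] pos by (auto simp: dist_commute)
        then show "w (u, y) \<le> 0" using y pos by (auto simp: w_def indicator_def)
      qed (use pos in \<open>auto simp: w_def indicator_def\<close>)
      then show ?thesis using True by simp
    qed (simp add: w_def)
  qed (use pos C_pos in auto)
qed

text \<open>The kernel is centred at \<open>x\<close> and does not see \<open>u\<close>: up to a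
  factor it majorizes the difference between the Riesz kernel at \<open>u\<close> and at
  \<open>x\<close>.\<close>

lemma far_field_bound:
  fixes x :: 'a and R r \<epsilon> :: real
  defines "w \<equiv> \<lambda>(u, y). indicator (ball x r) u * (indicator (- ball x R) y / dist x y ^ Suc n)"
  assumes pos: "0 < r" "0 < R" and x: "x \<in> E"
  shows "(\<integral>p. w p \<partial>(M \<Otimes>\<^sub>M M)) \<le> 2 * (C * 2 ^ n / R) * (C * r ^ n)"
    and "integrable (M \<Otimes>\<^sub>M M) w"
proof -
  have w_meas: "w \<in> borel_measurable (M \<Otimes>\<^sub>M M)"
    unfolding w_def case_prod_beta by (rule pair_measurable_borel) measurable
  have w_bd: "\<bar>w p\<bar> \<le> 1 / R ^ Suc n" for p
  proof -
    obtain u y where p: "p = (u, y)" by fastforce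
    show ?thesis
    proof (cases "u \<in> ball x r \<and> y \<notin> ball x R")
      case True
      have "1 / dist x y ^ Suc n \<le> 1 / R ^ Suc n"
        using True pos by (intro frac_le power_mono zero_less_power) auto
      then show ?thesis using True by (simp add: p w_def)
    qed (use pos in \<open>auto simp: p w_def\<close>)
  qed
  show "integrable (M \<Otimes>\<^sub>M M) w" using w_meas w_bd by (rule integrable_pair_bounded)
  show "(\<integral>p. w p \<partial>(M \<Otimes>\<^sub>M M)) \<le> 2 * (C * 2 ^ n / R) * (C * r ^ n)"
  proof (rule pair_integral_le[OF w_meas w_bd x])
    fix u assume u: "u \<in> E"
    show "(\<integral>y. w (u, y) \<partial>M) \<le> 2 * (C * 2 ^ n / R) * indicator (ball x r) u"
    proof (cases "u \<in> ball x r")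
      case True
      have "(\<integral>y. w (u, y) \<partial>M) \<le> 2 * (C * 2 ^ n / R)"
        by (rule integral_far_le[OF x]) (use pos in \<open>auto simp: w_def indicator_def\<close>)
      then show ?thesis using True by simp
    qed (simp add: w_def)
  qed (use pos C_pos in auto)
qed

end

section \<open>A test function seeing non-flatness\<close>

context upper_regular
begin

text \<open>In units of \<open>\<rho> * (B * \<rho>) ^ n\<close> the main term is at least
  \<open>\<kappa>\<close>, and \<open>AB\<close> asks that the two errors take at most half of it.
  The bound \<open>\<epsilon> \<le> \<rho> / 8\<close> keeps the pairs counted in the main term
  outside the truncation. The Lipschitz constant 7 is 1 from the height plus 6 from the cutoff,
  whose slope \<open>1 / (B * \<rho>)\<close> is multiplied by
  \<open>\<bar>h y - m\<bar> \<le> 6 * \<rho>\<close>.\<close>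

lemma nonflat_test_function:
  fixes x \<nu> :: 'a and \<rho> B A \<epsilon> :: real
  defines "h \<equiv> \<lambda>y. \<nu> \<bullet> (y - x)"
    and "\<kappa> \<equiv> 1 / (64 * 8 ^ n * 7 ^ Suc n * C\<^sup>2)"
  assumes pos: "0 < \<rho>" "1 \<le> B" "8 * B \<le> A" "0 < \<epsilon>" "\<epsilon> \<le> \<rho> / 8"
    and x: "x \<in> E" and \<nu>: "norm \<nu> = 1"
    and lower: "\<And>u r. u \<in> E \<Longrightarrow> 0 < r \<Longrightarrow> ball u r \<subseteq> ball x (A * \<rho>) \<Longrightarrow> r ^ n / C \<le> measure M (ball u r)"
    and G1: "\<And>y. y \<in> E \<Longrightarrow> dist x y < A * \<rho> \<Longrightarrow> \<bar>h y\<bar> \<le> 3 * \<rho>"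
    and G2: "\<And>y. y \<in> E \<Longrightarrow> dist x y < B * \<rho> \<Longrightarrow> \<exists>e\<in>E. dist y e \<le> 6 * \<rho> \<and> \<rho> / 4 \<le> \<bar>h y - h e\<bar>"
    and AB: "24 * C\<^sup>2 * 8 ^ n * sqrt (12 * A) / B
        + 48 * ((2 * real n + 3) * 2 ^ Suc n) * C\<^sup>2 * 4 ^ n * B / A \<le> \<kappa> / 2"
  shows "\<exists>\<psi>. \<psi> \<in> borel_measurable borel \<and> (\<forall>y\<in>E. \<bar>\<psi> y\<bar> \<le> 6 * \<rho>)
    \<and> (\<forall>y. 2 * B * \<rho> \<le> dist x y \<longrightarrow> \<psi> y = 0)
    \<and> (\<forall>u\<in>E. \<forall>y\<in>E. \<bar>\<psi> u - \<psi> y\<bar> \<le> 7 * dist u y)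
    \<and> (\<integral>y. \<psi> y \<partial>M) = 0
    \<and> \<kappa> / 4 * \<rho> ^ Suc n \<le> (\<integral>u. \<psi> u * (\<integral>y. riesz_comp n \<nu> \<epsilon> u y \<partial>M) \<partial>M)"
proof -
  interpret P: pair_sigma_finite M M ..
  define \<phi> where "\<phi> y = max 0 (min 1 (2 - dist x y / (B * \<rho>)))" for y
  define r where "r = 2 * B * \<rho>"
  define R where "R = A * \<rho>"
  have r: "0 < r" "\<rho> \<le> r" "4 * r \<le> R"
    using pos mult_right_mono[of 1 B \<rho>] mult_right_mono[of "8 * B" A \<rho>] by (auto simp: r_def R_def)
  have R: "0 < R" "r \<le> R" using r by auto
  have "0 < (B * \<rho>) ^ n / C" using pos C_pos by simp
  also have "\<dots> \<le> measure M (ball x (B * \<rho>))"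
    using r pos by (intro lower[OF x] subset_ball) (auto simp: r_def R_def)
  finally have mass: "0 < measure M (ball x (B * \<rho>))" .
  have "\<bar>\<nu> \<bullet> (y - x)\<bar> \<le> 3 * \<rho>" if "y \<in> E" "dist x y < 2 * B * \<rho>" for y
    using G1[of y] that r by (simp add: h_def r_def R_def)
  from mean_zero_bump[OF pos(1) _ this mass \<nu>] obtain m where "\<bar>m\<bar> \<le> 3 * \<rho>"
    and "(\<integral>y. max 0 (min 1 (2 - dist x y / (B * \<rho>))) * (\<nu> \<bullet> (y - x) - m) \<partial>M) = 0"
    using pos(2) by auto
  then have m: "\<bar>m\<bar> \<le> 3 * \<rho>" "(\<integral>y. \<phi> y * (h y - m) \<partial>M) = 0"
    by (simp_all only: \<phi>_def h_def)
  define \<psi> where "\<psi> y = \<phi> y * (h y - m)" for y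
  have [measurable]: "h \<in> borel_measurable borel" "\<phi> \<in> borel_measurable borel"
    unfolding h_def \<phi>_def by measurable
  have \<psi>_meas[measurable]: "\<psi> \<in> borel_measurable borel" unfolding \<psi>_def by measurable
  have \<phi>: "0 \<le> \<phi> y" "\<phi> y \<le> 1" for y by (auto simp: \<phi>_def)
  have \<phi>0: "\<phi> y = 0" if "r \<le> dist x y" for y
  proof -
    have "2 \<le> dist x y / (B * \<rho>)" using that pos by (simp add: field_simps r_def)
    then show ?thesis by (simp add: \<phi>_def)
  qed
  have \<phi>1: "\<phi> y = 1" if "dist x y \<le> B * \<rho>" for y
    using that pos by (auto simp: \<phi>_def field_simps)
  have \<phi>lip: "\<bar>\<phi> u - \<phi> y\<bar> \<le> dist u y / (B * \<rho>)" for u y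
  proof -
    have "\<bar>\<phi> u - \<phi> y\<bar> \<le> \<bar>dist x u / (B * \<rho>) - dist x y / (B * \<rho>)\<bar>"
      unfolding \<phi>_def by linarith
    also have "\<dots> = \<bar>dist x u - dist x y\<bar> / (B * \<rho>)"
      using pos by (simp add: diff_divide_distrib[symmetric])
    also have "\<dots> \<le> dist u y / (B * \<rho>)"
      using pos dist_triangle[of x u y] dist_triangle[of x y u]
      by (intro divide_right_mono) (auto simp: dist_commute)
    finally show ?thesis .
  qed
  have hlip: "\<bar>h u - h y\<bar> \<le> dist u y" for u y
    using Cauchy_Schwarz_ineq2[of \<nu> "u - y"] \<nu> by (simp add: h_def dist_norm inner_diff_right)
  have hx: "\<bar>h y\<bar> \<le> dist x y" for y using hlip[of y x] by (simp add: h_def dist_commute)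
  have hm: "\<bar>h y - m\<bar> \<le> 6 * \<rho>" if "y \<in> E" "dist x y < R" for y
    using G1[of y] m(1) that unfolding R_def by linarith
  have \<psi>0: "\<psi> y = 0" if "r \<le> dist x y" for y using \<phi>0[OF that] by (simp add: \<psi>_def)
  have \<psi>E: "\<bar>\<psi> y\<bar> \<le> 6 * \<rho>" if "y \<in> E" for y
  proof (cases "r \<le> dist x y")
    case False
    then have "\<bar>\<psi> y\<bar> \<le> 1 * (6 * \<rho>)"
      unfolding \<psi>_def abs_mult using \<phi>[of y] hm[OF that] R by (intro mult_mono) auto
    then show ?thesis by simp
  qed (use \<psi>0 pos in auto)
  have \<psi>bd: "\<bar>\<psi> y\<bar> \<le> r + 3 * \<rho>" for y
  proof (cases "r \<le> dist x y")
    case False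
    then have "\<bar>\<psi> y\<bar> \<le> 1 * (r + 3 * \<rho>)"
      unfolding \<psi>_def abs_mult using \<phi>[of y] hx[of y] m(1) by (intro mult_mono) auto
    then show ?thesis by simp
  qed (use \<psi>0 pos r in auto)
  have \<psi>lip1: "\<bar>\<psi> u - \<psi> y\<bar> \<le> 7 * dist u y" if "u \<in> E" "y \<in> E" "dist x y < r" for u y
  proof -
    have eq: "\<psi> u - \<psi> y = \<phi> u * (h u - h y) + (\<phi> u - \<phi> y) * (h y - m)"
      by (simp add: \<psi>_def algebra_simps)
    have "\<bar>\<phi> u * (h u - h y)\<bar> \<le> 1 * dist u y"
      unfolding abs_mult using \<phi>[of u] hlip by (intro mult_mono) auto
    moreover have "\<bar>(\<phi> u - \<phi> y) * (h y - m)\<bar> \<le> dist u y / (B * \<rho>) * (6 * \<rho>)"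
      unfolding abs_mult using \<phi>lip hm[of y] that R pos by (intro mult_mono) auto
    moreover have "dist u y / (B * \<rho>) * (6 * \<rho>) \<le> 6 * dist u y"
      using pos mult_right_mono[of 1 B "dist u y"] by (simp add: field_simps)
    ultimately show ?thesis unfolding eq by linarith
  qed
  have \<psi>lip: "\<bar>\<psi> u - \<psi> y\<bar> \<le> 7 * dist u y" if "u \<in> E" "y \<in> E" for u y
  proof -
    consider "dist x y < r" | "dist x u < r" | "r \<le> dist x y" "r \<le> dist x u" by linarith
    then show ?thesis
    proof cases
      case 2
      then show ?thesis using \<psi>lip1[of y u] that by (simp add: dist_commute abs_minus_commute)
    qed (use \<psi>lip1 that \<psi>0 in auto)
  qed
  let ?k = "riesz_comp n \<nu> \<epsilon>"
  note kbd = abs_riesz_comp_le[OF \<nu> pos(4), of n]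
  have int_pair: "integrable (M \<Otimes>\<^sub>M M) f"
    if "f \<in> borel_measurable (borel \<Otimes>\<^sub>M borel)" "\<And>p. \<bar>f p\<bar> \<le> K" for f :: "'a \<times> 'a \<Rightarrow> real" and K
    using that pair_measurable_borel by (intro integrable_pair_bounded) auto
  define full where "full = (\<lambda>(u, y). \<psi> u * ?k u y)"
  \<comment> \<open>The indicator in \<open>u\<close> does not change the product, since
    \<open>\<psi>\<close> vanishes outside \<open>ball x r\<close>; it makes the domain symmetric,
    so that swapping the variables turns \<open>near\<close> into \<open>- near'\<close>.\<close>
  define near where "near = (\<lambda>(u, y). indicator (ball x R) u * indicator (ball x R) y * (\<psi> u * ?k u y))"
  define near' where "near' = (\<lambda>(u, y). indicator (ball x R) u * indicator (ball x R) y * (\<psi> y * ?k u y))"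
  define far where "far = (\<lambda>(u, y). indicator (- ball x R) y * (\<psi> u * ?k u y))"
  \<comment> \<open>The far part with the kernel frozen at the centre \<open>x\<close>. The two
    variables then separate and the vanishing mean of \<open>\<psi>\<close> makes the integral zero,
    so only the oscillation of the kernel between \<open>u\<close> and \<open>x\<close> has to be
    estimated.\<close>
  define far0 where "far0 = (\<lambda>(u, y). \<psi> u * (indicator (- ball x R) y * ?k x y))"
  let ?K = "(r + 3 * \<rho>) * (1 / \<epsilon> ^ n)"
  have pk: "\<bar>\<psi> v * ?k u y\<bar> \<le> ?K" for u y v
    unfolding abs_mult using \<psi>bd kbd r pos by (intro mult_mono) auto
  have K0: "0 \<le> ?K" using r pos by simp
  have int_full: "integrable (M \<Otimes>\<^sub>M M) full"
    unfolding full_def case_prod_beta by (rule int_pair[of _ ?K]) (measurable, use pk in auto)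
  have int_near: "integrable (M \<Otimes>\<^sub>M M) near"
    unfolding near_def case_prod_beta
    by (rule int_pair[of _ ?K]) (measurable, use pk K0 in \<open>auto simp: indicator_def\<close>)
  have int_near': "integrable (M \<Otimes>\<^sub>M M) near'"
    unfolding near'_def case_prod_beta
    by (rule int_pair[of _ ?K]) (measurable, use pk K0 in \<open>auto simp: indicator_def\<close>)
  have int_far: "integrable (M \<Otimes>\<^sub>M M) far"
    unfolding far_def case_prod_beta
    by (rule int_pair[of _ ?K]) (measurable, use pk K0 in \<open>auto simp: indicator_def\<close>)
  have [measurable]: "(\<lambda>y. ?k x y) \<in> borel_measurable borel"
    unfolding riesz_comp_def by measurable
  have int_far0: "integrable (M \<Otimes>\<^sub>M M) far0"
    unfolding far0_def case_prod_beta
    by (rule int_pair[of _ ?K]) (measurable, use pk K0 in \<open>auto simp: indicator_def\<close>)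
  have far0_0: "(\<integral>p. far0 p \<partial>(M \<Otimes>\<^sub>M M)) = 0"
    using P.integral_fst'[OF int_far0] m(2) by (simp add: far0_def \<psi>_def)
  have "near p + far p = full p" for p
    using \<psi>0[of "fst p"] R by (auto simp: near_def far_def full_def case_prod_beta indicator_def)
  then have full: "(\<integral>p. full p \<partial>(M \<Otimes>\<^sub>M M)) = (\<integral>p. near p \<partial>(M \<Otimes>\<^sub>M M)) + (\<integral>p. far p \<partial>(M \<Otimes>\<^sub>M M))"
    using int_near int_far by (simp flip: Bochner_Integration.integral_add)
  have anti: "near (snd p, fst p) = - near' p" for p
    using riesz_comp_commute[of n \<nu> \<epsilon> "snd p" "fst p"]
    by (simp add: near_def near'_def case_prod_beta)
  have "(\<integral>p. near p \<partial>(M \<Otimes>\<^sub>M M)) = (\<integral>p. near (snd p, fst p) \<partial>(M \<Otimes>\<^sub>M M))"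
    using P.integral_product_swap[of near] int_near by (simp add: case_prod_unfold)
  also have "\<dots> = - (\<integral>p. near' p \<partial>(M \<Otimes>\<^sub>M M))"
    by (simp add: anti)
  finally have swap: "2 * (\<integral>p. near p \<partial>(M \<Otimes>\<^sub>M M)) = (\<integral>p. near p - near' p \<partial>(M \<Otimes>\<^sub>M M))"
    using int_near int_near' by simp
  define G where "G = (\<lambda>(u, y). indicator (ball x (B * \<rho>)) u * indicator (ball x (A * \<rho>)) y
      * (if dist u y < 7 * \<rho> \<and> \<rho> / 8 < \<bar>h u - h y\<bar> then (\<rho> / 8)\<^sup>2 / (7 * \<rho>) ^ Suc n else 0))"
  define w where "w = (\<lambda>(u, y). indicator (ball x r) u * indicator (ball x R) y
      * (if \<epsilon> < dist u y then sqrt (dist u y) / dist u y ^ n else 0))"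
  \<comment> \<open>Product of the slope \<open>1 / (B * \<rho>)\<close> of \<open>\<phi>\<close>,
    the bound \<open>6 * \<rho>\<close> for \<open>h - m\<close>, and the factor
    \<open>sqrt (6 * \<rho>)\<close> of the interpolated height difference.\<close>
  define D where "D = 6 * sqrt (6 * \<rho>) / B"
  have D: "0 \<le> D" using pos by (simp add: D_def)
  have G_le: "\<rho> * (B * \<rho>) ^ n * \<kappa> \<le> (\<integral>p. G p \<partial>(M \<Otimes>\<^sub>M M))" and int_G: "integrable (M \<Otimes>\<^sub>M M) G"
    using bump_main_term[OF pos(1-3) x \<nu> lower G2[unfolded h_def]] unfolding G_def h_def \<kappa>_def by auto
  have w_le: "(\<integral>p. w p \<partial>(M \<Otimes>\<^sub>M M)) \<le> 2 * (C * 4 ^ n * sqrt (2 * R)) * (C * r ^ n)"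
    and int_w: "integrable (M \<Otimes>\<^sub>M M) w"
    using bump_cutoff_error[OF r(1) R(2) pos(4) x] unfolding w_def by auto
  have int_w': "integrable (M \<Otimes>\<^sub>M M) (\<lambda>p. w (snd p, fst p))"
    using P.integrable_product_swap[OF int_w] by (simp add: case_prod_unfold)
  have w_swap: "(\<integral>p. w (snd p, fst p) \<partial>(M \<Otimes>\<^sub>M M)) = (\<integral>p. w p \<partial>(M \<Otimes>\<^sub>M M))"
    using P.integral_product_swap[of w] int_w by (simp add: case_prod_unfold)
  \<comment> \<open>\<open>w\<close> requires its first argument to be in the support ball of the
    cutoff. In the error either of \<open>u\<close> and \<open>y\<close> may be the one inside,
    hence \<open>w\<close> in both orders.\<close>
  have pointwise: "G (u, y) - D * (w (u, y) + w (y, u)) \<le> near (u, y) - near' (u, y)"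
    if E: "u \<in> E" "y \<in> E" for u y
  proof (cases "u \<in> ball x R \<and> y \<in> ball x R \<and> \<epsilon> < dist u y")
    case True
    define d where "d = dist u y"
    have d: "0 < d" unfolding d_def using True pos(4) by linarith
    define \<Delta> where "\<Delta> = h u - h y"
    have k: "?k u y = \<Delta> / d ^ Suc n"
      using True by (simp add: riesz_comp_def d_def \<Delta>_def h_def dist_norm inner_diff_right)
    have nn: "near (u, y) - near' (u, y) = \<phi> u * (\<Delta>\<^sup>2 / d ^ Suc n) + (\<phi> u - \<phi> y) * (h y - m) * (\<Delta> / d ^ Suc n)"
    proof -
      define q where "q = inverse (d ^ Suc n)"
      have "near (u, y) - near' (u, y) = (\<psi> u - \<psi> y) * (\<Delta> * q)"
        using True by (simp add: near_def near'_def k q_def divide_inverse left_diff_distrib del: power_Suc)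
      also have "\<dots> = \<phi> u * (\<Delta>\<^sup>2 * q) + (\<phi> u - \<phi> y) * (h y - m) * (\<Delta> * q)"
        by (simp add: \<psi>_def \<Delta>_def algebra_simps power2_eq_square)
      finally show ?thesis by (simp add: q_def divide_inverse)
    qed
    have 1: "G (u, y) \<le> \<phi> u * (\<Delta>\<^sup>2 / d ^ Suc n)"
    proof (cases "u \<in> ball x (B * \<rho>) \<and> d < 7 * \<rho> \<and> \<rho> / 8 < \<bar>\<Delta>\<bar>")
      case c: True
      have "(\<rho> / 8)\<^sup>2 \<le> \<bar>\<Delta>\<bar>\<^sup>2" using c pos by (intro power_mono) auto
      then have sq: "(\<rho> / 8)\<^sup>2 \<le> \<Delta>\<^sup>2" by simp
      have "(\<rho> / 8)\<^sup>2 / (7 * \<rho>) ^ Suc n \<le> \<Delta>\<^sup>2 / d ^ Suc n"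

        using c d by (intro frac_le[OF zero_le_power2 sq zero_less_power power_mono]) auto
      then show ?thesis using c True \<phi>1[of u] by (simp add: G_def d_def \<Delta>_def R_def)
    next
      case False
      then have "G (u, y) = 0" by (auto simp: G_def d_def \<Delta>_def)
      then show ?thesis using \<phi>[of u] d by simp
    qed
    have 2: "\<bar>(\<phi> u - \<phi> y) * (h y - m) * (\<Delta> / d ^ Suc n)\<bar> \<le> D * (w (u, y) + w (y, u))"
    proof (cases "r \<le> dist x u \<and> r \<le> dist x y")
      case c: True
      then show ?thesis using \<phi>0 D by (simp add: w_def)
    next
      case c: False
      have "\<bar>\<Delta>\<bar> \<le> 6 * \<rho>" using G1[OF E(1)] G1[OF E(2)] True by (auto simp: \<Delta>_def R_def)
      moreover have "\<bar>\<Delta>\<bar> \<le> d" using hlip by (simp add: \<Delta>_def d_def)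
      ultimately have "\<bar>\<Delta>\<bar> * \<bar>\<Delta>\<bar> \<le> (6 * \<rho>) * d" by (intro mult_mono) auto
      \<comment> \<open>Interpolating the two bounds makes the error kernel \<open>d\<^bsup>1/2-n\<^esup>\<close>, integrable at \<open>0\<close>.\<close>
      then have \<Delta>: "\<bar>\<Delta>\<bar> \<le> sqrt (6 * \<rho>) * sqrt d"
        by (simp add: real_le_rsqrt power2_eq_square flip: real_sqrt_mult)
      have "\<bar>(\<phi> u - \<phi> y) * (h y - m) * (\<Delta> / d ^ Suc n)\<bar>
          \<le> d / (B * \<rho>) * (6 * \<rho>) * (sqrt (6 * \<rho>) * sqrt d / d ^ Suc n)"
      proof -
        have "\<bar>\<Delta> / d ^ Suc n\<bar> = \<bar>\<Delta>\<bar> / d ^ Suc n" using d by (simp add: abs_divide del: power_Suc)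
        also have "\<dots> \<le> sqrt (6 * \<rho>) * sqrt d / d ^ Suc n"
          using \<Delta> d by (intro divide_right_mono zero_le_power) auto
        finally show ?thesis
          unfolding abs_mult[of _ "\<Delta> / d ^ Suc n"] abs_mult[of "\<phi> u - \<phi> y"]
          using \<phi>lip[of u y] hm[OF E(2)] True d pos
          by (intro mult_mono) (auto simp: d_def simp del: power_Suc)
      qed
      also have "\<dots> = D * (sqrt d / d ^ n)"
        using d pos by (simp add: D_def field_simps)
      also have "\<dots> \<le> D * (w (u, y) + w (y, u))"
        using c True D by (intro mult_left_mono) (auto simp: w_def d_def dist_commute indicator_def)
      finally show ?thesis .
    qed
    have "a - f \<le> b + e" if "a \<le> b" "\<bar>e\<bar> \<le> f" for a b e f :: real using that by linarith
    from this[OF 1 2] show ?thesis unfolding nn .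
  next
    case False
    have "G (u, y) = 0"
    proof (rule ccontr)
      assume G: "G (u, y) \<noteq> 0"
      have "u \<in> ball x (B * \<rho>)" "y \<in> ball x R" "\<rho> / 8 < \<bar>h u - h y\<bar>"
        using G by (auto simp: G_def indicator_def R_def split: if_splits)
      moreover have "B * \<rho> \<le> R" using r unfolding r_def by linarith
      ultimately have "u \<in> ball x R" "y \<in> ball x R" "\<epsilon> < dist u y"
        using hlip[of u y] pos by auto
      then show False using False by blast
    qed
    moreover have "0 \<le> w (u, y)" "0 \<le> w (y, u)" by (auto simp: w_def)
    moreover have "near (u, y) = 0" "near' (u, y) = 0"
      using False by (auto simp: near_def near'_def riesz_comp_def dist_norm indicator_def)
    ultimately show ?thesis using D by simp
  qed
  have "(\<integral>p. G p - D * (w p + w (snd p, fst p)) \<partial>(M \<Otimes>\<^sub>M M)) \<le> (\<integral>p. near p - near' p \<partial>(M \<Otimes>\<^sub>M M))"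
  proof (rule integral_mono_AE)
    show "AE p in M \<Otimes>\<^sub>M M. G p - D * (w p + w (snd p, fst p)) \<le> near p - near' p"
      using AE_pair_E
    proof eventually_elim
      case (elim p)
      then show ?case using pointwise[of "fst p" "snd p"] by simp
    qed
  qed (use int_G int_w int_w' int_near int_near' in auto)
  then have near_ge: "(\<integral>p. G p \<partial>(M \<Otimes>\<^sub>M M)) - 2 * D * (\<integral>p. w p \<partial>(M \<Otimes>\<^sub>M M)) \<le> 2 * (\<integral>p. near p \<partial>(M \<Otimes>\<^sub>M M))"
    using int_G int_w int_w' w_swap swap by simp
  define v where "v = (\<lambda>(u, y). indicator (ball x r) u * (indicator (- ball x R) y / dist x y ^ Suc n))"
  define F where "F = 6 * \<rho> * ((2 * real n + 3) * 2 ^ Suc n * r)"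
  have F: "0 \<le> F" using r pos by (simp add: F_def)
  have v_le: "(\<integral>p. v p \<partial>(M \<Otimes>\<^sub>M M)) \<le> 2 * (C * 2 ^ n / R) * (C * r ^ n)"
    and int_v: "integrable (M \<Otimes>\<^sub>M M) v"
    using far_field_bound[OF r(1) R(1) x] unfolding v_def by auto
  have far_pt: "- (F * v (u, y)) \<le> far (u, y) - far0 (u, y)" if E: "u \<in> E" "y \<in> E" for u y
  proof (cases "u \<in> ball x r \<and> y \<notin> ball x R")
    case True
    define a where "a = x - y"
    define b where "b = u - x"
    have ab: "norm b < r" "R \<le> norm a" "u - y = a + b" "x - y = a"
      using True by (auto simp: a_def b_def dist_norm norm_minus_commute)
    have "R \<le> norm (a + b) + norm b" using ab norm_triangle_ineq4[of "a + b" b] by simp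
    then have big: "\<epsilon> < norm (a + b)" "\<epsilon> < norm a" using ab r pos by linarith+
    have a0: "a \<noteq> 0" using ab(2) R(1) by (intro notI) simp
    have half: "norm b \<le> norm a / 2" using ab r by linarith
    have kd: "\<bar>?k u y - ?k x y\<bar> \<le> (2 * real n + 3) * 2 ^ Suc n * norm b / norm a ^ Suc n"
      using riesz_kernel_diff_le[OF \<nu> a0 half, of n] ab(3,4) big
      by (simp add: riesz_comp_def del: power_Suc)
    also have "\<dots> \<le> (2 * real n + 3) * 2 ^ Suc n * r / norm a ^ Suc n"
      using ab by (intro divide_right_mono mult_left_mono) auto
    finally have "\<bar>\<psi> u * (?k u y - ?k x y)\<bar> \<le> 6 * \<rho> * ((2 * real n + 3) * 2 ^ Suc n * r / norm a ^ Suc n)"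
      unfolding abs_mult using \<psi>E[OF E(1)] pos by (intro mult_mono) auto
    also have "\<dots> = F * v (u, y)"
      using True by (simp add: F_def v_def dist_norm ab(4))
    finally show ?thesis using True by (simp add: far_def far0_def algebra_simps)
  next
    case False
    then show ?thesis using \<psi>0[of u] by (auto simp: far_def far0_def v_def)
  qed
  have "(\<integral>p. - (F * v p) \<partial>(M \<Otimes>\<^sub>M M)) \<le> (\<integral>p. far p - far0 p \<partial>(M \<Otimes>\<^sub>M M))"
  proof (rule integral_mono_AE)
    show "AE p in M \<Otimes>\<^sub>M M. - (F * v p) \<le> far p - far0 p"
      using AE_pair_E
    proof eventually_elim
      case (elim p)
      then show ?case using far_pt[of "fst p" "snd p"] by simp
    qed
  qed (use int_v int_far int_far0 in auto)
  then have far_ge: "- (F * (\<integral>p. v p \<partial>(M \<Otimes>\<^sub>M M))) \<le> (\<integral>p. far p \<partial>(M \<Otimes>\<^sub>M M))"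
    using int_far int_far0 far0_0 by simp
  let ?W = "\<rho> * (B * \<rho>) ^ n"
  have "2 * D * (\<integral>p. w p \<partial>(M \<Otimes>\<^sub>M M)) \<le> 2 * D * (2 * (C * 4 ^ n * sqrt (2 * R)) * (C * r ^ n))"
    using w_le D by (intro mult_left_mono) auto
  also have "\<dots> = ?W * (24 * C\<^sup>2 * 8 ^ n * sqrt (12 * A) / B)"
  proof -
    have "sqrt (6 * \<rho>) * sqrt (2 * R) = sqrt (\<rho>\<^sup>2 * (12 * A))"
      by (simp add: R_def power2_eq_square flip: real_sqrt_mult)
    also have "\<dots> = \<rho> * sqrt (12 * A)" using pos by (simp add: real_sqrt_mult)
    finally have s: "sqrt (6 * \<rho>) * sqrt (2 * R) = \<rho> * sqrt (12 * A)" .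
    have e: "r ^ n = 2 ^ n * (B * \<rho>) ^ n" by (simp add: r_def power_mult_distrib mult.assoc)
    have e8: "(8::real) ^ n = 4 ^ n * 2 ^ n" by (simp flip: power_mult_distrib)
    have "2 * D * (2 * (C * 4 ^ n * sqrt (2 * R)) * (C * r ^ n))
        = 24 * C\<^sup>2 * 4 ^ n * r ^ n * (sqrt (6 * \<rho>) * sqrt (2 * R)) / B"
      by (simp add: D_def power2_eq_square)
    also have "\<dots> = ?W * (24 * C\<^sup>2 * 8 ^ n * sqrt (12 * A) / B)"
      unfolding s e e8 by simp
    finally show ?thesis .
  qed
  finally have 1: "2 * D * (\<integral>p. w p \<partial>(M \<Otimes>\<^sub>M M)) \<le> ?W * (24 * C\<^sup>2 * 8 ^ n * sqrt (12 * A) / B)" .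
  have "F * (\<integral>p. v p \<partial>(M \<Otimes>\<^sub>M M)) \<le> F * (2 * (C * 2 ^ n / R) * (C * r ^ n))"
    using v_le F by (intro mult_left_mono) auto
  also have "\<dots> = ?W * (24 * ((2 * real n + 3) * 2 ^ Suc n) * C\<^sup>2 * 4 ^ n * B / A)"
  proof -
    have e: "r ^ n = 2 ^ n * (B * \<rho>) ^ n" by (simp add: r_def power_mult_distrib mult.assoc)
    have e4: "(4::real) ^ n = 2 ^ n * 2 ^ n" by (simp flip: power_mult_distrib)
    have "F * (2 * (C * 2 ^ n / R) * (C * r ^ n))
        = (12 * ((2 * real n + 3) * 2 ^ Suc n) * C\<^sup>2 * 2 ^ n * r ^ n) * (\<rho> * r / R)"
      by (simp add: F_def power2_eq_square)
    also have "\<rho> * r / R = 2 * B * \<rho> / A" using pos by (simp add: r_def R_def)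
    also have "(12 * ((2 * real n + 3) * 2 ^ Suc n) * C\<^sup>2 * 2 ^ n * r ^ n) * (2 * B * \<rho> / A)
      = ?W * (24 * ((2 * real n + 3) * 2 ^ Suc n) * C\<^sup>2 * 4 ^ n * B / A)"
      unfolding e e4 by simp
    finally show ?thesis .
  qed
  finally have 2: "F * (\<integral>p. v p \<partial>(M \<Otimes>\<^sub>M M)) \<le> ?W * (24 * ((2 * real n + 3) * 2 ^ Suc n) * C\<^sup>2 * 4 ^ n * B / A)" .
  have W: "0 \<le> ?W" using pos by simp
  \<comment> \<open>Antisymmetrization estimates twice the near part directly, so on passing to
    twice the full integral only the far error is doubled; this is why \<open>AB\<close> has 48 in
    its second term.\<close>
  have "?W * (24 * C\<^sup>2 * 8 ^ n * sqrt (12 * A) / B)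
      + 2 * (?W * (24 * ((2 * real n + 3) * 2 ^ Suc n) * C\<^sup>2 * 4 ^ n * B / A)) \<le> ?W * (\<kappa> / 2)"
    using mult_left_mono[OF AB W] by (simp add: algebra_simps)
  then have "?W * (\<kappa> / 2) \<le> 2 * (\<integral>p. full p \<partial>(M \<Otimes>\<^sub>M M))"
    using 1 2 near_ge far_ge G_le full by linarith
  moreover have "\<rho> * \<rho> ^ n \<le> ?W"
    using pos mult_right_mono[of 1 B \<rho>] by (intro mult_left_mono power_mono) auto
  then have "\<rho> ^ Suc n * (\<kappa> / 2) \<le> ?W * (\<kappa> / 2)"
    using C_pos by (intro mult_right_mono) (auto simp: \<kappa>_def)
  moreover have "\<kappa> / 4 * \<rho> ^ Suc n = \<rho> ^ Suc n * (\<kappa> / 2) / 2" by simp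
  ultimately have "\<kappa> / 4 * \<rho> ^ Suc n \<le> (\<integral>p. full p \<partial>(M \<Otimes>\<^sub>M M))" by linarith
  also have "\<dots> = (\<integral>u. \<psi> u * (\<integral>y. ?k u y \<partial>M) \<partial>M)"
    using P.integral_fst'[OF int_full] by (simp add: full_def)
  finally show ?thesis
    using \<psi>_meas \<psi>E \<psi>0 \<psi>lip m(2) unfolding r_def \<psi>_def[abs_def] by (intro exI[of _ \<psi>]) (auto simp: \<psi>_def[abs_def])
qed

end

section \<open>Almost orthogonality\<close>

lemma sum_half_powers_le: "(\<Sum>l\<in>{k..<k + m}. (1/2) ^ (l - k)) \<le> (2::real)"
proof -
  have "(\<Sum>l\<in>{k..<k + m}. (1/2) ^ (l - k)) = 2 - 2 * (1/2::real) ^ m"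
    by (induction m) (auto simp: algebra_simps)
  then show ?thesis by simp
qed

context upper_regular
begin

text \<open>A wavelet-like function with centre \<open>p\<close> and scale \<open>s\<close>,
  normalized to size \<open>a\<close> independently of the scale. Size and Lipschitz bounds are
  asked on \<open>E\<close> only, where the slab condition controls the height; the 7 comes from
  \<open>nonflat_test_function\<close>.\<close>

definition adapted :: "real \<Rightarrow> 'a \<Rightarrow> real \<Rightarrow> ('a \<Rightarrow> real) \<Rightarrow> bool" where
  "adapted a p s \<psi> \<longleftrightarrow> \<psi> \<in> borel_measurable borel \<and> (\<forall>y\<in>E. \<bar>\<psi> y\<bar> \<le> a)
    \<and> (\<forall>y. a * s \<le> dist p y \<longrightarrow> \<psi> y = 0)
    \<and> (\<forall>u\<in>E. \<forall>y\<in>E. \<bar>\<psi> u - \<psi> y\<bar> \<le> 7 / s * dist u y) \<and> (\<integral>y. \<psi> y \<partial>M) = 0"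

lemma adapted_integrable:
  assumes "adapted a p s \<psi>"
  shows "integrable M \<psi>"
proof (rule integrable_const_bound[of _ a])
  show "AE y in M. norm (\<psi> y) \<le> a"
    using AE_E assms by (auto simp: adapted_def elim!: eventually_mono)
qed (use assms in \<open>simp add: adapted_def sets_M cong: measurable_cong_sets\<close>)

lemma adapted_integrable_mult:
  assumes "adapted a p s \<psi>" "adapted a' p' s' \<psi>'" "0 < a"
  shows "integrable M (\<lambda>y. \<psi> y * \<psi>' y)"
proof (rule integrable_const_bound[of _ "a * a'"])
  show "AE y in M. norm (\<psi> y * \<psi>' y) \<le> a * a'"
    using AE_E
  proof eventually_elim
    case (elim y)
    then show ?case
      using assms unfolding adapted_def real_norm_def abs_mult by (intro mult_mono) auto
  qed
  have [measurable]: "\<psi> \<in> borel_measurable borel" "\<psi>' \<in> borel_measurable borel"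
    using assms by (auto simp: adapted_def)
  show "(\<lambda>y. \<psi> y * \<psi>' y) \<in> borel_measurable M" by measurable
qed

text \<open>The finer function has mean zero, so the coarser one may be replaced by its deviation
  from its value at \<open>p2\<close>. On the support of \<open>\<psi>2\<close> this deviation is at
  most \<open>7 / s1 * (a * s2)\<close>, which gains the factor \<open>s2 / s1\<close>. Beyond
  distance \<open>2 * a * s1\<close> the supports are disjoint.\<close>

lemma adapted_correlation_le:
  assumes 1: "adapted a p1 s1 \<psi>1" and 2: "adapted a p2 s2 \<psi>2" and a: "0 < a"
    and s: "0 < s2" "s2 \<le> s1" and p2: "p2 \<in> E"
  shows "\<bar>\<integral>y. \<psi>1 y * \<psi>2 y \<partial>M\<bar>
    \<le> (if dist p1 p2 < 2 * a * s1 then 7 * a\<^sup>2 * C * a ^ n * (s2 / s1) * s2 ^ n else 0)"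
proof (cases "dist p1 p2 < 2 * a * s1")
  case False
  have z: "\<psi>1 y * \<psi>2 y = 0" for y
  proof (rule ccontr)
    assume "\<psi>1 y * \<psi>2 y \<noteq> 0"
    then have "\<not> a * s1 \<le> dist p1 y" "\<not> a * s2 \<le> dist p2 y" using 1 2 by (auto simp: adapted_def)
    moreover have "a * s2 \<le> a * s1" using a s by simp
    ultimately show False using False dist_triangle2[of p1 p2 y] by linarith
  qed
  have "(\<integral>y. \<psi>1 y * \<psi>2 y \<partial>M) = 0" unfolding z by simp
  then show ?thesis using False by simp
next
  case True
  note int1 = adapted_integrable_mult[OF 1 2 a] and int2 = adapted_integrable[OF 2]
  have mean: "(\<integral>y. \<psi>2 y \<partial>M) = 0" using 2 by (simp add: adapted_def)
  let ?q = "7 / s1 * (a * s2) * a"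
  have q: "0 \<le> ?q" using a s by simp
  have "(\<integral>y. \<psi>1 y * \<psi>2 y \<partial>M) = (\<integral>y. \<psi>1 y * \<psi>2 y - \<psi>1 p2 * \<psi>2 y \<partial>M)"
    using int1 int2 mean by simp
  also have "\<bar>\<dots>\<bar> \<le> (\<integral>y. \<bar>\<psi>1 y * \<psi>2 y - \<psi>1 p2 * \<psi>2 y\<bar> \<partial>M)" by simp
  also have "\<dots> \<le> (\<integral>y. ?q * indicator (ball p2 (a * s2)) y \<partial>M)"
  proof (rule integral_mono_AE)
    show "integrable M (\<lambda>y. ?q * indicator (ball p2 (a * s2)) y)"
      by (intro integrable_mult_right integrable_bounded[of _ 1]) (auto simp: sets_M indicator_def)
    show "AE y in M. \<bar>\<psi>1 y * \<psi>2 y - \<psi>1 p2 * \<psi>2 y\<bar> \<le> ?q * indicator (ball p2 (a * s2)) y"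
      using AE_E
    proof eventually_elim
      case (elim y)
      show ?case
      proof (cases "a * s2 \<le> dist p2 y")
        case True
        then show ?thesis using 2 by (simp add: adapted_def)
      next
        case False
        have "\<bar>\<psi>1 y - \<psi>1 p2\<bar> \<le> 7 / s1 * dist y p2" using 1 elim p2 by (simp add: adapted_def)
        also have "\<dots> \<le> 7 / s1 * (a * s2)"
          using False s by (intro mult_left_mono) (auto simp: dist_commute)
        finally have "\<bar>(\<psi>1 y - \<psi>1 p2) * \<psi>2 y\<bar> \<le> ?q"
          unfolding abs_mult using 2 elim a s by (intro mult_mono) (auto simp: adapted_def)
        then show ?thesis using False by (simp add: left_diff_distrib)
      qed
    qed
  qed (use int1 int2 in auto)
  also have "\<dots> = ?q * measure M (ball p2 (a * s2))" by (simp add: sets_M)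
  also have "\<dots> \<le> ?q * (C * (a * s2) ^ n)" using upper[OF p2] a s q by (intro mult_left_mono) auto
  also have "\<dots> = 7 * a\<^sup>2 * C * a ^ n * (s2 / s1) * s2 ^ n"
    by (simp add: power_mult_distrib power2_eq_square)
  finally show ?thesis using True by simp
qed

text \<open>Duality with a Schur test. The lower bounds \<open>big\<close> make \<open>c\<close>
  times the sum at most the pairing of \<open>g\<close> with the field of all
  \<open>\<psi> i\<close> times \<open>\<nu> i\<close>, while the correlations bound the squared
  norm of this field by a multiple of the same sum, which can then be absorbed. By
  \<open>pack\<close>, the finer functions of one level that meet a coarse one have total size
  comparable to \<open>s i ^ n\<close>; the geometric gain in the correlations makes the sum over
  levels converge.\<close>

lemma almost_orthogonality:
  fixes I :: "'i set" and lev :: "'i \<Rightarrow> nat" and p \<nu> :: "'i \<Rightarrow> 'a" and \<psi> :: "'i \<Rightarrow> 'a \<Rightarrow> real"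
    and r0 a P c :: real and g :: "'a \<Rightarrow> 'a"
  defines "s \<equiv> \<lambda>i. r0 / 2 ^ lev i"
  assumes I: "finite I" and pos: "0 < r0" "0 < a" "0 < P" "0 < c"
    and p: "\<And>i. i \<in> I \<Longrightarrow> p i \<in> E" and ad: "\<And>i. i \<in> I \<Longrightarrow> adapted a (p i) (s i) (\<psi> i)"
    and \<nu>: "\<And>i. i \<in> I \<Longrightarrow> norm (\<nu> i) = 1"
    and pack: "\<And>i l. i \<in> I \<Longrightarrow> lev i \<le> l \<Longrightarrow>
      real (card {j \<in> I. lev j = l \<and> dist (p i) (p j) < 2 * a * s i}) * (r0 / 2 ^ l) ^ n \<le> P * s i ^ n"
    and g: "g \<in> borel_measurable borel" "integrable M (\<lambda>y. (norm (g y))\<^sup>2)"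
    and big: "\<And>i. i \<in> I \<Longrightarrow> c * s i ^ n \<le> (\<integral>y. \<psi> i y * (\<nu> i \<bullet> g y) \<partial>M)"
  shows "(\<Sum>i\<in>I. s i ^ n) \<le> 4 * (7 * a\<^sup>2 * C * a ^ n) * P / c\<^sup>2 * (\<integral>y. (norm (g y))\<^sup>2 \<partial>M)"
proof -
  define q where "q = 7 * a\<^sup>2 * C * a ^ n"
  have q: "0 < q" using pos C_pos by (simp add: q_def)
  have s: "0 < s i" for i using pos by (simp add: s_def)
  define b where "b i j = \<bar>\<integral>y. \<psi> i y * \<psi> j y \<partial>M\<bar>" for i j
  define T where "T = (\<Sum>i\<in>I. s i ^ n)"
  have b_sym: "b i j = b j i" for i j by (simp add: b_def mult.commute)
  have b_le: "b i j \<le> (if dist (p i) (p j) < 2 * a * s i then q * (1/2) ^ (lev j - lev i) * s j ^ n else 0)"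
    if ij: "i \<in> I" "j \<in> I" "lev i \<le> lev j" for i j
  proof -
    have sj: "s j = (1/2) ^ (lev j - lev i) * s i"
      using ij by (simp add: s_def power_one_over power_diff field_simps)
    also have "\<dots> \<le> 1 * s i" using s[of i] by (intro mult_right_mono power_le_one) auto
    finally have le: "s j \<le> s i" by simp
    have ratio: "s j / s i = (1/2) ^ (lev j - lev i)" using sj s[of i] by simp
    show ?thesis
      using adapted_correlation_le[OF ad[OF ij(1)] ad[OF ij(2)] pos(2) s le p[OF ij(2)]]
      unfolding b_def q_def ratio .
  qed
  define L where "L = Suc (Max (insert 0 (lev ` I)))"
  have L: "lev i < L" if "i \<in> I" for i using that I by (auto simp: L_def less_Suc_eq_le)
  have row: "(\<Sum>j\<in>{j\<in>I. lev i \<le> lev j}. b i j) \<le> 2 * q * P * s i ^ n" if i: "i \<in> I" for i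
  proof -
    let ?S = "{j\<in>I. lev i \<le> lev j}" and ?T = "{lev i..<lev i + L}"
    have "(\<Sum>j\<in>?S. b i j) = (\<Sum>l\<in>?T. \<Sum>j\<in>{j\<in>?S. lev j = l}. b i j)"
      using I L by (intro sum.group[symmetric]) force+
    also have "\<dots> \<le> (\<Sum>l\<in>?T. (1/2) ^ (l - lev i) * (q * P * s i ^ n))"
    proof (rule sum_mono)
      fix l assume l: "l \<in> ?T"
      let ?N = "{j \<in> I. lev j = l \<and> dist (p i) (p j) < 2 * a * s i}"
      have N: "?N = {j\<in>{j\<in>?S. lev j = l}. dist (p i) (p j) < 2 * a * s i}" using l by auto
      have "(\<Sum>j\<in>{j\<in>?S. lev j = l}. b i j)
          \<le> (\<Sum>j\<in>{j\<in>?S. lev j = l}. if dist (p i) (p j) < 2 * a * s i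
              then q * (1/2) ^ (l - lev i) * (r0 / 2 ^ l) ^ n else 0)"
      proof (rule sum_mono)
        fix j assume j: "j \<in> {j\<in>?S. lev j = l}"
        show "b i j \<le> (if dist (p i) (p j) < 2 * a * s i
              then q * (1/2) ^ (l - lev i) * (r0 / 2 ^ l) ^ n else 0)"
          using b_le[of i j] i j by (auto simp: s_def)
      qed
      also have "\<dots> = (\<Sum>j\<in>?N. q * (1/2) ^ (l - lev i) * (r0 / 2 ^ l) ^ n)"
        unfolding N using I by (intro sum.inter_filter[symmetric]) auto
      also have "\<dots> = (1/2) ^ (l - lev i) * (q * (real (card ?N) * (r0 / 2 ^ l) ^ n))" by simp
      also have "\<dots> \<le> (1/2) ^ (l - lev i) * (q * (P * s i ^ n))"
        using pack[OF i, of l] l q by (intro mult_left_mono) auto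
      finally show "(\<Sum>j\<in>{j\<in>?S. lev j = l}. b i j) \<le> (1/2) ^ (l - lev i) * (q * P * s i ^ n)"
        by (simp add: mult.assoc)
    qed
    also have "\<dots> = (\<Sum>l\<in>?T. (1/2) ^ (l - lev i)) * (q * P * s i ^ n)"
      by (simp add: sum_distrib_right)
    also have "\<dots> \<le> 2 * (q * P * s i ^ n)"
      using q pos s[of i] by (intro mult_right_mono sum_half_powers_le) auto
    finally show ?thesis by (simp add: mult.assoc)
  qed
  \<comment> \<open>Each pair is charged to its coarser member, so by symmetry both halves are row
    sums over finer levels. Pairs of equal level are counted twice, which an upper bound
    permits.\<close>
  have "(\<Sum>i\<in>I. \<Sum>j\<in>I. b i j) \<le> (\<Sum>i\<in>I. \<Sum>j\<in>I. (if lev i \<le> lev j then b i j else 0) + (if lev j \<le> lev i then b i j else 0))"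
    by (intro sum_mono) (auto simp: b_def)
  also have "\<dots> = (\<Sum>i\<in>I. \<Sum>j\<in>I. if lev i \<le> lev j then b i j else 0) + (\<Sum>i\<in>I. \<Sum>j\<in>I. if lev j \<le> lev i then b i j else 0)"
    by (simp add: sum.distrib)
  also have "(\<Sum>i\<in>I. \<Sum>j\<in>I. if lev j \<le> lev i then b i j else 0) = (\<Sum>i\<in>I. \<Sum>j\<in>I. if lev i \<le> lev j then b i j else 0)"
    by (subst sum.swap) (intro sum.cong refl if_cong b_sym)
  also have "(\<Sum>i\<in>I. \<Sum>j\<in>I. if lev i \<le> lev j then b i j else 0) = (\<Sum>i\<in>I. \<Sum>j\<in>{j\<in>I. lev i \<le> lev j}. b i j)"
    using I by (simp add: sum.inter_filter)
  also have "(\<Sum>i\<in>I. \<Sum>j\<in>{j\<in>I. lev i \<le> lev j}. b i j) + (\<Sum>i\<in>I. \<Sum>j\<in>{j\<in>I. lev i \<le> lev j}. b i j)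
      \<le> (\<Sum>i\<in>I. 2 * q * P * s i ^ n) + (\<Sum>i\<in>I. 2 * q * P * s i ^ n)"
    by (intro add_mono sum_mono row)
  also have "\<dots> = 4 * q * P * T" by (simp add: T_def sum_distrib_left[symmetric])
  finally have bT: "(\<Sum>i\<in>I. \<Sum>j\<in>I. b i j) \<le> 4 * q * P * T" .
  \<comment> \<open>The normals differ from index to index. Being unit vectors, they enter the
    squared norm only through \<open>\<nu> i \<bullet> \<nu> j\<close>, which is at most 1 in
    absolute value.\<close>
  define v where "v y = (\<Sum>i\<in>I. \<psi> i y *\<^sub>R \<nu> i)" for y
  have meas: "\<psi> i \<in> borel_measurable borel" if "i \<in> I" for i using ad[OF that] by (simp add: adapted_def)
  have v2: "(norm (v y))\<^sup>2 = (\<Sum>i\<in>I. \<Sum>j\<in>I. (\<nu> i \<bullet> \<nu> j) * (\<psi> i y * \<psi> j y))" for y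
    unfolding power2_norm_eq_inner v_def
    by (simp add: inner_sum_left inner_sum_right sum_distrib_left mult_ac inner_commute)
  have int_pp: "integrable M (\<lambda>y. \<psi> i y * \<psi> j y)" if "i \<in> I" "j \<in> I" for i j
    by (rule adapted_integrable_mult[OF ad[OF that(1)] ad[OF that(2)] pos(2)])
  have int_v2: "integrable M (\<lambda>y. (norm (v y))\<^sup>2)"
    unfolding v2 by (intro Bochner_Integration.integrable_sum integrable_mult_right int_pp)
  have "(\<integral>y. (norm (v y))\<^sup>2 \<partial>M) = (\<Sum>i\<in>I. \<Sum>j\<in>I. (\<nu> i \<bullet> \<nu> j) * (\<integral>y. \<psi> i y * \<psi> j y \<partial>M))"
    unfolding v2 using int_pp by (simp add: Bochner_Integration.integral_sum)
  also have "\<dots> \<le> (\<Sum>i\<in>I. \<Sum>j\<in>I. b i j)"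
  proof (intro sum_mono)
    fix i j assume "i \<in> I" "j \<in> I"
    then have "\<bar>\<nu> i \<bullet> \<nu> j\<bar> \<le> 1" using Cauchy_Schwarz_ineq2[of "\<nu> i" "\<nu> j"] \<nu> by simp
    then have "\<bar>\<nu> i \<bullet> \<nu> j\<bar> * b i j \<le> 1 * b i j" by (intro mult_right_mono) (auto simp: b_def)
    then show "(\<nu> i \<bullet> \<nu> j) * (\<integral>y. \<psi> i y * \<psi> j y \<partial>M) \<le> b i j"
      unfolding b_def abs_mult[symmetric] by linarith
  qed
  finally have vT: "(\<integral>y. (norm (v y))\<^sup>2 \<partial>M) \<le> 4 * q * P * T" using bT by linarith
  define G where "G = (\<integral>y. (norm (g y))\<^sup>2 \<partial>M)"
  have [measurable]: "g \<in> borel_measurable borel" by fact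
  have int_g: "integrable M (\<lambda>y. \<psi> i y * (\<nu> i \<bullet> g y))" if i: "i \<in> I" for i
  proof (rule Bochner_Integration.integrable_bound)
    show "integrable M (\<lambda>y. a * (1 + (norm (g y))\<^sup>2))" using g(2) by simp
    have [measurable]: "\<psi> i \<in> borel_measurable borel" by (rule meas[OF i])
    show "(\<lambda>y. \<psi> i y * (\<nu> i \<bullet> g y)) \<in> borel_measurable M" by measurable
    show "AE y in M. norm (\<psi> i y * (\<nu> i \<bullet> g y)) \<le> norm (a * (1 + (norm (g y))\<^sup>2))"
      using AE_E
    proof eventually_elim
      case (elim y)
      have "\<bar>\<nu> i \<bullet> g y\<bar> \<le> norm (g y)" using Cauchy_Schwarz_ineq2[of "\<nu> i" "g y"] \<nu>[OF i] by simp
      also have "norm (g y) \<le> 1 + (norm (g y))\<^sup>2"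
      proof -
        have "2 * norm (g y) \<le> (norm (g y))\<^sup>2 + 1"
          using zero_le_power2[of "norm (g y) - 1"] by (simp add: power2_diff)
        then show ?thesis using norm_ge_zero[of "g y"] by linarith
      qed
      finally have "\<bar>\<psi> i y * (\<nu> i \<bullet> g y)\<bar> \<le> a * (1 + (norm (g y))\<^sup>2)"
        unfolding abs_mult using ad[OF i] elim pos by (intro mult_mono) (auto simp: adapted_def)
      then show ?case by simp
    qed
  qed
  \<comment> \<open>The weight in Young's inequality for which the term with \<open>v\<close>
    becomes \<open>c * T / 2\<close>, half of the left-hand side.\<close>
  define \<theta> where "\<theta> = 4 * q * P / c"
  have \<theta>: "0 < \<theta>" using q pos by (simp add: \<theta>_def)
  have "c * T \<le> (\<Sum>i\<in>I. \<integral>y. \<psi> i y * (\<nu> i \<bullet> g y) \<partial>M)"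
    unfolding T_def sum_distrib_left by (intro sum_mono big)
  also have "\<dots> = (\<integral>y. (\<Sum>i\<in>I. \<psi> i y * (\<nu> i \<bullet> g y)) \<partial>M)"
    by (rule Bochner_Integration.integral_sum[symmetric]) (rule int_g)
  also have "\<dots> \<le> (\<integral>y. \<theta> / 2 * (norm (g y))\<^sup>2 + 1 / (2 * \<theta>) * (norm (v y))\<^sup>2 \<partial>M)"
  proof (rule integral_mono)
    fix y
    have "(\<Sum>i\<in>I. \<psi> i y * (\<nu> i \<bullet> g y)) = v y \<bullet> g y" by (simp add: v_def inner_sum_left)
    also have "\<dots> \<le> norm (v y) * norm (g y)" by (rule norm_cauchy_schwarz)
    also have "\<dots> \<le> \<theta> / 2 * (norm (g y))\<^sup>2 + 1 / (2 * \<theta>) * (norm (v y))\<^sup>2"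
    proof -
      have "0 \<le> (\<theta> * norm (g y) - norm (v y))\<^sup>2 / (2 * \<theta>)" using \<theta> by simp
      also have "\<dots> = \<theta> / 2 * (norm (g y))\<^sup>2 + 1 / (2 * \<theta>) * (norm (v y))\<^sup>2 - norm (v y) * norm (g y)"
        using \<theta> by (simp add: power2_eq_square field_simps)
      finally show ?thesis by simp
    qed
    finally show "(\<Sum>i\<in>I. \<psi> i y * (\<nu> i \<bullet> g y)) \<le> \<theta> / 2 * (norm (g y))\<^sup>2 + 1 / (2 * \<theta>) * (norm (v y))\<^sup>2" .
  qed (use int_g g(2) int_v2 in auto)
  also have "\<dots> = \<theta> / 2 * G + 1 / (2 * \<theta>) * (\<integral>y. (norm (v y))\<^sup>2 \<partial>M)"
    using g(2) int_v2 by (simp add: G_def)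
  also have "\<dots> \<le> \<theta> / 2 * G + 1 / (2 * \<theta>) * (4 * q * P * T)"
    using vT \<theta> by (intro add_mono mult_left_mono) auto
  also have "1 / (2 * \<theta>) * (4 * q * P * T) = c * T / 2" using q pos by (simp add: \<theta>_def)
  finally have "c * T \<le> \<theta> * G" by simp
  then have "T \<le> \<theta> * G / c" using pos by (simp add: field_simps)
  also have "\<dots> = 4 * q * P / c\<^sup>2 * G" by (simp add: \<theta>_def power2_eq_square)
  finally show ?thesis by (simp add: T_def q_def G_def)
qed

end

section \<open>Stacks of parallel planes\<close>

text \<open>Each plane of the family is a full level set of the same linear form, so the union is
  determined by one unit normal and the set of heights it attains. The search for a good scale
  thereby becomes a question about a set of real numbers.\<close>

lemma parallel_hyperplanes_heights:
  fixes I :: "'a::euclidean_space set set"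
  assumes dim: "DIM('a) = n + 1" and "I \<noteq> {}" and planes: "\<And>L. L \<in> I \<Longrightarrow> is_plane n L"
    and par: "\<And>L L'. L \<in> I \<Longrightarrow> L' \<in> I \<Longrightarrow> affine_parallel L L'"
  obtains \<nu> T where "norm \<nu> = 1" "\<Union>I = {y. \<nu> \<bullet> (y - x) \<in> T}"
proof -
  obtain L0 where L0: "L0 \<in> I" using \<open>I \<noteq> {}\<close> by blast
  have dim0: "aff_dim L0 = int (DIM('a) - 1)" and hull: "affine hull L0 = L0"
    using planes[OF L0] dim by (auto simp: is_plane_def affine_hull_eq)
  obtain a b where "a \<noteq> 0" "affine hull L0 = {y. a \<bullet> y = b}"
    using aff_dim_eq_hyperplane[THEN iffD1, OF dim0] by (elim exE conjE) (rule that)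
  then have a: "a \<noteq> 0" "L0 = {y. a \<bullet> y = b}" unfolding hull .
  have sat: "y \<in> \<Union>I" if y': "y' \<in> \<Union>I" "a \<bullet> y = a \<bullet> y'" for y y'
  proof -
    obtain L where L: "L \<in> I" "y' \<in> L" using y'(1) by blast
    obtain c where c: "L = (\<lambda>z. c + z) ` L0" using par[OF L0 L(1)] by (auto simp: affine_parallel_def)
    have "y - c \<in> L0" using L(2) y'(2) unfolding c a(2) by (auto simp: inner_diff_right inner_add_right)
    then have "y \<in> L" unfolding c by (auto intro: image_eqI[of _ _ "y - c"])
    then show ?thesis using L(1) by blast
  qed
  define \<nu> where "\<nu> = a /\<^sub>R norm a"
  show thesis
  proof
    show "norm \<nu> = 1" using a by (simp add: \<nu>_def)
    show "\<Union>I = {y. \<nu> \<bullet> (y - x) \<in> (\<lambda>y. \<nu> \<bullet> (y - x)) ` \<Union>I}"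
    proof (intro set_eqI iffI)
      fix y assume "y \<in> {y. \<nu> \<bullet> (y - x) \<in> (\<lambda>y. \<nu> \<bullet> (y - x)) ` \<Union>I}"
      then obtain y' where y': "y' \<in> \<Union>I" "\<nu> \<bullet> (y - x) = \<nu> \<bullet> (y' - x)" by blast
      then have "a \<bullet> y = a \<bullet> y'" using a by (simp add: \<nu>_def inner_diff_right)
      then show "y \<in> \<Union>I" using sat y' by blast
    qed blast
  qed
qed

lemma infdist_less_imp_near:
  assumes "infdist y H < \<tau>" "H \<noteq> {}"
  obtains p where "p \<in> H" "dist y p < \<tau>"
proof -
  have "(INF p\<in>H. dist y p) < \<tau>" using assms by (simp add: infdist_notempty)
  then show thesis
    using that assms(2) by (subst (asm) cINF_less_iff) (auto intro: bdd_belowI[of _ 0])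
qed

lemma bilateral_dev_le_imp:
  fixes S H :: "'a::euclidean_space set"
  assumes "bilateral_dev S H x r \<le> ennreal e" "0 < r" "0 < e"
  shows "y \<in> S \<Longrightarrow> dist x y < r \<Longrightarrow> infdist y H \<le> e * r"
    and "y \<in> H \<Longrightarrow> dist x y < r \<Longrightarrow> infdist y S \<le> e * r"
proof -
  have 1: "infdist y H \<le> e * r" if "ennreal (infdist y H / r) \<le> ennreal e" for y and H :: "'a set"
    using that assms by (simp add: field_simps)
  have le: "(SUP y\<in>S \<inter> ball x r. ennreal (infdist y H / r)) \<le> ennreal e"
    "(SUP y\<in>H \<inter> ball x r. ennreal (infdist y S / r)) \<le> ennreal e"
    by (rule order_trans[OF _ assms(1)], simp add: bilateral_dev_def add_increasing add_increasing2)+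
  show "infdist y H \<le> e * r" if "y \<in> S" "dist x y < r"
    by (rule 1, rule order_trans[OF SUP_upper le(1)]) (use that in auto)
  show "infdist y S \<le> e * r" if "y \<in> H" "dist x y < r"
    by (rule 1, rule order_trans[OF SUP_upper le(2)]) (use that in auto)
qed

text \<open>The strict slack \<open>e * R < \<tau>\<close> turns distances to sets, which are
  infima, into actual planes and actual points of the support.\<close>

lemma BAUPP_heights:
  fixes x :: "'a::euclidean_space"
  assumes dim: "DIM('a) = n + 1" and x: "x \<in> msupp \<mu>" and R: "0 < R" and e: "0 < e"
    and app: "(x, R) \<in> BAUPP n \<mu> e" and \<tau>: "e * R < \<tau>"
  obtains \<nu> T where "norm \<nu> = 1"
    "\<And>y. y \<in> msupp \<mu> \<Longrightarrow> dist x y < R \<Longrightarrow> \<exists>c\<in>T. \<bar>\<nu> \<bullet> (y - x) - c\<bar> < \<tau>"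
    "\<And>p. dist x p < R \<Longrightarrow> \<nu> \<bullet> (p - x) \<in> T \<Longrightarrow> \<exists>y\<in>msupp \<mu>. dist p y < \<tau>"
proof -
  have "\<exists>I. I \<noteq> {} \<and> (\<forall>L\<in>I. is_plane n L) \<and> (\<forall>L\<in>I. \<forall>L'\<in>I. affine_parallel L L')
      \<and> bilateral_dev (msupp \<mu>) (\<Union>I) x R \<le> ennreal e"
    using app by (simp add: BAUPP_def)
  then obtain I where ne_I: "I \<noteq> {}" and planes: "\<forall>L\<in>I. is_plane n L"
      and par: "\<forall>L\<in>I. \<forall>L'\<in>I. affine_parallel L L'"
      and dev: "bilateral_dev (msupp \<mu>) (\<Union>I) x R \<le> ennreal e"
    by (elim exE conjE) (rule that)
  obtain \<nu> T where \<nu>: "norm \<nu> = 1" and T: "\<Union>I = {y. \<nu> \<bullet> (y - x) \<in> T}"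
    using parallel_hyperplanes_heights[OF dim ne_I planes[rule_format] par[rule_format]] by blast
  have ne: "\<Union>I \<noteq> {}"
  proof -
    obtain L where L: "L \<in> I" using ne_I by blast
    then have "L \<noteq> {}" using planes by (auto simp: is_plane_def)
    then show ?thesis using L by blast
  qed
  show thesis
  proof (rule that[OF \<nu>])
    fix y assume y: "y \<in> msupp \<mu>" "dist x y < R"
    then have "infdist y (\<Union>I) < \<tau>" using bilateral_dev_le_imp(1)[OF dev R e y] \<tau> by linarith
    then obtain p where p: "p \<in> \<Union>I" "dist y p < \<tau>" using infdist_less_imp_near ne by blast
    have "\<bar>\<nu> \<bullet> (y - x) - \<nu> \<bullet> (p - x)\<bar> \<le> dist y p"
      using Cauchy_Schwarz_ineq2[of \<nu> "y - p"] \<nu> by (simp add: dist_norm inner_diff_right)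
    then show "\<exists>c\<in>T. \<bar>\<nu> \<bullet> (y - x) - c\<bar> < \<tau>" using p T by (intro bexI[of _ "\<nu> \<bullet> (p - x)"]) auto
  next
    fix p assume p: "dist x p < R" "\<nu> \<bullet> (p - x) \<in> T"
    then have "p \<in> \<Union>I" using T by blast
    then have "infdist p (msupp \<mu>) < \<tau>" using bilateral_dev_le_imp(2)[OF dev R e _ p(1)] \<tau> by fastforce
    then show "\<exists>y\<in>msupp \<mu>. dist p y < \<tau>" using infdist_less_imp_near x by blast
  qed
qed

text \<open>If all heights in the window were within \<open>\<delta> * t\<close> of
  \<open>c0\<close>, the single plane at height \<open>c0\<close> would do: its two deviations add
  up to at most \<open>2 * \<tau> + \<delta> * t\<close>, hence to at most \<open>e * t / 2\<close>.
  The window \<open>t + \<tau>\<close> contains the height of every plane that \<open>P1\<close>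
  assigns to a point of the ball of radius \<open>t\<close>.\<close>

lemma not_BWGL_two_heights:
  fixes x \<nu> :: "'a::euclidean_space"
  assumes dim: "DIM('a) = n + 1" and x: "x \<in> msupp \<mu>" and t: "0 < t" "t \<le> R" and e: "0 < e"
    and bad: "(x, t) \<notin> BWGL n \<mu> e" and \<nu>: "norm \<nu> = 1"
    and P1: "\<And>y. y \<in> msupp \<mu> \<Longrightarrow> dist x y < R \<Longrightarrow> \<exists>c\<in>T. \<bar>\<nu> \<bullet> (y - x) - c\<bar> < \<tau>"
    and P2: "\<And>p. dist x p < R \<Longrightarrow> \<nu> \<bullet> (p - x) \<in> T \<Longrightarrow> \<exists>y\<in>msupp \<mu>. dist p y < \<tau>"
    and c0: "c0 \<in> T" and \<delta>: "0 < \<delta>" "4 * \<delta> \<le> e" "2 * \<tau> \<le> \<delta> * t" and \<tau>: "0 < \<tau>"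
  shows "\<exists>c\<in>T. \<bar>c\<bar> < t + \<tau> \<and> \<delta> * t \<le> \<bar>c - c0\<bar>"
proof (rule ccontr)
  assume "\<not> ?thesis"
  then have near: "\<bar>c - c0\<bar> < \<delta> * t" if "c \<in> T" "\<bar>c\<bar> < t + \<tau>" for c using that by force
  define L where "L = {y. \<nu> \<bullet> y = c0 + \<nu> \<bullet> x}"
  have L: "y \<in> L \<longleftrightarrow> \<nu> \<bullet> (y - x) = c0" for y by (auto simp: L_def inner_diff_right)
  have "\<nu> \<noteq> 0" using \<nu> by auto
  then have plane: "is_plane n L" using dim by (simp add: is_plane_def L_def affine_hyperplane)
  have 1: "infdist y L / t \<le> (\<tau> + \<delta> * t) / t" if y: "y \<in> msupp \<mu>" "dist x y < t" for y
  proof -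
    obtain c where c: "c \<in> T" "\<bar>\<nu> \<bullet> (y - x) - c\<bar> < \<tau>" using P1 y t by force
    have "\<bar>\<nu> \<bullet> (y - x)\<bar> < t"
      using Cauchy_Schwarz_ineq2[of \<nu> "y - x"] \<nu> y by (simp add: dist_norm norm_minus_commute)
    then have d: "\<bar>c0 - \<nu> \<bullet> (y - x)\<bar> \<le> \<tau> + \<delta> * t" using near[OF c(1)] c(2) by linarith
    define p where "p = y + (c0 - \<nu> \<bullet> (y - x)) *\<^sub>R \<nu>"
    have "\<nu> \<bullet> \<nu> = 1" using \<nu> by (simp add: dot_square_norm)
    then have "p \<in> L" unfolding L p_def by (simp add: inner_diff_right inner_add_right)
    moreover have "dist y p = \<bar>c0 - \<nu> \<bullet> (y - x)\<bar>" by (simp add: p_def dist_norm \<nu>)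
    ultimately have "infdist y L \<le> \<tau> + \<delta> * t" using infdist_le[of p L y] d by linarith
    then show ?thesis using t by (intro divide_right_mono) auto
  qed
  have 2: "infdist y (msupp \<mu>) / t \<le> \<tau> / t" if y: "y \<in> L" "dist x y < t" for y
  proof -
    obtain y' where "y' \<in> msupp \<mu>" "dist y y' < \<tau>" using P2[of y] y L c0 t by force
    then have "infdist y (msupp \<mu>) \<le> \<tau>" using infdist_le[of y' "msupp \<mu>" y] by linarith
    then show ?thesis using t by (intro divide_right_mono) auto
  qed
  have "bilateral_dev (msupp \<mu>) L x t \<le> ennreal ((\<tau> + \<delta> * t) / t) + ennreal (\<tau> / t)"
    unfolding bilateral_dev_def by (intro add_mono SUP_least ennreal_leI 1 2) auto
  also have "\<dots> = ennreal ((\<tau> + \<delta> * t) / t + \<tau> / t)"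
    using t \<tau> \<delta> by (subst ennreal_plus) auto
  also have "\<dots> \<le> ennreal e"
  proof (rule ennreal_leI)
    have "4 * \<delta> * t \<le> e * t" "0 < \<delta> * t" using \<delta> t by (auto intro: mult_right_mono)
    then have "2 * \<tau> + \<delta> * t \<le> e * t" using \<delta>(3) by linarith
    then show "(\<tau> + \<delta> * t) / t + \<tau> / t \<le> e" using t by (simp add: field_simps)
  qed
  finally show False using bad plane x t by (auto simp: BWGL_def)
qed

text \<open>\<open>T\<close> is the set of heights of the approximating planes and \<open>\<rho>\<close> the width of the slab around the
  plane of height \<open>c0\<close>. If the slab is not isolated in the \<open>A\<close> times larger ball, there is a plane at
  more than twice the distance, which becomes the new \<open>\<rho>\<close>.\<close>

lemma lacunary_heights:
  fixes T :: "real set"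
  assumes A: "1 \<le> A" and \<rho>0: "0 < \<rho>0" "\<bar>c0\<bar> \<le> \<rho>0" and c1: "c1 \<in> T" "\<bar>c1 - c0\<bar> = \<rho>0"
  shows "(\<exists>\<rho>\<ge>\<rho>0. \<rho> \<le> (3 * A) ^ N * \<rho>0 \<and> (\<exists>c\<in>T. \<bar>c - c0\<bar> = \<rho>) \<and> (\<forall>c\<in>T. \<bar>c\<bar> \<le> A * \<rho> \<longrightarrow> \<bar>c - c0\<bar> \<le> 2 * \<rho>))
    \<or> (\<exists>f. \<forall>i\<le>N. f i \<in> T \<and> \<rho>0 \<le> \<bar>f i - c0\<bar> \<and> \<bar>f i - c0\<bar> \<le> (3 * A) ^ N * \<rho>0
          \<and> (\<forall>j<i. 2 * \<bar>f j - c0\<bar> < \<bar>f i - c0\<bar>))"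
  (is "?stop N \<or> ?sep N")
proof (induction N)
  case 0
  have "?sep 0" using c1 by (intro exI[of _ "\<lambda>_. c1"]) auto
  then show ?case ..
next
  case (Suc N)
  have mono: "(3 * A) ^ N * \<rho>0 \<le> (3 * A) ^ Suc N * \<rho>0"
    using A \<rho>0 by (intro mult_right_mono power_increasing) auto
  show ?case
  proof (cases "?stop N")
    case True
    then have "?stop (Suc N)" using mono by (meson order_trans)
    then show ?thesis ..
  next
    case False
    then obtain f where f: "\<And>i. i \<le> N \<Longrightarrow> f i \<in> T" "\<And>i. i \<le> N \<Longrightarrow> \<rho>0 \<le> \<bar>f i - c0\<bar>"
      "\<And>i. i \<le> N \<Longrightarrow> \<bar>f i - c0\<bar> \<le> (3 * A) ^ N * \<rho>0"
      "\<And>i j. i \<le> N \<Longrightarrow> j < i \<Longrightarrow> 2 * \<bar>f j - c0\<bar> < \<bar>f i - c0\<bar>" using Suc by blast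
    define \<rho> where "\<rho> = \<bar>f N - c0\<bar>"
    have \<rho>: "\<rho>0 \<le> \<rho>" "\<rho> \<le> (3 * A) ^ N * \<rho>0" using f by (auto simp: \<rho>_def)
    \<comment> \<open>The bound \<open>\<bar>c\<bar> \<le> A * \<rho>\<close> limits the growth of
      the width to a factor \<open>3 * A\<close> per step, the source of
      \<open>(3 * A) ^ N\<close>.\<close>
    then obtain c where c: "c \<in> T" "\<bar>c\<bar> \<le> A * \<rho>" "2 * \<rho> < \<bar>c - c0\<bar>"
      using False f(1)[of N] unfolding \<rho>_def by (metis le_refl not_less)
    have "\<rho> \<le> A * \<rho>" using A \<rho> \<rho>0 by simp
    then have "\<bar>c - c0\<bar> \<le> 3 * A * \<rho>" using c(2) \<rho> \<rho>0 by linarith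
    also have "\<dots> \<le> 3 * A * ((3 * A) ^ N * \<rho>0)" using A \<rho> by (intro mult_left_mono) auto
    finally have cN: "\<bar>c - c0\<bar> \<le> (3 * A) ^ Suc N * \<rho>0" by simp
    have le: "\<bar>f j - c0\<bar> \<le> \<rho>" if "j \<le> N" for j
    proof (cases "j = N")
      case False
      then have "2 * \<bar>f j - c0\<bar> < \<rho>"
        using f(4)[of N j] that by (simp add: \<rho>_def)
      moreover have "a \<le> b" if "2 * a < b" "0 \<le> a" for a b :: real using that by linarith
      ultimately show ?thesis using abs_ge_zero by blast
    qed (simp add: \<rho>_def)
    define g where "g = f(Suc N := c)"
    have "?sep (Suc N)"
    proof (intro exI[of _ g] allI impI conjI)
      fix i assume i: "i \<le> Suc N"
      consider "i = Suc N" | "i \<le> N" using i by linarith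
      note cs = this
      show "g i \<in> T" using cs f c by cases (auto simp: g_def)
      show "\<rho>0 \<le> \<bar>g i - c0\<bar>" using cs f(2) c \<rho> \<rho>0 by cases (auto simp: g_def)
      show "\<bar>g i - c0\<bar> \<le> (3 * A) ^ Suc N * \<rho>0"
        using cs f(3) cN mono by cases (auto simp: g_def simp del: power_Suc intro: order_trans)
      show "2 * \<bar>g j - c0\<bar> < \<bar>g i - c0\<bar>" if "j < i" for j
        using cs
      proof cases
        case 1
        then show ?thesis using le[of j] c(3) that by (simp add: g_def)
      next
        case 2
        then show ?thesis using f(4) that by (simp add: g_def)
      qed
    qed
    then show ?thesis ..
  qed
qed

text \<open>The upper bound is imposed for all radii: for bounded \<open>E\<close> of positive diameter this only costs
  a larger constant, since \<open>E\<close> then has finite mass.\<close>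

locale ahlfors =
  fixes \<mu> :: "'a::euclidean_space measure" and E :: "'a set" and n :: nat and C :: real
  assumes sets_\<mu> [measurable_cong]: "sets \<mu> = sets borel"
    and closed_E: "closed E" and null: "emeasure \<mu> (- E) = 0"
    and upper: "\<And>u r. u \<in> E \<Longrightarrow> 0 < r \<Longrightarrow> emeasure \<mu> (ball u r) \<le> ennreal (C * r ^ n)"
    and lower: "\<And>u r. u \<in> E \<Longrightarrow> admissible_radius E r \<Longrightarrow> ennreal (r ^ n / C) \<le> emeasure \<mu> (ball u r)"
    and C_ge: "1 \<le> C" and n_pos: "1 \<le> n" and dim: "DIM('a) = n + 1"
begin

lemma packing:
  assumes X: "finite X" and p: "\<And>i. i \<in> X \<Longrightarrow> p i \<in> E" and s: "admissible_radius E s"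
    and sep: "\<And>i j. i \<in> X \<Longrightarrow> j \<in> X \<Longrightarrow> i \<noteq> j \<Longrightarrow> 2 * s \<le> dist (p i) (p j)"
    and u: "u \<in> E" and sub: "\<And>i. i \<in> X \<Longrightarrow> ball (p i) s \<subseteq> ball u r" and r: "0 < r"
  shows "real (card X) * s ^ n \<le> C\<^sup>2 * r ^ n"
proof -
  have s0: "0 < s" using s by (simp add: admissible_radius_def)
  have "disjoint_family_on (\<lambda>i. ball (p i) s) X"
    unfolding disjoint_family_on_def
  proof (intro ballI impI)
    fix i j assume "i \<in> X" "j \<in> X" "i \<noteq> j"
    then have "2 * s \<le> dist (p i) (p j)" by (rule sep)
    then have "\<not> (dist (p i) z < s \<and> dist (p j) z < s)" for z
      using dist_triangle2[of "p i" "p j" z] by linarith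
    then show "ball (p i) s \<inter> ball (p j) s = {}" by auto
  qed
  then have "(\<Sum>i\<in>X. emeasure \<mu> (ball (p i) s)) = emeasure \<mu> (\<Union>i\<in>X. ball (p i) s)"
    using X by (intro sum_emeasure) (auto simp: sets_\<mu>)
  also have "\<dots> \<le> emeasure \<mu> (ball u r)" using sub by (intro emeasure_mono) (auto simp: sets_\<mu>)
  also have "\<dots> \<le> ennreal (C * r ^ n)" by (rule upper[OF u r])
  finally have "(\<Sum>i\<in>X. ennreal (s ^ n / C)) \<le> ennreal (C * r ^ n)"
    using sum_mono[of X "\<lambda>_. ennreal (s ^ n / C)" "\<lambda>i. emeasure \<mu> (ball (p i) s)"] lower[OF p s]
    by (meson order_trans)
  then have "ennreal (real (card X) * (s ^ n / C)) \<le> ennreal (C * r ^ n)"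
    using s0 C_ge by (subst (asm) sum_ennreal) auto
  then have "real (card X) * (s ^ n / C) \<le> C * r ^ n"
    using C_ge r by (subst (asm) ennreal_le_iff) auto
  then show ?thesis using C_ge by (simp add: field_simps power2_eq_square)
qed

text \<open>A volume count. Each of the \<open>N + 1\<close> planes carries a grid of mesh
  \<open>l\<close> filling a fixed proportion of the ball, and moving the grids to \<open>E\<close>
  gives about \<open>N\<close> times \<open>(R / l) ^ n\<close> separated points, which regularity
  of dimension \<open>n\<close> limits. The resulting bound does not involve \<open>l\<close>, so
  the number of steps in the pigeonholing depends on \<open>C\<close> and \<open>n\<close>
  only.\<close>

lemma separated_planes_bound:
  fixes x \<nu> :: 'a and f :: "nat \<Rightarrow> real"
  assumes x: "x \<in> E" and \<nu>: "norm \<nu> = 1" and l: "0 < l" "l \<le> R" "admissible_radius E (l / 8)"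
    and f: "\<And>i. i \<le> N \<Longrightarrow> f i \<in> T" "\<And>i. i \<le> N \<Longrightarrow> \<bar>f i\<bar> \<le> R / 4"
    and sep: "\<And>i j. i < j \<Longrightarrow> j \<le> N \<Longrightarrow> l \<le> \<bar>f j - f i\<bar>"
    and P2: "\<And>p. dist x p < R \<Longrightarrow> \<nu> \<bullet> (p - x) \<in> T \<Longrightarrow> \<exists>y\<in>E. dist p y < l / 8"
  shows "real N < C\<^sup>2 * (32 * real n) ^ n"
proof -
  obtain B where B: "B \<subseteq> {y. \<nu> \<bullet> y = 0}" "pairwise orthogonal B" "\<And>b. b \<in> B \<Longrightarrow> norm b = 1"
      "independent B" "card B = dim {y. \<nu> \<bullet> y = 0}"
    using orthonormal_basis_subspace[OF subspace_hyperplane] by metis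
  have "\<nu> \<noteq> 0" using \<nu> by auto
  then have cardB: "card B = n" using dim_hyperplane[of \<nu>] B(5) dim by simp
  have finB: "finite B" using B(4) independent_imp_finite by blast
  \<comment> \<open>A grid vector with coordinates up to \<open>m\<close> has norm at most
    \<open>n * m\<close>, so this \<open>m\<close> keeps the displacement along the plane within
    \<open>R / 4\<close>. That \<open>m + 1\<close> is too large gives the lower bound
    \<open>R / (32 * n)\<close> at the end.\<close>
  define m where "m = \<lfloor>R / (4 * real n * l)\<rfloor>"
  have m0: "0 \<le> m" using l by (simp add: m_def)
  have q: "0 < 4 * real n * l" using l n_pos by simp
  have m1: "real_of_int m * (4 * real n * l) \<le> R"
    using q of_int_floor_le[of "R / (4 * real n * l)"] unfolding m_def by (simp only: pos_le_divide_eq)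
  have m2: "R < (real_of_int m + 1) * (4 * real n * l)"
    using q floor_correct[of "R / (4 * real n * l)"] unfolding m_def by (simp only: pos_divide_less_eq of_int_add of_int_1)
  define K where "K = {..N} \<times> (PiE B (\<lambda>_. {-m..m}))"
  have cardK: "real (card K) = (real N + 1) * (2 * real_of_int m + 1) ^ n"
    using m0 finB cardB by (simp add: K_def card_PiE card_cartesian_product distrib_right)
  have finK: "finite K" using finB by (simp add: K_def finite_PiE)
  define g where "g k = (\<Sum>b\<in>B. real_of_int (k b) *\<^sub>R b)" for k :: "'a \<Rightarrow> int"
  define p where "p i = x + f (fst i) *\<^sub>R \<nu> + l *\<^sub>R g (snd i)" for i
  have orth: "b \<bullet> b' = (if b = b' then 1 else 0)" if "b \<in> B" "b' \<in> B" for b b'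
    using B(2,3) that by (auto simp: pairwise_def orthogonal_def dot_square_norm)
  have gb: "b \<bullet> g k = real_of_int (k b)" if "b \<in> B" for b k
    using that finB by (simp add: g_def inner_sum_right orth if_distrib sum.delta cong: if_cong)
  have g\<nu>: "\<nu> \<bullet> g k = 0" for k
    using B(1) by (auto simp: g_def inner_sum_right intro!: sum.neutral)
  have \<nu>\<nu>: "\<nu> \<bullet> \<nu> = 1" using \<nu> by (simp add: dot_square_norm)
  have bv: "b \<bullet> \<nu> = 0" if "b \<in> B" for b using B(1) that by (auto simp: inner_commute)
  have gn: "norm (g k) \<le> real n * real_of_int m" if "k \<in> PiE B (\<lambda>_. {-m..m})" for k
  proof -
    have "norm (g k) \<le> (\<Sum>b\<in>B. \<bar>real_of_int (k b)\<bar>)"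
      unfolding g_def using B(3) by (intro order_trans[OF norm_sum] sum_mono) auto
    also have "\<dots> \<le> (\<Sum>b\<in>B. real_of_int m)"
      using that by (intro sum_mono) (force simp: PiE_iff abs_le_iff)
    finally show ?thesis by (simp add: cardB)
  qed
  have dp: "dist x (p i) \<le> R / 2" if "i \<in> K" for i
  proof -
    have "dist x (p i) = norm (f (fst i) *\<^sub>R \<nu> + l *\<^sub>R g (snd i))"
      by (simp add: p_def dist_norm norm_minus_commute algebra_simps)
    also have "\<dots> \<le> \<bar>f (fst i)\<bar> + l * norm (g (snd i))"
      using norm_triangle_ineq[of "f (fst i) *\<^sub>R \<nu>" "l *\<^sub>R g (snd i)"] l \<nu> by simp
    also have "\<dots> \<le> R / 4 + l * (real n * real_of_int m)"
      using that f(2) gn l by (intro add_mono mult_left_mono) (auto simp: K_def)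
    also have "\<dots> \<le> R / 2" using m1 by (simp add: algebra_simps)
    finally show ?thesis .
  qed
  have hp: "\<nu> \<bullet> (p i - x) \<in> T" if "i \<in> K" for i
    using that f(1) by (auto simp: p_def inner_add_right g\<nu> \<nu>\<nu> K_def)
  have sepp: "l \<le> dist (p i) (p j)" if ij: "i \<in> K" "j \<in> K" "i \<noteq> j" for i j
  proof (cases "fst i = fst j")
    case True
    then have ne: "snd i \<noteq> snd j" using ij by (simp add: prod_eq_iff)
    have "snd i \<in> PiE B (\<lambda>_. {-m..m})" "snd j \<in> PiE B (\<lambda>_. {-m..m})"
      using ij by (auto simp: K_def)
    from PiE_ext[OF this] ne obtain b where b: "b \<in> B" "snd i b \<noteq> snd j b" by blast
    have "b \<bullet> (p i - p j) = l * real_of_int (snd i b - snd j b)"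
      using b(1) True by (simp add: p_def inner_add_right inner_diff_right gb bv algebra_simps)
    moreover have "1 \<le> \<bar>real_of_int (snd i b - snd j b)\<bar>" using b(2) by linarith
    then have "l * 1 \<le> l * \<bar>real_of_int (snd i b - snd j b)\<bar>" using l by (intro mult_left_mono) auto
    ultimately have "l \<le> \<bar>b \<bullet> (p i - p j)\<bar>" using l by (simp add: abs_mult)
    also have "\<dots> \<le> dist (p i) (p j)"
      using Cauchy_Schwarz_ineq2[of b "p i - p j"] B(3)[OF b(1)] by (simp add: dist_norm)
    finally show ?thesis .
  next
    case False
    have "\<nu> \<bullet> (p i - p j) = f (fst i) - f (fst j)"
      by (simp add: p_def inner_add_right inner_diff_right g\<nu> \<nu>\<nu>)
    moreover have "l \<le> \<bar>f (fst i) - f (fst j)\<bar>"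
      using sep[of "fst i" "fst j"] sep[of "fst j" "fst i"] False ij by (force simp: K_def)
    ultimately show ?thesis
      using Cauchy_Schwarz_ineq2[of \<nu> "p i - p j"] \<nu> by (simp add: dist_norm)
  qed
  have "\<exists>y\<in>E. dist (p i) y < l / 8" if "i \<in> K" for i
    using P2[OF _ hp[OF that]] dp[OF that] l by force
  \<comment> \<open>Both ends of a pair move by less than \<open>l / 8\<close>, so a separation
    above \<open>3 * l / 4\<close> remains, enough for disjoint balls of radius
    \<open>l / 8\<close>.\<close>
  then obtain q where q: "\<And>i. i \<in> K \<Longrightarrow> q i \<in> E" "\<And>i. i \<in> K \<Longrightarrow> dist (p i) (q i) < l / 8" by metis
  have "real (card K) * (l / 8) ^ n \<le> C\<^sup>2 * R ^ n"
  proof (rule packing[OF finK q(1) l(3) _ x])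
    fix i j assume ij: "i \<in> K" "j \<in> K" "i \<noteq> j"
    have "dist (p i) (p j) \<le> dist (p i) (q i) + dist (q i) (q j) + dist (p j) (q j)"
      using dist_triangle[of "p i" "p j" "q i"] dist_triangle[of "q i" "p j" "q j"]
      by (simp add: dist_commute)
    then show "2 * (l / 8) \<le> dist (q i) (q j)" using sepp[OF ij] q(2)[OF ij(1)] q(2)[OF ij(2)] l(1) by linarith
  next
    fix i assume i: "i \<in> K"
    show "ball (q i) (l / 8) \<subseteq> ball x R"
    proof
      fix y assume "y \<in> ball (q i) (l / 8)"
      moreover have "dist x y \<le> dist x (p i) + dist (p i) (q i) + dist (q i) y"
        using dist_triangle[of x y "p i"] dist_triangle[of "p i" y "q i"] by linarith
      ultimately show "y \<in> ball x R" using dp[OF i] q(2)[OF i] l by simp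
    qed
  qed (use l in auto)
  then have "(real N + 1) * ((2 * real_of_int m + 1) * (l / 8)) ^ n \<le> C\<^sup>2 * R ^ n"
    by (simp add: cardK power_mult_distrib power_divide)
  moreover have "R / (32 * real n) \<le> (2 * real_of_int m + 1) * (l / 8)"
  proof -
    have "R / (32 * real n) \<le> (real_of_int m + 1) * (l / 8)" using m2 n_pos by (simp add: field_simps)
    also have "\<dots> \<le> (2 * real_of_int m + 1) * (l / 8)" using m0 l by (intro mult_right_mono) auto
    finally show ?thesis .
  qed
  then have "(real N + 1) * (R / (32 * real n)) ^ n \<le> (real N + 1) * ((2 * real_of_int m + 1) * (l / 8)) ^ n"
    using l n_pos by (intro mult_left_mono power_mono) auto
  ultimately have "(real N + 1) * (R / (32 * real n)) ^ n \<le> C\<^sup>2 * R ^ n" by linarith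
  then have "(real N + 1) * R ^ n \<le> (C\<^sup>2 * (32 * real n) ^ n) * R ^ n"
    using n_pos unfolding power_divide by (simp add: field_simps)
  then have "real N + 1 \<le> C\<^sup>2 * (32 * real n) ^ n"
    using l by (intro mult_right_le_imp_le[of "real N + 1" "R ^ n"]) auto
  then show ?thesis by linarith
qed


text \<open>\<open>\<nu>\<close> and \<open>\<rho>\<close> are quantified inside because they vary
  with the pair in an uncontrolled way; the packing argument needs of them only that
  \<open>\<rho>\<close> is comparable to \<open>t\<close>.\<close>

definition stacked :: "real \<Rightarrow> real \<Rightarrow> real \<Rightarrow> 'a \<Rightarrow> real \<Rightarrow> bool" where
  "stacked A \<Lambda> \<delta> x t \<longleftrightarrow> (\<exists>\<nu> \<rho>. norm \<nu> = 1 \<and> \<delta> * t \<le> \<rho> \<and> 2 * A * \<rho> \<le> \<Lambda> * t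
        \<and> (\<forall>y\<in>E. dist x y < A * \<rho> \<longrightarrow> \<bar>\<nu> \<bullet> (y - x)\<bar> \<le> 3 * \<rho>)
        \<and> (\<forall>y\<in>E. dist x y < A * \<rho> \<longrightarrow>
             (\<exists>z\<in>E. dist y z \<le> 6 * \<rho> \<and> \<rho> / 4 \<le> \<bar>\<nu> \<bullet> (y - x) - \<nu> \<bullet> (z - x)\<bar>)))"

text \<open>\<open>N\<close> is at least the bound of \<open>separated_planes_bound\<close>, so
  \<open>N + 1\<close> lacunary heights cannot exist and the other alternative of
  \<open>lacunary_heights\<close> holds. \<open>\<Lambda>\<close> is so large that every height
  reached, at most \<open>Q * \<rho>0\<close> away from \<open>c0\<close>, stays below a quarter of
  \<open>\<Lambda> * t\<close>. \<open>e'\<close> is so small that at scale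
  \<open>\<Lambda> * t\<close> the approximation error is below
  \<open>\<delta> * t / 16\<close>.\<close>

lemma stacked_planes_scale:
  assumes E: "E = msupp \<mu>" and A: "1 \<le> A" and e: "0 < e"
  shows "\<exists>\<Lambda> e' \<delta>. 4 \<le> \<Lambda> \<and> 0 < e' \<and> 0 < \<delta> \<and>
    (\<forall>x\<in>E. \<forall>t. admissible_radius E t \<longrightarrow> (x, t) \<notin> BWGL n \<mu> e \<longrightarrow> (x, \<Lambda> * t) \<in> BAUPP n \<mu> e' \<longrightarrow>
      stacked A \<Lambda> \<delta> x t)"
proof -
  define N where "N = nat \<lceil>C\<^sup>2 * (32 * real n) ^ n\<rceil>"
  have N: "C\<^sup>2 * (32 * real n) ^ n \<le> real N" by (simp add: N_def)
  define Q where "Q = (3 * (2 * A)) ^ N"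
  have Q: "1 \<le> Q" unfolding Q_def by (rule one_le_power) (use A in auto)
  define \<Lambda> where "\<Lambda> = 32 * A * Q"
  have AQ: "1 \<le> A * Q" using A Q mult_mono[of 1 A 1 Q] by simp
  then have \<Lambda>: "32 \<le> \<Lambda>" by (simp add: \<Lambda>_def)
  define \<delta> where "\<delta> = min (e / 4) 1"
  have \<delta>: "0 < \<delta>" "\<delta> \<le> 1" "4 * \<delta> \<le> e" using e by (auto simp: \<delta>_def)
  define e' where "e' = \<delta> / (32 * \<Lambda>)"
  have e': "0 < e'" using \<delta> \<Lambda> by (simp add: e'_def)
  show ?thesis
    unfolding stacked_def
  proof (rule exI[of _ \<Lambda>], rule exI[of _ e'], rule exI[of _ \<delta>], intro conjI ballI allI impI)
    fix x t assume x: "x \<in> E" and adm: "admissible_radius E t" and bad: "(x, t) \<notin> BWGL n \<mu> e"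
      and good: "(x, \<Lambda> * t) \<in> BAUPP n \<mu> e'"
    have t: "0 < t" using adm by (simp add: admissible_radius_def)
    define R where "R = \<Lambda> * t"
    have R: "0 < R" "t \<le> R" using \<Lambda> t by (auto simp: R_def)
    define \<tau> where "\<tau> = \<delta> * t / 16"
    have \<tau>: "0 < \<tau>" "16 * \<tau> = \<delta> * t" "e' * R < \<tau>"
      using \<delta> t \<Lambda> by (auto simp: \<tau>_def e'_def R_def)
    have \<delta>t: "\<delta> * t \<le> t" using \<delta> t by simp
    obtain \<nu> T where \<nu>: "norm \<nu> = 1"
      and P1: "\<And>y. y \<in> E \<Longrightarrow> dist x y < R \<Longrightarrow> \<exists>c\<in>T. \<bar>\<nu> \<bullet> (y - x) - c\<bar> < \<tau>"
      and P2: "\<And>p. dist x p < R \<Longrightarrow> \<nu> \<bullet> (p - x) \<in> T \<Longrightarrow> \<exists>y\<in>E. dist p y < \<tau>"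
      using BAUPP_heights[OF dim x[unfolded E] R(1) e' good[folded R_def] \<tau>(3)] unfolding E by blast
    obtain c0 where c0: "c0 \<in> T" "\<bar>c0\<bar> < \<tau>" using P1[OF x] R by auto
    obtain c1 where c1: "c1 \<in> T" "\<bar>c1\<bar> < t + \<tau>" "\<delta> * t \<le> \<bar>c1 - c0\<bar>"
      using not_BWGL_two_heights[OF dim x[unfolded E] t R(2) e bad \<nu> P1[unfolded E] P2[unfolded E] c0(1) \<delta>(1,3) _ \<tau>(1)]
        \<tau>(1,2) by auto
    define \<rho>0 where "\<rho>0 = \<bar>c1 - c0\<bar>"
    have \<rho>0: "0 < \<rho>0" "\<delta> * t \<le> \<rho>0" "\<rho>0 \<le> 2 * t" "\<bar>c0\<bar> \<le> \<rho>0"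
      using c0 c1 \<tau> \<delta>t t by (auto simp: \<rho>0_def)
    have Q\<rho>: "Q * \<rho>0 \<le> 2 * (Q * t)" using mult_left_mono[OF \<rho>0(3), of Q] Q by simp
    have Qt: "t \<le> Q * t" "Q * t \<le> A * (Q * t)"
      using Q A t mult_right_mono[of 1 Q t] mult_right_mono[of 1 A "Q * t"] by auto
    have RAQ: "R = 32 * (A * (Q * t))" by (simp add: R_def \<Lambda>_def)
    have "\<not> (\<exists>f. \<forall>i\<le>N. f i \<in> T \<and> \<rho>0 \<le> \<bar>f i - c0\<bar> \<and> \<bar>f i - c0\<bar> \<le> (3 * (2 * A)) ^ N * \<rho>0
          \<and> (\<forall>j<i. 2 * \<bar>f j - c0\<bar> < \<bar>f i - c0\<bar>))"
    proof
      assume "\<exists>f. \<forall>i\<le>N. f i \<in> T \<and> \<rho>0 \<le> \<bar>f i - c0\<bar> \<and> \<bar>f i - c0\<bar> \<le> (3 * (2 * A)) ^ N * \<rho>0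
          \<and> (\<forall>j<i. 2 * \<bar>f j - c0\<bar> < \<bar>f i - c0\<bar>)"
      then obtain f where f: "\<And>i. i \<le> N \<Longrightarrow> f i \<in> T" "\<And>i. i \<le> N \<Longrightarrow> \<rho>0 \<le> \<bar>f i - c0\<bar>"
        "\<And>i. i \<le> N \<Longrightarrow> \<bar>f i - c0\<bar> \<le> Q * \<rho>0"
        "\<And>i j. i \<le> N \<Longrightarrow> j < i \<Longrightarrow> 2 * \<bar>f j - c0\<bar> < \<bar>f i - c0\<bar>"
        unfolding Q_def by blast
      have "real N < C\<^sup>2 * (32 * real n) ^ n"
      proof (rule separated_planes_bound[OF x \<nu>, where l = "\<delta> * t" and R = R])
        show "0 < \<delta> * t" using \<delta> t by simp
        show "\<delta> * t \<le> R" using \<delta>t R by simp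
        have "0 < \<delta> * t / 8" "\<delta> * t / 8 \<le> t" using \<delta> \<delta>t t by auto
        then show "admissible_radius E (\<delta> * t / 8)"
          using adm unfolding admissible_radius_def by linarith
        show "\<bar>f i\<bar> \<le> R / 4" if "i \<le> N" for i
          using f(3)[OF that] Q\<rho> Qt RAQ c0(2) \<tau> \<delta>t t by linarith
        show "\<delta> * t \<le> \<bar>f j - f i\<bar>" if "i < j" "j \<le> N" for i j
        proof -
          have "d \<le> b" if "2 * a < c" "\<rho>0 \<le> a" "c \<le> b + a" "d \<le> \<rho>0" for a b c d :: real
            using that by linarith
          moreover have "\<bar>f j - c0\<bar> \<le> \<bar>f j - f i\<bar> + \<bar>f i - c0\<bar>"
            using abs_triangle_ineq[of "f j - f i" "f i - c0"] by simp
          ultimately show ?thesis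
            using f(4)[OF that(2,1)] f(2)[OF less_imp_le[OF less_le_trans[OF that]]] \<rho>0(2) by blast
        qed
        show "\<exists>y\<in>E. dist p y < \<delta> * t / 8" if p: "dist x p < R" "\<nu> \<bullet> (p - x) \<in> T" for p
        proof -
          obtain y where "y \<in> E" "dist p y < \<tau>" using P2[OF p] by blast
          moreover have "\<tau> \<le> \<delta> * t / 8" using \<tau> by linarith
          ultimately show ?thesis by (intro bexI[of _ y]) auto
        qed
      qed (use f in auto)
      then show False using N by linarith
    qed
    \<comment> \<open>The isolation is taken in the window \<open>2 * A * \<rho>\<close>: a point of
      \<open>E\<close> within \<open>A * \<rho>\<close> of \<open>x\<close> may be assigned to a
      plane slightly higher than \<open>A * \<rho>\<close>.\<close>
    then obtain \<rho> c2 where \<rho>: "\<rho>0 \<le> \<rho>" "\<rho> \<le> Q * \<rho>0" and c2: "c2 \<in> T" "\<bar>c2 - c0\<bar> = \<rho>"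
      and stop: "\<And>c. c \<in> T \<Longrightarrow> \<bar>c\<bar> \<le> 2 * A * \<rho> \<Longrightarrow> \<bar>c - c0\<bar> \<le> 2 * \<rho>"
      using lacunary_heights[of "2 * A" \<rho>0 c0 c1 T N] A \<rho>0 c1 unfolding Q_def[symmetric] \<rho>0_def[symmetric] by auto
    have \<rho>t: "\<rho> \<le> 2 * (Q * t)" using \<rho>(2) Q\<rho> by linarith
    have A\<rho>: "A * \<rho> \<le> 2 * (A * (Q * t))" "\<rho> \<le> A * \<rho>"
      using mult_left_mono[OF \<rho>t, of A] mult_right_mono[of 1 A \<rho>] A \<rho> \<rho>0 by auto
    have \<tau>\<rho>: "16 * \<tau> \<le> \<rho>" using \<tau> \<rho>0 \<rho> by linarith
    show "\<exists>\<nu> \<rho>. norm \<nu> = 1 \<and> \<delta> * t \<le> \<rho> \<and> 2 * A * \<rho> \<le> \<Lambda> * t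
        \<and> (\<forall>y\<in>E. dist x y < A * \<rho> \<longrightarrow> \<bar>\<nu> \<bullet> (y - x)\<bar> \<le> 3 * \<rho>)
        \<and> (\<forall>y\<in>E. dist x y < A * \<rho> \<longrightarrow>
             (\<exists>z\<in>E. dist y z \<le> 6 * \<rho> \<and> \<rho> / 4 \<le> \<bar>\<nu> \<bullet> (y - x) - \<nu> \<bullet> (z - x)\<bar>))"
    proof (intro exI[of _ \<nu>] exI[of _ \<rho>] conjI ballI impI)
      show "norm \<nu> = 1" by fact
      show "\<delta> * t \<le> \<rho>" using \<rho>0 \<rho> by linarith
      show "2 * A * \<rho> \<le> \<Lambda> * t" using A\<rho> RAQ t Qt unfolding R_def by linarith
      fix y assume y: "y \<in> E" "dist x y < A * \<rho>"
      define hy where "hy = \<nu> \<bullet> (y - x)"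
      have hy: "\<bar>hy\<bar> \<le> dist x y"
        using Cauchy_Schwarz_ineq2[of \<nu> "y - x"] \<nu> by (simp add: hy_def dist_norm norm_minus_commute)
      have "dist x y < R" using y(2) A\<rho> RAQ t Qt by linarith
      then obtain c where c: "c \<in> T" "\<bar>hy - c\<bar> < \<tau>" using P1[OF y(1)] unfolding hy_def by blast
      have "\<bar>c\<bar> \<le> 2 * A * \<rho>" using c(2) hy y(2) A\<rho> \<tau>\<rho> by linarith
      then have h3: "\<bar>hy\<bar> \<le> 2 * \<rho> + 2 * \<tau>" using stop[OF c(1)] c(2) c0(2) by linarith
      then show "\<bar>\<nu> \<bullet> (y - x)\<bar> \<le> 3 * \<rho>" using \<tau>\<rho> \<tau>(1) by (simp add: hy_def)
      \<comment> \<open>The planes at heights \<open>c0\<close> and \<open>c2\<close> are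
        \<open>\<rho>\<close> apart, so one of them is at least \<open>\<rho> / 2\<close> away from
        the height of \<open>y\<close>. Projecting \<open>y\<close> to it and moving on to
        \<open>E\<close> loses less than \<open>\<tau>\<close>, which leaves
        \<open>\<rho> / 4\<close>.\<close>
      have "\<exists>c\<in>T. \<rho> / 2 \<le> \<bar>c - hy\<bar> \<and> \<bar>c\<bar> \<le> \<rho> + \<tau>"
      proof (cases "\<rho> / 2 \<le> \<bar>c0 - hy\<bar>")
        case True
        then show ?thesis using c0 \<rho> \<rho>0 by (intro bexI[of _ c0]) auto
      next
        case False
        then have "\<rho> / 2 \<le> \<bar>c2 - hy\<bar>" "\<bar>c2\<bar> \<le> \<rho> + \<tau>" using c2(2) c0(2) by linarith+
        then show ?thesis using c2(1) by blast
      qed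
      then obtain d where d: "d \<in> T" "\<rho> / 2 \<le> \<bar>d - hy\<bar>" "\<bar>d\<bar> \<le> \<rho> + \<tau>" by blast
      define p where "p = y + (d - hy) *\<^sub>R \<nu>"
      have "\<nu> \<bullet> \<nu> = 1" using \<nu> by (simp add: dot_square_norm)
      then have hp: "\<nu> \<bullet> (p - x) = d"
        by (simp add: p_def hy_def inner_diff_right inner_add_right)
      have yp: "dist y p = \<bar>d - hy\<bar>" by (simp add: p_def dist_norm \<nu>)
      have yp5: "dist y p \<le> 4 * \<rho>" using yp d(3) h3 \<tau>\<rho> \<tau>(1) by linarith
      have "dist x p < R"
        using dist_triangle[of x p y] yp5 y(2) A\<rho> RAQ t Qt by linarith
      then obtain z where z: "z \<in> E" "dist p z < \<tau>" using P2 hp d(1) by blast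
      have "\<bar>\<nu> \<bullet> (p - x) - \<nu> \<bullet> (z - x)\<bar> \<le> dist p z"
        using Cauchy_Schwarz_ineq2[of \<nu> "p - z"] \<nu> by (simp add: dist_norm inner_diff_right)
      then have "\<rho> / 4 \<le> \<bar>hy - \<nu> \<bullet> (z - x)\<bar>" using hp d(2) z(2) \<tau>\<rho> \<tau>(1) by linarith
      moreover have "dist y z \<le> 6 * \<rho>" using dist_triangle[of y z p] yp5 z(2) \<tau>\<rho> \<tau>(1) by linarith
      ultimately show "\<exists>z\<in>E. dist y z \<le> 6 * \<rho> \<and> \<rho> / 4 \<le> \<bar>\<nu> \<bullet> (y - x) - \<nu> \<bullet> (z - x)\<bar>"
        using z(1) unfolding hy_def by blast
    qed
  qed (use \<Lambda> e' \<delta> in auto)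
qed

end

section \<open>Carleson packing\<close>

context ahlfors
begin

text \<open>Encoded as a density, so that the restricted measure keeps the Borel sets of the whole
  space, as \<open>upper_regular\<close> demands.\<close>

definition local_measure :: "'a set \<Rightarrow> 'a measure" where
  "local_measure F = density \<mu> (indicator F)"

lemma emeasure_local:
  assumes "open F" "open A"
  shows "emeasure (local_measure F) A = emeasure \<mu> (A \<inter> F)"
proof -
  have "F \<in> sets \<mu>" "A \<in> sets \<mu>" using assms by (auto simp: sets_\<mu>)
  then have "emeasure (local_measure F) A = (\<integral>\<^sup>+x. indicator F x * indicator A x \<partial>\<mu>)"
    unfolding local_measure_def by (intro emeasure_density) auto
  also have "\<dots> = (\<integral>\<^sup>+x. indicator (A \<inter> F) x \<partial>\<mu>)"
    by (rule nn_integral_cong) (auto simp: indicator_def)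
  also have "\<dots> = emeasure \<mu> (A \<inter> F)"
    using \<open>F \<in> sets \<mu>\<close> \<open>A \<in> sets \<mu>\<close> by (intro nn_integral_indicator sets.Int)
  finally show ?thesis .
qed

lemma upper_regular_local:
  assumes z: "z \<in> E" and r: "0 < r"
  shows "upper_regular (local_measure (ball z r)) E n C"
proof -
  have sets: "sets (local_measure (ball z r)) = sets borel" by (simp add: local_measure_def sets_\<mu>)
  have top: "emeasure (local_measure (ball z r)) UNIV \<le> ennreal (C * r ^ n)"
    using upper[OF z r] by (simp add: emeasure_local)
  interpret finite_measure "local_measure (ball z r)"
    using sets_eq_imp_space_eq[OF sets] top
    by (intro finite_measureI) (auto simp: top_unique less_top[symmetric] dest: neq_top_trans)
  show ?thesis
  proof (unfold_locales)
    show "sets (local_measure (ball z r)) = sets borel" by fact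
    have "AE y in \<mu>. y \<in> E"
      using null closed_E by (intro AE_I[of _ _ "- E"]) (auto simp: sets_\<mu> borel_closed)
    then show "AE y in local_measure (ball z r). y \<in> E"
      unfolding local_measure_def by (subst AE_density) (auto simp: sets_\<mu> elim!: eventually_mono)
    show "measure (local_measure (ball z r)) (ball u s) \<le> C * s ^ n" if "u \<in> E" "0 < s" for u s
    proof -
      have "emeasure (local_measure (ball z r)) (ball u s) \<le> emeasure \<mu> (ball u s)"
        by (subst emeasure_local) (auto intro!: emeasure_mono simp: sets_\<mu>)
      also have "\<dots> \<le> ennreal (C * s ^ n)" by (rule upper[OF that])
      finally show ?thesis using C_ge that by (simp add: emeasure_eq_measure)
    qed
    show "0 < C" using C_ge by simp
    show "closed E" by (rule closed_E)
  qed
qed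

lemma lower_local:
  assumes z: "z \<in> E" and r: "0 < r" and u: "u \<in> E" "admissible_radius E s" "ball u s \<subseteq> ball z r"
  shows "s ^ n / C \<le> measure (local_measure (ball z r)) (ball u s)"
proof -
  interpret upper_regular "local_measure (ball z r)" E n C by (rule upper_regular_local[OF z r])
  have "ball u s \<inter> ball z r = ball u s" using u by blast
  then have "ennreal (s ^ n / C) \<le> emeasure (local_measure (ball z r)) (ball u s)"
    using lower[OF u(1,2)] by (subst emeasure_local) auto
  then show ?thesis by (simp add: emeasure_eq_measure)
qed

text \<open>The bridge between two settings: test functions are built for the restricted measure,
  while the boundedness hypothesis speaks of the original one.\<close>

lemma riesz_trunc_component:
  assumes z: "z \<in> E" and r: "0 < r" and \<epsilon>: "0 < \<epsilon>"
  shows "\<nu> \<bullet> riesz_trunc n \<mu> \<epsilon> (indicator (ball z r)) u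
    = (\<integral>y. riesz_comp n \<nu> \<epsilon> u y \<partial>(local_measure (ball z r)))"
proof -
  interpret upper_regular "local_measure (ball z r)" E n C by (rule upper_regular_local[OF z r])
  define k where "k y = (if \<epsilon> < norm (u - y) then (1 / norm (u - y) ^ Suc n) *\<^sub>R (u - y) else 0)" for y
  have [measurable]: "k \<in> borel_measurable borel" unfolding k_def by measurable
  have k_bd: "norm (k y) \<le> 1 / \<epsilon> ^ n" for y
  proof (cases "\<epsilon> < norm (u - y)")
    case True
    then have "norm (k y) = 1 / norm (u - y) ^ n" using \<epsilon> by (auto simp: k_def)
    also have "\<dots> \<le> 1 / \<epsilon> ^ n" using True \<epsilon> by (intro frac_le power_mono) auto
    finally show ?thesis .
  qed (use \<epsilon> in \<open>simp add: k_def\<close>)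
  have int: "integrable (local_measure (ball z r)) k"
    using k_bd by (intro integrable_const_bound[of _ "1 / \<epsilon> ^ n"]) (auto simp: sets_M cong: measurable_cong_sets)
  have "riesz_trunc n \<mu> \<epsilon> (indicator (ball z r)) u = (\<integral>y. indicator (ball z r) y *\<^sub>R k y \<partial>\<mu>)"
    unfolding riesz_trunc_def set_lebesgue_integral_def
    by (intro Bochner_Integration.integral_cong) (auto simp: k_def indicator_def)
  also have "\<dots> = (\<integral>y. k y \<partial>(local_measure (ball z r)))"
    unfolding local_measure_def ennreal_indicator[symmetric]
    by (subst integral_density) (auto simp: sets_\<mu> cong: measurable_cong_sets)
  finally have "\<nu> \<bullet> riesz_trunc n \<mu> \<epsilon> (indicator (ball z r)) u = (\<integral>y. \<nu> \<bullet> k y \<partial>(local_measure (ball z r)))"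
    using int by simp
  also have "\<dots> = (\<integral>y. riesz_comp n \<nu> \<epsilon> u y \<partial>(local_measure (ball z r)))"
    by (intro Bochner_Integration.integral_cong) (auto simp: k_def riesz_comp_def)
  finally show ?thesis .
qed

text \<open>The testing inequality on balls, familiar from T1 theorems. The packing uses the
  boundedness of the Riesz transform in this form only.\<close>

lemma riesz_L2_local:
  assumes z: "z \<in> E" and r: "0 < r" and \<epsilon>: "0 < \<epsilon>" and K: "0 \<le> K"
    and bd: "\<And>f. f \<in> L2_space \<mu> \<Longrightarrow> riesz_trunc n \<mu> \<epsilon> f \<in> L2_space \<mu>
        \<and> L2_norm \<mu> (riesz_trunc n \<mu> \<epsilon> f) \<le> K * L2_norm \<mu> f"
  defines "g \<equiv> riesz_trunc n \<mu> \<epsilon> (indicator (ball z r))"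
  shows "g \<in> borel_measurable borel"
    and "integrable (local_measure (ball z r)) (\<lambda>y. (norm (g y))\<^sup>2)"
    and "(\<integral>y. (norm (g y))\<^sup>2 \<partial>(local_measure (ball z r))) \<le> K\<^sup>2 * (C * r ^ n)"
proof -
  have F: "ball z r \<in> sets \<mu>" by (simp add: sets_\<mu>)
  have fin: "emeasure \<mu> (ball z r) < \<infinity>"
    using upper[OF z r] by (auto simp: less_top[symmetric] top_unique)
  have sq: "(\<lambda>y. (norm (indicator (ball z r) y :: real))\<^sup>2) = indicator (ball z r)"
    by (auto simp: indicator_def)
  have "(indicator (ball z r) :: 'a \<Rightarrow> real) \<in> L2_space \<mu>"
    unfolding L2_space_def mem_Collect_eq sq using F fin by simp
  from bd[OF this] have g: "g \<in> L2_space \<mu>"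
    and gn: "L2_norm \<mu> g \<le> K * L2_norm \<mu> (indicator (ball z r) :: 'a \<Rightarrow> real)"
    by (auto simp: g_def)
  show gm: "g \<in> borel_measurable borel"
    using g by (simp add: L2_space_def sets_\<mu> cong: measurable_cong_sets)
  have gi: "integrable \<mu> (\<lambda>y. (norm (g y))\<^sup>2)" using g by (simp add: L2_space_def)
  have [measurable]: "g \<in> borel_measurable borel" by fact
  have gm2: "(\<lambda>y. (norm (g y))\<^sup>2) \<in> borel_measurable \<mu>"
    using gi by (rule borel_measurable_integrable)
  have ind: "(\<lambda>y. indicator (ball z r) y :: real) \<in> borel_measurable \<mu>" using F by simp
  have gi': "integrable \<mu> (\<lambda>y. indicator (ball z r) y *\<^sub>R (norm (g y))\<^sup>2)"
    by (rule integrable_mult_indicator[OF F gi])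
  show "integrable (local_measure (ball z r)) (\<lambda>y. (norm (g y))\<^sup>2)"
    unfolding local_measure_def ennreal_indicator[symmetric]
    by (subst integrable_density) (use gm2 ind gi' in auto)
  have "(\<integral>y. (norm (g y))\<^sup>2 \<partial>(local_measure (ball z r))) = (\<integral>y. indicator (ball z r) y *\<^sub>R (norm (g y))\<^sup>2 \<partial>\<mu>)"
    unfolding local_measure_def ennreal_indicator[symmetric]
    by (subst integral_density) (use gm2 ind in auto)
  also have "\<dots> \<le> (\<integral>y. (norm (g y))\<^sup>2 \<partial>\<mu>)"
    using gi gi' by (intro integral_mono) (auto simp: indicator_def)
  also have "\<dots> = (L2_norm \<mu> g)\<^sup>2" by (simp add: L2_norm_def)
  also have "\<dots> \<le> (K * L2_norm \<mu> (indicator (ball z r) :: 'a \<Rightarrow> real))\<^sup>2"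
    using gn by (intro power_mono) (auto simp: L2_norm_def)
  also have "\<dots> = K\<^sup>2 * measure \<mu> (ball z r)"
    using F unfolding L2_norm_def sq power_mult_distrib by simp
  also have "\<dots> \<le> K\<^sup>2 * (C * r ^ n)"
  proof (intro mult_left_mono)
    show "measure \<mu> (ball z r) \<le> C * r ^ n"
      unfolding measure_def using enn2real_mono[OF upper[OF z r]] C_ge r by simp
  qed simp
  finally show "(\<integral>y. (norm (g y))\<^sup>2 \<partial>(local_measure (ball z r))) \<le> K\<^sup>2 * (C * r ^ n)" .
qed

end

text \<open>\<open>B\<close> has to lie well between \<open>sqrt A\<close> and \<open>A\<close>.
  With \<open>t ^ 4\<close> and \<open>t ^ 6\<close> both terms become at most a multiple of
  \<open>1 / t\<close>; the bound \<open>3 \<le> t\<close> secures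
  \<open>8 * B \<le> A\<close>.\<close>

lemma bump_radii_exist:
  fixes k1 k2 \<kappa> :: real
  assumes "0 \<le> k1" "0 \<le> k2" "0 < \<kappa>"
  obtains A B where "1 \<le> B" "8 * B \<le> A" "k1 * sqrt (12 * A) / B + k2 * B / A \<le> \<kappa>"
proof -
  define t where "t = max 3 ((4 * k1 + k2) / \<kappa>)"
  have t: "3 \<le> t" "(4 * k1 + k2) / \<kappa> \<le> t" by (auto simp: t_def)
  have t1: "1 \<le> t" "0 < t" using t by auto
  have sq: "sqrt (12 * t ^ 6) \<le> 4 * t ^ 3"
  proof (rule real_le_lsqrt)
    show "12 * t ^ 6 \<le> (4 * t ^ 3)\<^sup>2" by (simp add: power_mult_distrib flip: power_mult)
  qed (use t1 in auto)
  have "k1 * sqrt (12 * t ^ 6) / t ^ 4 + k2 * t ^ 4 / t ^ 6 \<le> k1 * (4 * t ^ 3) / t ^ 4 + k2 * t ^ 4 / t ^ 6"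
    using assms t1 sq by (intro add_mono divide_right_mono mult_left_mono) auto
  also have "\<dots> = 4 * k1 / t + k2 / t\<^sup>2" using t1 by (simp add: power_numeral_reduce field_simps)
  also have "\<dots> \<le> 4 * k1 / t + k2 / t"
    using assms t1 by (intro add_mono divide_left_mono) (auto simp: power2_eq_square)
  also have "\<dots> \<le> \<kappa>" using t(2) t1 assms by (simp add: field_simps)
  finally have "k1 * sqrt (12 * t ^ 6) / t ^ 4 + k2 * t ^ 4 / t ^ 6 \<le> \<kappa>" .
  moreover have "8 * t ^ 4 \<le> t ^ 6"
  proof -
    have "(8::real) \<le> 3\<^sup>2" by simp
    also have "\<dots> \<le> t\<^sup>2" using t by (intro power_mono) auto
    finally have "8 * t ^ 4 \<le> t\<^sup>2 * t ^ 4" by (intro mult_right_mono) auto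
    then show ?thesis by (simp flip: power_add)
  qed
  moreover have "1 \<le> t ^ 4" using t1 by (simp add: one_le_power)
  ultimately show thesis using that by blast
qed

section \<open>Packing of stacked pairs\<close>

context ahlfors
begin

lemma admissible_mono: "admissible_radius E r \<Longrightarrow> 0 < s \<Longrightarrow> s \<le> r \<Longrightarrow> admissible_radius E s"
  by (auto simp: admissible_radius_def)

lemma packing_separated:
  assumes X: "finite X" "X \<subseteq> E" and s: "admissible_radius E s"
    and sep: "\<And>x y. x \<in> X \<Longrightarrow> y \<in> X \<Longrightarrow> x \<noteq> y \<Longrightarrow> s \<le> dist x y"
    and u: "u \<in> E" and sub: "\<And>x. x \<in> X \<Longrightarrow> dist u x < r" and r: "s \<le> r"
  shows "real (card X) * s ^ n \<le> C\<^sup>2 * 4 ^ n * r ^ n"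
proof -
  have s0: "0 < s" using s by (simp add: admissible_radius_def)
  have "real (card X) * (s / 2) ^ n \<le> C\<^sup>2 * (2 * r) ^ n"
  proof (rule packing[where p = "\<lambda>x. x"])
    show "admissible_radius E (s / 2)" using admissible_mono[OF s, of "s / 2"] s0 by simp
    show "2 * (s / 2) \<le> dist x y" if "x \<in> X" "y \<in> X" "x \<noteq> y" for x y using sep that by simp
    show "ball x (s / 2) \<subseteq> ball u (2 * r)" if "x \<in> X" for x
    proof
      fix y assume "y \<in> ball x (s / 2)"
      then show "y \<in> ball u (2 * r)"
        using sub[OF that] dist_triangle[of u y x] r s0 by auto
    qed
  qed (use X u s0 r in auto)
  then have "real (card X) * (s / 2) ^ n * 2 ^ n \<le> C\<^sup>2 * (2 * r) ^ n * 2 ^ n"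
    by (rule mult_right_mono) simp
  moreover have "(4::real) ^ n = 2 ^ n * 2 ^ n" by (simp flip: power_mult_distrib)
  ultimately show ?thesis by (simp add: power_divide power_mult_distrib mult_ac)
qed

text \<open>Every stacked pair yields a test function that correlates with the same
  \<open>g\<close>, the transform of the indicator of \<open>ball z (2 * r0)\<close>;
  \<open>almost_orthogonality\<close> sums these correlations and the testing inequality bounds
  \<open>g\<close>. \<open>K\<close> is chosen before \<open>m\<close>, so the restriction to
  finitely many levels is lost harmlessly in the limit.\<close>

lemma stacked_sum_bound:
  fixes A B \<Lambda> \<delta> :: real
  defines "\<kappa> \<equiv> 1 / (64 * 8 ^ n * 7 ^ Suc n * C\<^sup>2)"
  assumes AB: "1 \<le> B" "8 * B \<le> A"
    and AB2: "24 * C\<^sup>2 * 8 ^ n * sqrt (12 * A) / B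
        + 48 * ((2 * real n + 3) * 2 ^ Suc n) * C\<^sup>2 * 4 ^ n * B / A \<le> \<kappa> / 2"
    and \<delta>: "0 < \<delta>" and \<Lambda>: "4 \<le> \<Lambda>" and riesz: "riesz_L2_bounded n \<mu>"
  shows "\<exists>K\<ge>0. \<forall>z\<in>E. \<forall>r0. admissible_radius E r0 \<longrightarrow> (\<forall>m Z.
    (\<forall>k<m. finite (Z k) \<and> Z k \<subseteq> E \<inter> ball z r0
      \<and> (\<forall>x\<in>Z k. \<forall>y\<in>Z k. x \<noteq> y \<longrightarrow> r0 / 2 ^ k \<le> dist x y)
      \<and> (\<forall>x\<in>Z k. \<exists>t. r0 / 2 ^ Suc k < t \<and> t \<le> r0 / 2 ^ k \<and> \<Lambda> * t \<le> r0 \<and> stacked A \<Lambda> \<delta> x t))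
    \<longrightarrow> (\<Sum>k<m. real (card (Z k)) * (r0 / 2 ^ k) ^ n) \<le> K * r0 ^ n)"
proof -
  obtain K0 where K0: "\<And>\<epsilon> f. 0 < \<epsilon> \<Longrightarrow> f \<in> L2_space \<mu> \<Longrightarrow> riesz_trunc n \<mu> \<epsilon> f \<in> L2_space \<mu>
        \<and> L2_norm \<mu> (riesz_trunc n \<mu> \<epsilon> f) \<le> K0 * L2_norm \<mu> f"
    using riesz unfolding riesz_L2_bounded_def by blast
  define K1 where "K1 = max 0 K0"
  have K1: "0 \<le> K1" by (simp add: K1_def)
  have bd: "riesz_trunc n \<mu> \<epsilon> f \<in> L2_space \<mu> \<and> L2_norm \<mu> (riesz_trunc n \<mu> \<epsilon> f) \<le> K1 * L2_norm \<mu> f"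
    if "0 < \<epsilon>" "f \<in> L2_space \<mu>" for \<epsilon> f
  proof -
    have "0 \<le> L2_norm \<mu> f" by (simp add: L2_norm_def)
    then have "K0 * L2_norm \<mu> f \<le> K1 * L2_norm \<mu> f" by (intro mult_right_mono) (auto simp: K1_def)
    then show ?thesis using K0[OF that] by linarith
  qed
  \<comment> \<open>By \<open>2 * A * \<rho> \<le> \<Lambda> * t\<close>, the size
    \<open>6 * \<rho>\<close> and the support radius \<open>2 * B * \<rho>\<close> of a test
    function are both at most \<open>3 * \<Lambda>\<close> times the dyadic scale
    \<open>r0 / 2 ^ k\<close>.\<close>
  define a where "a = 3 * \<Lambda>"
  define P where "P = C\<^sup>2 * 4 ^ n * (2 * a) ^ n"
  \<comment> \<open>The width \<open>\<rho>\<close> is at least \<open>\<delta> / 2\<close> times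
    the dyadic scale, so the correlation is at least \<open>c\<close> times the scale to the power
    \<open>Suc n\<close>. Dividing the test function by the scale removes one power.\<close>
  define c where "c = \<kappa> / 4 * (\<delta> / 2) ^ Suc n"
  have \<kappa>: "0 < \<kappa>" using C_ge by (simp add: \<kappa>_def)
  have a: "0 < a" "12 \<le> a" using \<Lambda> by (auto simp: a_def)
  have P: "0 < P" using C_ge a by (simp add: P_def)
  have c: "0 < c" using \<kappa> \<delta> by (simp add: c_def)
  define K where "K = 4 * (7 * a\<^sup>2 * C * a ^ n) * P / c\<^sup>2 * (K1\<^sup>2 * (C * 2 ^ n))"
  have K: "0 \<le> K" using a P c C_ge by (simp add: K_def)
  show ?thesis
  proof (rule exI[of _ K], intro conjI K ballI allI impI)
    fix z r0 m and Z :: "nat \<Rightarrow> 'a set"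
    assume z: "z \<in> E" and adm: "admissible_radius E r0"
      and Z: "\<forall>k<m. finite (Z k) \<and> Z k \<subseteq> E \<inter> ball z r0
      \<and> (\<forall>x\<in>Z k. \<forall>y\<in>Z k. x \<noteq> y \<longrightarrow> r0 / 2 ^ k \<le> dist x y)
      \<and> (\<forall>x\<in>Z k. \<exists>t. r0 / 2 ^ Suc k < t \<and> t \<le> r0 / 2 ^ k \<and> \<Lambda> * t \<le> r0 \<and> stacked A \<Lambda> \<delta> x t)"
    have Z_fin: "finite (Z k)" if "k < m" for k using Z that by blast
    have Z_E: "x \<in> E" "dist z x < r0" if "k < m" "x \<in> Z k" for k x
    proof -
      have "x \<in> E \<inter> ball z r0" using Z that by blast
      then show "x \<in> E" "dist z x < r0" by auto
    qed
    have Z_sep: "r0 / 2 ^ k \<le> dist x y" if "k < m" "x \<in> Z k" "y \<in> Z k" "x \<noteq> y" for k x y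
      using Z that by blast
    have r0: "0 < r0" using adm by (simp add: admissible_radius_def)
    then have r2: "0 < 2 * r0" by simp
    \<comment> \<open>The radius \<open>2 * r0\<close> accommodates the slab balls
      \<open>ball x (A * \<rho>)\<close> of all centres in \<open>ball z r0\<close>, so the lower
      regularity is inherited there.\<close>
    let ?M = "local_measure (ball z (2 * r0))"
    interpret M: upper_regular ?M E n C by (rule upper_regular_local[OF z r2])
    \<comment> \<open>All scales in play exceed \<open>r0 / 2 ^ m\<close> and
      \<open>\<rho> \<ge> \<delta> * t\<close>, so \<open>\<epsilon> \<le> \<rho> / 8\<close> holds
      on all levels at once. The dependence on \<open>m\<close> is harmless because
      \<open>K1\<close> is uniform in the truncation.\<close>
    define \<epsilon> where "\<epsilon> = \<delta> * (r0 / 2 ^ m) / 16"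
    have \<epsilon>: "0 < \<epsilon>" using \<delta> r0 by (simp add: \<epsilon>_def)
    define g where "g = riesz_trunc n \<mu> \<epsilon> (indicator (ball z (2 * r0)))"
    note g = riesz_L2_local[OF z r2 \<epsilon> K1 bd[OF \<epsilon>], folded g_def]
    define I where "I = Sigma {..<m} Z"
    have I: "finite I" unfolding I_def using Z_fin by (intro finite_SigmaI) auto
    define s where "s i = r0 / 2 ^ fst i" for i :: "nat \<times> 'a"
    have s: "0 < s i" for i using r0 by (simp add: s_def)
    have ex: "\<exists>\<nu> \<psi>. norm \<nu> = 1 \<and> M.adapted a (snd i) (s i) \<psi>
        \<and> c * s i ^ n \<le> (\<integral>y. \<psi> y * (\<nu> \<bullet> g y) \<partial>?M)" if i: "i \<in> I" for i
    proof -
      obtain k x where kx: "i = (k, x)" "k < m" "x \<in> Z k" using i by (auto simp: I_def)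
      have x: "x \<in> E" "dist z x < r0" using Z_E[OF kx(2,3)] by auto
      obtain t where t: "r0 / 2 ^ Suc k < t" "t \<le> r0 / 2 ^ k" "\<Lambda> * t \<le> r0" "stacked A \<Lambda> \<delta> x t"
        using Z kx by blast
      have t0: "0 < t" using t(1) r0 by (meson divide_pos_pos less_trans zero_less_numeral zero_less_power)
      obtain \<nu> \<rho> where \<nu>: "norm \<nu> = 1" and \<rho>: "\<delta> * t \<le> \<rho>" "2 * A * \<rho> \<le> \<Lambda> * t"
        and G1: "\<forall>y\<in>E. dist x y < A * \<rho> \<longrightarrow> \<bar>\<nu> \<bullet> (y - x)\<bar> \<le> 3 * \<rho>"
        and G2: "\<forall>y\<in>E. dist x y < A * \<rho> \<longrightarrow>
             (\<exists>z\<in>E. dist y z \<le> 6 * \<rho> \<and> \<rho> / 4 \<le> \<bar>\<nu> \<bullet> (y - x) - \<nu> \<bullet> (z - x)\<bar>)"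
        using t(4) unfolding stacked_def by blast
      have "0 < \<delta> * t" using \<delta> t0 by simp
      then have \<rho>0: "0 < \<rho>" using \<rho>(1) by linarith
      have "r0 / 2 ^ m \<le> r0 / 2 ^ Suc k"
        using r0 kx(2) by (intro divide_left_mono power_increasing) auto
      then have "r0 / 2 ^ m \<le> t" using t(1) by linarith
      then have "\<delta> * (r0 / 2 ^ m) \<le> \<delta> * t" using \<delta> by (intro mult_left_mono) auto
      then have \<epsilon>\<rho>: "\<epsilon> \<le> \<rho> / 8" using \<rho>(1) \<rho>0 by (simp add: \<epsilon>_def)
      have A\<rho>: "A * \<rho> \<le> r0 / 2" "B * \<rho> \<le> A * \<rho>" "\<rho> \<le> A * \<rho>"
        using \<rho>(2) t(3) AB \<rho>0 mult_right_mono[of B A \<rho>] mult_right_mono[of 1 A \<rho>] by auto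
      have low: "r ^ n / C \<le> measure ?M (ball u r)" if u: "u \<in> E" "0 < r" "ball u r \<subseteq> ball x (A * \<rho>)" for u r
      proof (rule lower_local[OF z r2 u(1)])
        have "dist u x + r \<le> A * \<rho>" using u(2,3) ball_subset_ball_iff[of u r x "A * \<rho>"] by auto
        then have "r \<le> A * \<rho>" using zero_le_dist[of u x] by linarith
        then show "admissible_radius E r" using A\<rho> r0 u by (intro admissible_mono[OF adm]) auto
        have "ball x (A * \<rho>) \<subseteq> ball z (2 * r0)"
        proof
          fix y assume "y \<in> ball x (A * \<rho>)"
          then show "y \<in> ball z (2 * r0)" using dist_triangle[of z y x] x A\<rho> r0 by auto
        qed
        then show "ball u r \<subseteq> ball z (2 * r0)" using u(3) by blast
      qed
      have "\<exists>\<psi>. \<psi> \<in> borel_measurable borel \<and> (\<forall>y\<in>E. \<bar>\<psi> y\<bar> \<le> 6 * \<rho>)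
          \<and> (\<forall>y. 2 * B * \<rho> \<le> dist x y \<longrightarrow> \<psi> y = 0)
          \<and> (\<forall>u\<in>E. \<forall>y\<in>E. \<bar>\<psi> u - \<psi> y\<bar> \<le> 7 * dist u y)
          \<and> (\<integral>y. \<psi> y \<partial>?M) = 0
          \<and> \<kappa> / 4 * \<rho> ^ Suc n \<le> (\<integral>u. \<psi> u * (\<integral>y. riesz_comp n \<nu> \<epsilon> u y \<partial>?M) \<partial>?M)"
        unfolding \<kappa>_def
      proof (rule M.nonflat_test_function[OF \<rho>0 AB \<epsilon> \<epsilon>\<rho> x(1) \<nu> low _ _ AB2[unfolded \<kappa>_def]])
        show "\<bar>\<nu> \<bullet> (y - x)\<bar> \<le> 3 * \<rho>" if "y \<in> E" "dist x y < A * \<rho>" for y using G1 that by blast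
        show "\<exists>e\<in>E. dist y e \<le> 6 * \<rho> \<and> \<rho> / 4 \<le> \<bar>\<nu> \<bullet> (y - x) - \<nu> \<bullet> (e - x)\<bar>"
          if "y \<in> E" "dist x y < B * \<rho>" for y
          using G2 that A\<rho>(2) by (meson less_le_trans)
      qed
      then obtain \<psi> where \<psi>: "\<psi> \<in> borel_measurable borel" "\<And>y. y \<in> E \<Longrightarrow> \<bar>\<psi> y\<bar> \<le> 6 * \<rho>"
          "\<And>y. 2 * B * \<rho> \<le> dist x y \<Longrightarrow> \<psi> y = 0"
          "\<And>u y. u \<in> E \<Longrightarrow> y \<in> E \<Longrightarrow> \<bar>\<psi> u - \<psi> y\<bar> \<le> 7 * dist u y"
          "(\<integral>y. \<psi> y \<partial>?M) = 0"
          "\<kappa> / 4 * \<rho> ^ Suc n \<le> (\<integral>u. \<psi> u * (\<integral>y. riesz_comp n \<nu> \<epsilon> u y \<partial>?M) \<partial>?M)"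
        by blast
      have si: "s i = r0 / 2 ^ k" by (simp add: s_def kx)
      have "\<Lambda> * t \<le> \<Lambda> * s i" using t(2) \<Lambda> si by (intro mult_left_mono) auto
      then have \<rho>s: "2 * (A * \<rho>) \<le> \<Lambda> * s i" using \<rho>(2) by simp
      have "M.adapted a x (s i) (\<lambda>y. \<psi> y / s i)"
        unfolding M.adapted_def
      proof (intro conjI ballI allI impI)
        show "(\<lambda>y. \<psi> y / s i) \<in> borel_measurable borel" using \<psi>(1) by measurable
        show "\<bar>\<psi> y / s i\<bar> \<le> a" if "y \<in> E" for y
        proof -
          have "\<bar>\<psi> y\<bar> \<le> a * s i" using \<psi>(2)[OF that] \<rho>s A\<rho>(3) unfolding a_def by linarith
          then show ?thesis using s[of i] by (simp add: abs_divide pos_divide_le_eq)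
        qed
        show "\<psi> y / s i = 0" if "a * s i \<le> dist x y" for y
        proof -
          have "0 < \<Lambda> * s i" using \<Lambda> s[of i] by simp
          then have "2 * B * \<rho> \<le> dist x y" using that \<rho>s A\<rho>(2) unfolding a_def by linarith
          then show ?thesis using \<psi>(3) by simp
        qed
        show "\<bar>\<psi> u / s i - \<psi> y / s i\<bar> \<le> 7 / s i * dist u y" if "u \<in> E" "y \<in> E" for u y
        proof -
          have "\<bar>\<psi> u / s i - \<psi> y / s i\<bar> = \<bar>\<psi> u - \<psi> y\<bar> / s i"
            using s[of i] by (simp add: abs_divide flip: diff_divide_distrib)
          then show ?thesis using \<psi>(4)[OF that] s[of i] by (simp add: divide_right_mono)
        qed
        show "(\<integral>y. \<psi> y / s i \<partial>?M) = 0" using \<psi>(5) by simp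
      qed
      moreover have "c * s i ^ n \<le> (\<integral>y. \<psi> y / s i * (\<nu> \<bullet> g y) \<partial>?M)"
      proof -
        have "\<delta> * s i / 2 \<le> \<rho>"
        proof -
          have "\<delta> * (r0 / 2 ^ Suc k) \<le> \<delta> * t" using t(1) \<delta> by (intro mult_left_mono) auto
          then show ?thesis using \<rho>(1) by (simp add: si)
        qed
        then have "(\<delta> * s i / 2) ^ Suc n \<le> \<rho> ^ Suc n"
          using \<delta> s[of i] by (intro power_mono) auto
        then have "\<kappa> / 4 * (\<delta> * s i / 2) ^ Suc n \<le> \<kappa> / 4 * \<rho> ^ Suc n"
          using \<kappa> by (intro mult_left_mono) auto
        also have "\<dots> \<le> (\<integral>y. \<psi> y * (\<nu> \<bullet> g y) \<partial>?M)"
          using \<psi>(6) unfolding g_def riesz_trunc_component[OF z r2 \<epsilon>] .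
        also have "\<kappa> / 4 * (\<delta> * s i / 2) ^ Suc n = c * s i ^ n * s i"
          by (simp add: c_def power_mult_distrib power_divide)
        finally have "c * s i ^ n \<le> (\<integral>y. \<psi> y * (\<nu> \<bullet> g y) \<partial>?M) / s i"
          using s[of i] by (simp add: pos_le_divide_eq)
        also have "\<dots> = (\<integral>y. \<psi> y / s i * (\<nu> \<bullet> g y) \<partial>?M)"
          by (simp flip: Bochner_Integration.integral_divide_zero)
        finally show ?thesis .
      qed
      moreover have snd_i: "snd i = x" by (simp add: kx(1))
      ultimately show ?thesis
        unfolding snd_i using \<nu> by (intro exI[of _ \<nu>] exI[of _ "\<lambda>y. \<psi> y / s i"] conjI)
    qed
    define Q where "Q i \<nu> \<psi> \<longleftrightarrow> norm \<nu> = 1 \<and> M.adapted a (snd i) (s i) \<psi>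
        \<and> c * s i ^ n \<le> (\<integral>y. \<psi> y * (\<nu> \<bullet> g y) \<partial>?M)" for i \<nu> \<psi>
    have "\<forall>i\<in>I. \<exists>\<nu>. \<exists>\<psi>. Q i \<nu> \<psi>" unfolding Q_def using ex by (rule ballI)
    from bchoice[OF this] obtain \<nu> where "\<forall>i\<in>I. \<exists>\<psi>. Q i (\<nu> i) \<psi>" by (elim exE) (rule that)
    from bchoice[OF this] obtain \<psi> where "\<forall>i\<in>I. Q i (\<nu> i) (\<psi> i)" by (elim exE) (rule that)
    then have \<nu>\<psi>: "i \<in> I \<Longrightarrow> norm (\<nu> i) = 1"
        "i \<in> I \<Longrightarrow> M.adapted a (snd i) (s i) (\<psi> i)"
        "i \<in> I \<Longrightarrow> c * s i ^ n \<le> (\<integral>y. \<psi> i y * (\<nu> i \<bullet> g y) \<partial>?M)" for i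
      unfolding Q_def by blast+
    have pack: "real (card {j \<in> I. fst j = l \<and> dist (snd i) (snd j) < 2 * a * s i}) * (r0 / 2 ^ l) ^ n \<le> P * s i ^ n"
      if i: "i \<in> I" and l: "fst i \<le> l" for i l
    proof -
      let ?J = "{j \<in> I. fst j = l \<and> dist (snd i) (snd j) < 2 * a * s i}"
      have inj: "inj_on snd ?J" by (auto simp: inj_on_def)
      have sl: "r0 / 2 ^ l \<le> s i" "r0 / 2 ^ l \<le> r0"
        unfolding s_def using l r0 by (auto intro: divide_left_mono power_increasing simp: divide_le_eq_1 field_simps)
      have "real (card (snd ` ?J)) * (r0 / 2 ^ l) ^ n \<le> C\<^sup>2 * 4 ^ n * (2 * a * s i) ^ n"
      proof (rule packing_separated)
        show "finite (snd ` ?J)" using I by auto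
        show "snd ` ?J \<subseteq> E" "snd i \<in> E" using Z_E i by (auto simp: I_def)
        show "admissible_radius E (r0 / 2 ^ l)" using sl r0 by (intro admissible_mono[OF adm]) auto
        show "r0 / 2 ^ l \<le> dist x y" if "x \<in> snd ` ?J" "y \<in> snd ` ?J" "x \<noteq> y" for x y
          using that Z_sep by (auto simp: I_def)
        have "1 * s i \<le> 2 * a * s i" using a s[of i] by (intro mult_right_mono) auto
        then show "r0 / 2 ^ l \<le> 2 * a * s i" using sl by linarith
      qed auto
      then show ?thesis
        unfolding card_image[OF inj] P_def power_mult_distrib[of "2 * a"] by (simp only: mult_ac)
    qed
    have "(\<Sum>k<m. real (card (Z k)) * (r0 / 2 ^ k) ^ n) = (\<Sum>k<m. \<Sum>x\<in>Z k. (r0 / 2 ^ k) ^ n)" by simp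
    also have "\<dots> = (\<Sum>i\<in>I. s i ^ n)"
      unfolding I_def s_def using Z_fin by (subst sum.Sigma) (auto simp: case_prod_beta)
    also have "\<dots> \<le> 4 * (7 * a\<^sup>2 * C * a ^ n) * P / c\<^sup>2 * (\<integral>y. (norm (g y))\<^sup>2 \<partial>?M)"
      unfolding s_def
    proof (rule M.almost_orthogonality[OF I r0 a(1) P c _ _ _ _ g(1,2)])
      show "snd i \<in> E" if "i \<in> I" for i using that Z_E by (auto simp: I_def)
    qed (use \<nu>\<psi> pack in \<open>auto simp: s_def\<close>)
    also have "\<dots> \<le> 4 * (7 * a\<^sup>2 * C * a ^ n) * P / c\<^sup>2 * (K1\<^sup>2 * (C * (2 * r0) ^ n))"
      using g(3) a P c C_ge by (intro mult_left_mono) auto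
    also have "\<dots> = K * r0 ^ n" by (simp add: K_def power_mult_distrib)
    finally show "(\<Sum>k<m. real (card (Z k)) * (r0 / 2 ^ k) ^ n) \<le> K * r0 ^ n" .
  qed
qed

end

section \<open>Packing of pairs failing the BAUPP\<close>

lemma BAUPP_rescale:
  assumes app: "(x, t') \<in> BAUPP n \<mu> \<epsilon>" and y: "y \<in> msupp \<mu>" and T: "0 < T" "dist x y + T \<le> t'" "t' \<le> 5 * T"
  shows "(y, T) \<in> BAUPP n \<mu> (5 * \<epsilon>)"
proof -
  have "\<exists>I. I \<noteq> {} \<and> (\<forall>L\<in>I. is_plane n L) \<and> (\<forall>L\<in>I. \<forall>L'\<in>I. affine_parallel L L')
      \<and> bilateral_dev (msupp \<mu>) (\<Union>I) x t' \<le> ennreal \<epsilon>" and t': "0 < t'"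
    using app by (simp_all add: BAUPP_def)
  then obtain I where I: "I \<noteq> {}" "\<forall>L\<in>I. is_plane n L" "\<forall>L\<in>I. \<forall>L'\<in>I. affine_parallel L L'"
      and dev: "bilateral_dev (msupp \<mu>) (\<Union>I) x t' \<le> ennreal \<epsilon>" by (elim exE conjE) (rule that)
  have sub: "ball y T \<subseteq> ball x t'"
  proof
    fix v assume "v \<in> ball y T"
    then show "v \<in> ball x t'" using dist_triangle[of x v y] T by auto
  qed
  \<comment> \<open>The same planes serve the smaller ball; dividing by \<open>T\<close> instead of
    \<open>t'\<close> costs a factor of at most 5.\<close>
  have le: "(SUP v\<in>S \<inter> ball y T. ennreal (infdist v H / T)) \<le> 5 * (SUP v\<in>S \<inter> ball x t'. ennreal (infdist v H / t'))"
    for S H :: "'a set"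
  proof (rule SUP_least)
    fix v assume v: "v \<in> S \<inter> ball y T"
    have "infdist v H / T \<le> 5 * (infdist v H / t')"
      using T t' infdist_nonneg[of v H] mult_right_mono[of t' "5 * T" "infdist v H"] by (simp add: field_simps)
    then have "ennreal (infdist v H / T) \<le> ennreal (5 * (infdist v H / t'))" by (rule ennreal_leI)
    also have "\<dots> = 5 * ennreal (infdist v H / t')"
      using t' by (subst ennreal_mult) (auto simp: infdist_nonneg)
    also have "\<dots> \<le> 5 * (SUP v\<in>S \<inter> ball x t'. ennreal (infdist v H / t'))"
      using v sub by (intro mult_left_mono SUP_upper) auto
    finally show "ennreal (infdist v H / T) \<le> 5 * (SUP v\<in>S \<inter> ball x t'. ennreal (infdist v H / t'))" .
  qed
  have "bilateral_dev (msupp \<mu>) (\<Union>I) y T \<le> 5 * bilateral_dev (msupp \<mu>) (\<Union>I) x t'"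
    unfolding bilateral_dev_def distrib_left by (intro add_mono le)
  also have "\<dots> \<le> 5 * ennreal \<epsilon>" using dev by (intro mult_left_mono) auto
  also have "\<dots> = ennreal (5 * \<epsilon>)" by (simp add: ennreal_mult')
  finally show ?thesis unfolding BAUPP_def using y T I by blast
qed

text \<open>The exact value is \<open>ln 2\<close>; the least value \<open>1 / (2 * v)\<close> of
  the integrand times the length \<open>v\<close> is enough.\<close>

lemma nn_integral_inverse_ge_half:
  fixes v :: real
  assumes "0 < v"
  shows "ennreal (1 / 2) \<le> (\<integral>\<^sup>+t. indicator {v<..2 * v} t * ennreal (1 / t) \<partial>lborel)"
proof -
  have "ennreal (1 / 2) = ennreal (1 / (2 * v)) * ennreal v"
    using assms by (simp flip: ennreal_mult)
  also have "\<dots> = ennreal (1 / (2 * v)) * emeasure lborel {v<..2 * v}" using assms by simp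
  also have "\<dots> = (\<integral>\<^sup>+t. ennreal (1 / (2 * v)) * indicator {v<..2 * v} t \<partial>lborel)"
    by (rule nn_integral_cmult_indicator[symmetric]) simp
  also have "\<dots> \<le> (\<integral>\<^sup>+t. indicator {v<..2 * v} t * ennreal (1 / t) \<partial>lborel)"
  proof (rule nn_integral_mono)
    fix t
    show "ennreal (1 / (2 * v)) * indicator {v<..2 * v} t \<le> indicator {v<..2 * v} t * ennreal (1 / t)"
    proof (cases "t \<in> {v<..2 * v}")
      case True
      then have "ennreal (1 / (2 * v)) \<le> ennreal (1 / t)"
        using assms by (intro ennreal_leI divide_left_mono) auto
      then show ?thesis using True by simp
    qed simp
  qed
  finally show ?thesis .
qed

context ahlfors
begin

text \<open>A separated subset of largest cardinality exists because
  \<open>packing_separated\<close> bounds all of them, and it covers \<open>S\<close> because an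
  uncovered point could be added.\<close>

lemma separated_net:
  assumes z: "z \<in> E" and S: "S \<subseteq> E \<inter> ball z r" and s: "admissible_radius E s" "s \<le> r"
  obtains X where "X \<subseteq> S" "finite X" "\<And>x y. x \<in> X \<Longrightarrow> y \<in> X \<Longrightarrow> x \<noteq> y \<Longrightarrow> s \<le> dist x y"
    "\<And>x. x \<in> S \<Longrightarrow> \<exists>y\<in>X. dist y x < s"
proof -
  have s0: "0 < s" using s by (simp add: admissible_radius_def)
  define Q where "Q X \<longleftrightarrow> X \<subseteq> S \<and> finite X \<and> (\<forall>x\<in>X. \<forall>y\<in>X. x \<noteq> y \<longrightarrow> s \<le> dist x y)" for X
  define b where "b = nat \<lceil>C\<^sup>2 * 4 ^ n * r ^ n / s ^ n\<rceil>"
  have "card X \<le> b" if "Q X" for X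
  proof -
    have "real (card X) * s ^ n \<le> C\<^sup>2 * 4 ^ n * r ^ n"
    proof (rule packing_separated[OF _ _ s(1) _ z _ s(2)])
      show "finite X" "X \<subseteq> E" using that S by (auto simp: Q_def)
      show "s \<le> dist x y" if "x \<in> X" "y \<in> X" "x \<noteq> y" for x y using \<open>Q X\<close> that by (auto simp: Q_def)
      show "dist z x < r" if "x \<in> X" for x using \<open>Q X\<close> that S by (auto simp: Q_def)
    qed
    then have "real (card X) \<le> C\<^sup>2 * 4 ^ n * r ^ n / s ^ n" using s0 by (simp add: pos_le_divide_eq)
    then show ?thesis unfolding b_def by linarith
  qed
  moreover have "Q {}" by (simp add: Q_def)
  ultimately obtain X where X: "Q X" "\<And>Y. Q Y \<Longrightarrow> card Y \<le> card X"
    using ex_has_greatest_nat[of Q "{}" card "Suc b"] by (auto simp: less_Suc_eq_le)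
  have "\<exists>y\<in>X. dist y x < s" if "x \<in> S" for x
  proof (rule ccontr)
    assume no: "\<not> (\<exists>y\<in>X. dist y x < s)"
    then have "x \<notin> X" using s0 by force
    have "Q (insert x X)" using X(1) no that by (auto simp: Q_def not_less dist_commute)
    then have "card (insert x X) \<le> card X" by (rule X(2))
    then show False using \<open>x \<notin> X\<close> X(1) by (simp add: Q_def)
  qed
  then show thesis using X(1) that[of X] unfolding Q_def by blast
qed

text \<open>A bad pair \<open>(y, \<Lambda> t)\<close> spoils the full product of a ball around \<open>y\<close> with an interval of slightly
  larger scales, by \<open>BAUPP_rescale\<close>. Comparing with these disjoint products avoids any appeal to the
  measurability of the set of bad pairs.\<close>

lemma BAUPP_sum_bound:
  assumes E: "E = msupp \<mu>" and \<Lambda>: "4 \<le> \<Lambda>" and car: "bad_set_carleson \<mu> (BAUPP n \<mu> (e / 5))"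
  shows "\<exists>K\<ge>0. \<forall>w\<in>E. \<forall>r0. admissible_radius E r0 \<longrightarrow> (\<forall>m Y.
    (\<forall>k<m. finite (Y k) \<and> Y k \<subseteq> E \<inter> ball w (r0 / 4)
      \<and> (\<forall>x\<in>Y k. \<forall>y\<in>Y k. x \<noteq> y \<longrightarrow> r0 / 2 ^ k \<le> dist x y)
      \<and> (\<forall>y\<in>Y k. \<exists>t. r0 / 2 ^ Suc k < t \<and> t \<le> r0 / 2 ^ k \<and> 5 * \<Lambda> * (r0 / 2 ^ k) < r0
            \<and> (y, \<Lambda> * t) \<notin> BAUPP n \<mu> e))
    \<longrightarrow> (\<Sum>k<m. real (card (Y k)) * (r0 / 2 ^ k) ^ n) \<le> K * r0 ^ n)"
proof -
  let ?G = "BAUPP n \<mu> (e / 5)"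
  obtain Cb0 where Cb0: "\<And>z r. z \<in> E \<Longrightarrow> admissible_radius E r \<Longrightarrow>
        (\<integral>\<^sup>+x\<in>ball z r. (\<integral>\<^sup>+t\<in>{0<..<r}. indicator (- ?G) (x, t) * ennreal (1 / t) \<partial>lborel) \<partial>\<mu>)
          \<le> ennreal Cb0 * emeasure \<mu> (ball z r)"
    using car unfolding bad_set_carleson_def E by blast
  define Cb where "Cb = max 0 Cb0"
  have Cb: "0 \<le> Cb" "Cb0 \<le> Cb" by (auto simp: Cb_def)
  define K where "K = 2 * C\<^sup>2 * Cb"
  show ?thesis
  proof (rule exI[of _ K], intro conjI ballI allI impI)
    show "0 \<le> K" using Cb by (simp add: K_def)
    fix w r0 m and Y :: "nat \<Rightarrow> 'a set"
    assume w: "w \<in> E" and adm: "admissible_radius E r0"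
      and Y: "\<forall>k<m. finite (Y k) \<and> Y k \<subseteq> E \<inter> ball w (r0 / 4)
      \<and> (\<forall>x\<in>Y k. \<forall>y\<in>Y k. x \<noteq> y \<longrightarrow> r0 / 2 ^ k \<le> dist x y)
      \<and> (\<forall>y\<in>Y k. \<exists>t. r0 / 2 ^ Suc k < t \<and> t \<le> r0 / 2 ^ k \<and> 5 * \<Lambda> * (r0 / 2 ^ k) < r0
            \<and> (y, \<Lambda> * t) \<notin> BAUPP n \<mu> e)"
    have r0: "0 < r0" using adm by (simp add: admissible_radius_def)
    define s where "s k = r0 / 2 ^ k" for k :: nat
    have s: "0 < s k" "s k \<le> r0" "s (Suc k) = s k / 2" for k
      using r0 by (auto simp: s_def divide_le_eq field_simps)
    have Y_fin: "finite (Y k)" if "k < m" for k using Y that by blast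
    have Y_E: "y \<in> E" "dist w y < r0 / 4" if "k < m" "y \<in> Y k" for k y
    proof -
      have "y \<in> E \<inter> ball w (r0 / 4)" using Y that by blast
      then show "y \<in> E" "dist w y < r0 / 4" by auto
    qed
    have Y_sep: "s k \<le> dist x y" if "k < m" "x \<in> Y k" "y \<in> Y k" "x \<noteq> y" for k x y
      using Y that unfolding s_def by blast
    have Y_t: "\<exists>t. s k / 2 < t \<and> t \<le> s k \<and> 5 * \<Lambda> * s k < r0 \<and> (y, \<Lambda> * t) \<notin> BAUPP n \<mu> e"
      if "k < m" "y \<in> Y k" for k y
      using Y that unfolding s_def by (simp add: mult.commute)
    have Y_small: "5 * \<Lambda> * s k < r0" "20 * s k < r0" if ky: "k < m" "y \<in> Y k" for k y
    proof -
      show 1: "5 * \<Lambda> * s k < r0" using Y_t[OF ky] by blast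
      have "20 * s k \<le> 5 * \<Lambda> * s k" using \<Lambda> s(1)[of k] by (intro mult_right_mono) auto
      then show "20 * s k < r0" using 1 by linarith
    qed
    \<comment> \<open>\<open>v k\<close> depends on the level only, so the intervals \<open>(v k, 2 v k]\<close> are disjoint.\<close>
    define v where "v k = 5 / 4 * \<Lambda> * s k" for k
    have v0: "0 < v k" for k using \<Lambda> s(1)[of k] by (simp add: v_def)
    have v_half: "2 * v l \<le> v k" if "k < l" for k l
    proof -
      have "s l \<le> s (Suc k)"
        unfolding s_def using that r0 by (intro divide_left_mono power_increasing) auto
      then have "2 * s l \<le> s k" using s(3)[of k] by simp
      then have "5 / 4 * \<Lambda> * (2 * s l) \<le> 5 / 4 * \<Lambda> * s k" using \<Lambda> by (intro mult_left_mono) auto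
      then show ?thesis by (simp add: v_def)
    qed
    have bad: "(x, t') \<notin> ?G" if kxy: "k < m" "y \<in> Y k" "dist y x < s k / 2" "v k < t'" "t' \<le> 2 * v k" for k x y t'
    proof
      assume "(x, t') \<in> ?G"
      obtain t where t: "s k / 2 < t" "t \<le> s k" "(y, \<Lambda> * t) \<notin> BAUPP n \<mu> e" using Y_t[OF kxy(1,2)] by blast
      \<comment> \<open>The factor 5/4 in \<open>v\<close> leaves room for the displacement, as
        \<open>s k / 2 \<le> \<Lambda> * s k / 8\<close>. At the upper end
        \<open>2 * v k = 5 / 2 * \<Lambda> * s k\<close> is below \<open>5 * \<Lambda> * t\<close>,
        the ratio that \<open>BAUPP_rescale\<close> allows.\<close>
      have 1: "\<Lambda> * t \<le> \<Lambda> * s k" "4 * s k \<le> \<Lambda> * s k" "\<Lambda> * (s k / 2) \<le> \<Lambda> * t"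
        using t \<Lambda> s(1)[of k] by (auto intro!: mult_left_mono mult_right_mono)
      have "(y, \<Lambda> * t) \<in> BAUPP n \<mu> (5 * (e / 5))"
      proof (rule BAUPP_rescale[OF \<open>(x, t') \<in> ?G\<close>])
        show "y \<in> msupp \<mu>" using Y_E[OF kxy(1,2)] E by simp
        show "0 < \<Lambda> * t" using t \<Lambda> s(1)[of k] by simp
        show "dist x y + \<Lambda> * t \<le> t'" using kxy 1 by (simp add: v_def dist_commute)
        show "t' \<le> 5 * (\<Lambda> * t)" using kxy 1 by (simp add: v_def)
      qed
      then show False using t by simp
    qed
    define \<Phi> where "\<Phi> x = (\<integral>\<^sup>+t\<in>{0<..<r0 / 2}. indicator (- ?G) (x, t) * ennreal (1 / t) \<partial>lborel)" for x
    \<comment> \<open>Each bad pair is charged 1/2 on its ball; the interval of bad scales attached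
      to its level pays for it in \<open>\<Phi>\<close>.\<close>
    define f where "f x = (\<Sum>k<m. \<Sum>y\<in>Y k. ennreal (1 / 2) * indicator (ball y (s k / 2)) x)" for x
    have f_le: "f x \<le> \<Phi> x * indicator (ball w (r0 / 2)) x" for x
    proof -
      define J where "J = {k. k < m \<and> (\<exists>y\<in>Y k. dist y x < s k / 2)}"
      have J: "finite J" "J \<subseteq> {..<m}" by (auto simp: J_def)
      have row: "(\<Sum>y\<in>Y k. ennreal (1 / 2) * indicator (ball y (s k / 2)) x) \<le> (if k \<in> J then ennreal (1 / 2) else 0)"
        if k: "k < m" for k
      proof (cases "k \<in> J")
        case True
        then obtain y0 where y0: "y0 \<in> Y k" "dist y0 x < s k / 2" by (auto simp: J_def)
        have "x \<notin> ball y (s k / 2)" if "y \<in> Y k" "y \<noteq> y0" for y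
          using Y_sep[OF k that(1) y0(1) that(2)] dist_triangle2[of y y0 x] y0(2) by auto
        then have "(\<Sum>y\<in>Y k. ennreal (1 / 2) * indicator (ball y (s k / 2)) x)
            = (\<Sum>y\<in>{y0}. ennreal (1 / 2) * indicator (ball y (s k / 2)) x)"
          using Y_fin[OF k] y0 by (intro sum.mono_neutral_right) auto
        also have "\<dots> = ennreal (1 / 2) * indicator (ball y0 (s k / 2)) x"
          by (simp del: sum_mult_indicator)
        also have "\<dots> \<le> ennreal (1 / 2)" by (auto simp: indicator_def)
        finally show ?thesis using True by simp
      next
        case False
        then have "indicator (ball y (s k / 2)) x = (0::ennreal)" if "y \<in> Y k" for y
          using k that by (auto simp: J_def)
        then show ?thesis by simp
      qed
      have "f x \<le> (\<Sum>k<m. if k \<in> J then ennreal (1 / 2) else 0)"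
        unfolding f_def using row by (intro sum_mono) auto
      also have "\<dots> = (\<Sum>k\<in>J. ennreal (1 / 2))"
        using J by (subst sum.mono_neutral_cong_right[of "{..<m}" J]) auto
      finally have fJ: "f x \<le> (\<Sum>k\<in>J. ennreal (1 / 2))" .
      show ?thesis
      proof (cases "J = {}")
        case True
        then show ?thesis using fJ by simp
      next
        case False
        then obtain k y where ky: "k < m" "y \<in> Y k" "dist y x < s k / 2" by (auto simp: J_def)
        have "dist w x < r0 / 2"
          using dist_triangle[of w x y] Y_E[OF ky(1,2)] ky(3) Y_small[OF ky(1,2)] s(1)[of k] r0 by linarith
        have "(\<Sum>k\<in>J. ennreal (1 / 2)) \<le> (\<Sum>k\<in>J. \<integral>\<^sup>+t. indicator {v k<..2 * v k} t * ennreal (1 / t) \<partial>lborel)"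
          by (intro sum_mono nn_integral_inverse_ge_half v0)
        also have "\<dots> = (\<integral>\<^sup>+t. (\<Sum>k\<in>J. indicator {v k<..2 * v k} t * ennreal (1 / t)) \<partial>lborel)"
          by (rule nn_integral_sum[symmetric]) measurable
        also have "\<dots> \<le> \<Phi> x"
          unfolding \<Phi>_def
        proof (rule nn_integral_mono)
          fix t :: real
          show "(\<Sum>k\<in>J. indicator {v k<..2 * v k} t * ennreal (1 / t))
              \<le> indicator (- ?G) (x, t) * ennreal (1 / t) * indicator {0<..<r0 / 2} t"
          proof (cases "\<exists>k\<in>J. t \<in> {v k<..2 * v k}")
            case True
            then obtain k where k: "k \<in> J" "v k < t" "t \<le> 2 * v k" by auto
            then obtain y where y: "k < m" "y \<in> Y k" "dist y x < s k / 2" by (auto simp: J_def)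
            have "t \<notin> {v l<..2 * v l}" if "l \<noteq> k" for l
              using v_half[of k l] v_half[of l k] that k by (cases "l < k") auto
            then have "(\<Sum>k\<in>J. indicator {v k<..2 * v k} t * ennreal (1 / t))
                = (\<Sum>k\<in>{k}. indicator {v k<..2 * v k} t * ennreal (1 / t))"
              using J k by (intro sum.mono_neutral_right) auto
            also have "\<dots> = ennreal (1 / t)" using k by simp
            finally have sum: "(\<Sum>k\<in>J. indicator {v k<..2 * v k} t * ennreal (1 / t)) = ennreal (1 / t)" .
            have "0 < t" using k v0[of k] by linarith
            moreover have "t < r0 / 2" using k Y_small(1)[OF y(1,2)] by (simp add: v_def)
            ultimately show ?thesis unfolding sum using bad[OF y k(2,3)] by simp
          next
            case False
            then have "(\<Sum>k\<in>J. indicator {v k<..2 * v k} t * ennreal (1 / t)) = 0" by (intro sum.neutral) auto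
            then show ?thesis by simp
          qed
        qed
        finally show ?thesis using fJ \<open>dist w x < r0 / 2\<close> by simp
      qed
    qed
    have "(\<Sum>k<m. \<Sum>y\<in>Y k. ennreal (1 / 2 * ((s k / 2) ^ n / C)))
        \<le> (\<Sum>k<m. \<Sum>y\<in>Y k. ennreal (1 / 2) * emeasure \<mu> (ball y (s k / 2)))"
    proof (intro sum_mono)
      fix k y assume "k \<in> {..<m}" and y: "y \<in> Y k"
      then have k: "k < m" by simp
      have "ennreal ((s k / 2) ^ n / C) \<le> emeasure \<mu> (ball y (s k / 2))"
        using Y_E[OF k y] s[of k] by (intro lower admissible_mono[OF adm]) auto
      then have "ennreal (1 / 2) * ennreal ((s k / 2) ^ n / C) \<le> ennreal (1 / 2) * emeasure \<mu> (ball y (s k / 2))"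
        by (intro mult_left_mono) auto
      then show "ennreal (1 / 2 * ((s k / 2) ^ n / C)) \<le> ennreal (1 / 2) * emeasure \<mu> (ball y (s k / 2))"
        by (subst ennreal_mult') auto
    qed
    also have "\<dots> = (\<integral>\<^sup>+x. f x \<partial>\<mu>)"
      unfolding f_def by (simp add: nn_integral_sum nn_integral_cmult_indicator sets_\<mu>)
    also have "\<dots> \<le> (\<integral>\<^sup>+x. \<Phi> x * indicator (ball w (r0 / 2)) x \<partial>\<mu>)"
      by (intro nn_integral_mono f_le)
    also have "\<dots> \<le> ennreal Cb0 * emeasure \<mu> (ball w (r0 / 2))"
      unfolding \<Phi>_def using r0 by (intro Cb0 w admissible_mono[OF adm]) auto
    also have "\<dots> \<le> ennreal Cb * ennreal (C * (r0 / 2) ^ n)"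
      using r0 Cb by (intro mult_mono ennreal_leI upper w) auto
    also have "\<dots> = ennreal (Cb * (C * (r0 / 2) ^ n))"
      using Cb by (simp add: ennreal_mult')
    also have "(\<Sum>k<m. \<Sum>y\<in>Y k. ennreal (1 / 2 * ((s k / 2) ^ n / C)))
        = ennreal (\<Sum>k<m. \<Sum>y\<in>Y k. 1 / 2 * ((s k / 2) ^ n / C))"
    proof -
      have nonneg: "0 \<le> 1 / 2 * ((s k / 2) ^ n / C)" for k using s(1)[of k] C_ge by simp
      have "(\<Sum>k<m. \<Sum>y\<in>Y k. ennreal (1 / 2 * ((s k / 2) ^ n / C)))
          = (\<Sum>k<m. ennreal (\<Sum>y\<in>Y k. 1 / 2 * ((s k / 2) ^ n / C)))"
        by (intro sum.cong refl sum_ennreal nonneg)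
      also have "\<dots> = ennreal (\<Sum>k<m. \<Sum>y\<in>Y k. 1 / 2 * ((s k / 2) ^ n / C))"
        by (intro sum_ennreal sum_nonneg nonneg)
      finally show ?thesis .
    qed
    finally have "(\<Sum>k<m. \<Sum>y\<in>Y k. 1 / 2 * ((s k / 2) ^ n / C)) \<le> Cb * (C * (r0 / 2) ^ n)"
      using Cb C_ge r0 by (subst (asm) ennreal_le_iff) auto
    then have "(2 * C * 2 ^ n) * (\<Sum>k<m. \<Sum>y\<in>Y k. 1 / 2 * ((s k / 2) ^ n / C))
        \<le> (2 * C * 2 ^ n) * (Cb * (C * (r0 / 2) ^ n))"
      using C_ge by (intro mult_left_mono) auto
    also have "(2 * C * 2 ^ n) * (\<Sum>k<m. \<Sum>y\<in>Y k. 1 / 2 * ((s k / 2) ^ n / C))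
        = (\<Sum>k<m. real (card (Y k)) * s k ^ n)"
      using C_ge unfolding sum_distrib_left by (intro sum.cong) (auto simp: power_divide)
    also have "(2 * C * 2 ^ n) * (Cb * (C * (r0 / 2) ^ n)) = K * r0 ^ n"
      by (simp add: K_def power_divide power2_eq_square)
    finally show "(\<Sum>k<m. real (card (Y k)) * (r0 / 2 ^ k) ^ n) \<le> K * r0 ^ n"
      unfolding s_def .
  qed
qed


text \<open>There are three kinds of pairs: those on the first \<open>k0\<close> levels, where every
  level costs one packing bound; those failing the BAUPP at the enlarged scale; and the remaining
  ones, which are stacked by \<open>stacked_planes_scale\<close>. The cut at \<open>k0\<close> keeps
  the enlarged scale \<open>\<Lambda> * t\<close> below \<open>r0\<close>.\<close>

lemma BWGL_sum_bound:
  assumes E: "E = msupp \<mu>" and e: "0 < e" and baupp: "BAUPP_condition n \<mu>" and riesz: "riesz_L2_bounded n \<mu>"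
  shows "\<exists>K\<ge>0. \<forall>z\<in>E. \<forall>r0. admissible_radius E r0 \<longrightarrow> (\<forall>m X.
    (\<forall>k<m. finite (X k) \<and> X k \<subseteq> E \<inter> ball z r0
      \<and> (\<forall>x\<in>X k. \<forall>y\<in>X k. x \<noteq> y \<longrightarrow> r0 / 2 ^ k \<le> dist x y)
      \<and> (\<forall>x\<in>X k. \<exists>t. r0 / 2 ^ Suc k < t \<and> t \<le> r0 / 2 ^ k \<and> (x, t) \<notin> BWGL n \<mu> e))
    \<longrightarrow> (\<Sum>k<m. real (card (X k)) * (r0 / 2 ^ k) ^ n) \<le> K * r0 ^ n)"
proof -
  obtain A B where AB: "1 \<le> B" "8 * B \<le> A" and
    AB2: "24 * C\<^sup>2 * 8 ^ n * sqrt (12 * A) / B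
        + 48 * ((2 * real n + 3) * 2 ^ Suc n) * C\<^sup>2 * 4 ^ n * B / A \<le> 1 / (64 * 8 ^ n * 7 ^ Suc n * C\<^sup>2) / 2"
    by (rule bump_radii_exist[of "24 * C\<^sup>2 * 8 ^ n" "48 * ((2 * real n + 3) * 2 ^ Suc n) * C\<^sup>2 * 4 ^ n"
          "1 / (64 * 8 ^ n * 7 ^ Suc n * C\<^sup>2) / 2"]) (use C_ge in auto)
  have A: "1 \<le> A" using AB by linarith
  obtain \<Lambda> e' \<delta> where \<Lambda>: "4 \<le> \<Lambda>" and e': "0 < e'" and \<delta>: "0 < \<delta>"
    and stack: "\<forall>x\<in>E. \<forall>t. admissible_radius E t \<longrightarrow> (x, t) \<notin> BWGL n \<mu> e \<longrightarrow>
       (x, \<Lambda> * t) \<in> BAUPP n \<mu> e' \<longrightarrow> stacked A \<Lambda> \<delta> x t"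
    using stacked_planes_scale[OF E A e] by (elim exE conjE) (rule that)
  obtain KZ where KZ: "0 \<le> KZ" and sumZ: "\<forall>z\<in>E. \<forall>r0. admissible_radius E r0 \<longrightarrow> (\<forall>m Z.
    (\<forall>k<m. finite (Z k) \<and> Z k \<subseteq> E \<inter> ball z r0
      \<and> (\<forall>x\<in>Z k. \<forall>y\<in>Z k. x \<noteq> y \<longrightarrow> r0 / 2 ^ k \<le> dist x y)
      \<and> (\<forall>x\<in>Z k. \<exists>t. r0 / 2 ^ Suc k < t \<and> t \<le> r0 / 2 ^ k \<and> \<Lambda> * t \<le> r0 \<and> stacked A \<Lambda> \<delta> x t))
    \<longrightarrow> (\<Sum>k<m. real (card (Z k)) * (r0 / 2 ^ k) ^ n) \<le> KZ * r0 ^ n)"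
    using stacked_sum_bound[OF AB AB2 \<delta> \<Lambda> riesz] by (elim exE conjE) (rule that)
  have "bad_set_carleson \<mu> (BAUPP n \<mu> (e' / 5))" using baupp e' by (simp add: BAUPP_condition_def)
  from BAUPP_sum_bound[OF E \<Lambda> this] obtain KY where KY: "0 \<le> KY"
    and sumY: "\<forall>w\<in>E. \<forall>r0. admissible_radius E r0 \<longrightarrow> (\<forall>m Y.
    (\<forall>k<m. finite (Y k) \<and> Y k \<subseteq> E \<inter> ball w (r0 / 4)
      \<and> (\<forall>x\<in>Y k. \<forall>y\<in>Y k. x \<noteq> y \<longrightarrow> r0 / 2 ^ k \<le> dist x y)
      \<and> (\<forall>y\<in>Y k. \<exists>t. r0 / 2 ^ Suc k < t \<and> t \<le> r0 / 2 ^ k \<and> 5 * \<Lambda> * (r0 / 2 ^ k) < r0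
            \<and> (y, \<Lambda> * t) \<notin> BAUPP n \<mu> e'))
    \<longrightarrow> (\<Sum>k<m. real (card (Y k)) * (r0 / 2 ^ k) ^ n) \<le> KY * r0 ^ n)"
    by (elim exE conjE) (rule that)
  obtain k0 :: nat where k0: "5 * \<Lambda> < 2 ^ k0" using real_arch_pow[of 2 "5 * \<Lambda>"] by auto
  define K where "K = real k0 * (C\<^sup>2 * 4 ^ n) + C\<^sup>2 * 16 ^ n * KY + KZ"
  have K: "0 \<le> K" using KY KZ by (simp add: K_def)
  show ?thesis
  proof (rule exI[of _ K], intro conjI K ballI allI impI)
    fix z r0 m and X :: "nat \<Rightarrow> 'a set"
    assume z: "z \<in> E" and adm: "admissible_radius E r0"
      and X: "\<forall>k<m. finite (X k) \<and> X k \<subseteq> E \<inter> ball z r0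
      \<and> (\<forall>x\<in>X k. \<forall>y\<in>X k. x \<noteq> y \<longrightarrow> r0 / 2 ^ k \<le> dist x y)
      \<and> (\<forall>x\<in>X k. \<exists>t. r0 / 2 ^ Suc k < t \<and> t \<le> r0 / 2 ^ k \<and> (x, t) \<notin> BWGL n \<mu> e)"
    have r0: "0 < r0" using adm by (simp add: admissible_radius_def)
    have X_fin: "finite (X k)" if "k < m" for k using X that by blast
    have X_sub: "X k \<subseteq> E \<inter> ball z r0" if "k < m" for k using X that by blast
    have X_sep: "r0 / 2 ^ k \<le> dist x y" if "k < m" "x \<in> X k" "y \<in> X k" "x \<noteq> y" for k x y
      using X that by blast
    have X_bad: "\<exists>t. r0 / 2 ^ Suc k < t \<and> t \<le> r0 / 2 ^ k \<and> (x, t) \<notin> BWGL n \<mu> e" if "k < m" "x \<in> X k" for k x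
      using X that by blast
    have sk: "0 < r0 / 2 ^ k" "r0 / 2 ^ k \<le> r0" for k
      using r0 divide_left_mono[of 1 "2 ^ k" r0] by auto
    have small: "5 * \<Lambda> * (r0 / 2 ^ k) < r0" if "k0 \<le> k" for k
    proof -
      have "5 * \<Lambda> < 2 ^ k" using k0 power_increasing[OF that, of "2::real"] by linarith
      then have "5 * \<Lambda> * r0 < 2 ^ k * r0" using r0 by (intro mult_strict_right_mono)
      then show ?thesis by (simp add: field_simps)
    qed
    \<comment> \<open>\<open>t\<close> is any scale of the level, not necessarily one at which the
      BWGL fails. Outside \<open>Y k\<close> the BAUPP therefore holds at
      \<open>\<Lambda> * t\<close> for the very \<open>t\<close> at which the BWGL fails.\<close>
    define Y where "Y k = {x \<in> X k. k0 \<le> k \<and>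
      (\<exists>t. r0 / 2 ^ Suc k < t \<and> t \<le> r0 / 2 ^ k \<and> (x, \<Lambda> * t) \<notin> BAUPP n \<mu> e')}" for k
    define Z where "Z k = {x \<in> X k. k0 \<le> k \<and> x \<notin> Y k}" for k
    let ?s = "\<lambda>k. (r0 / 2 ^ k) ^ n"
    have sumZ': "(\<Sum>k<m. real (card (Z k)) * ?s k) \<le> KZ * r0 ^ n"
    proof (rule sumZ[rule_format, OF z adm], intro conjI ballI impI)
      fix k assume k: "k < m"
      show "finite (Z k)" using X_fin[OF k] by (simp add: Z_def)
      show "Z k \<subseteq> E \<inter> ball z r0" using X_sub[OF k] by (auto simp: Z_def)
      show "r0 / 2 ^ k \<le> dist x y" if "x \<in> Z k" "y \<in> Z k" "x \<noteq> y" for x y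
        using that X_sep[OF k] by (simp add: Z_def)
      fix x assume x: "x \<in> Z k"
      then have xk: "x \<in> X k" "k0 \<le> k" by (auto simp: Z_def)
      obtain t where t: "r0 / 2 ^ Suc k < t" "t \<le> r0 / 2 ^ k" "(x, t) \<notin> BWGL n \<mu> e"
        using X_bad[OF k xk(1)] by blast
      have t0: "0 < t" using t(1) sk(1)[of "Suc k"] by linarith
      have "(x, \<Lambda> * t) \<in> BAUPP n \<mu> e'" using x t xk by (auto simp: Z_def Y_def)
      moreover have "admissible_radius E t"
        using t sk(2)[of k] t0 by (intro admissible_mono[OF adm]) auto
      moreover have "x \<in> E" using X_sub[OF k] xk by auto
      ultimately have "stacked A \<Lambda> \<delta> x t" using stack t(3) by blast
      moreover have "\<Lambda> * t \<le> r0"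
      proof -
        have "\<Lambda> * t \<le> \<Lambda> * (r0 / 2 ^ k)" using t(2) \<Lambda> by (intro mult_left_mono) auto
        moreover have "0 < \<Lambda> * (r0 / 2 ^ k)" using \<Lambda> sk(1)[of k] by (intro mult_pos_pos) auto
        ultimately show ?thesis using small[OF xk(2)] by linarith
      qed
      ultimately show "\<exists>t. r0 / 2 ^ Suc k < t \<and> t \<le> r0 / 2 ^ k \<and> \<Lambda> * t \<le> r0 \<and> stacked A \<Lambda> \<delta> x t"
        using t by blast
    qed
    have r4: "admissible_radius E (r0 / 4)" using r0 by (intro admissible_mono[OF adm]) auto
    have r04: "r0 / 4 \<le> r0" using r0 by simp
    \<comment> \<open>\<open>BAUPP_sum_bound\<close> counts in balls of radius
      \<open>r0 / 4\<close>, so that the slightly larger ball on which it invokes the Carleson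
      condition still has an admissible radius. Boundedly many such balls cover
      \<open>E \<inter> ball z r0\<close>.\<close>
    obtain W where W: "W \<subseteq> E \<inter> ball z r0" "finite W"
      "\<And>x y. x \<in> W \<Longrightarrow> y \<in> W \<Longrightarrow> x \<noteq> y \<Longrightarrow> r0 / 4 \<le> dist x y"
      "\<And>x. x \<in> E \<inter> ball z r0 \<Longrightarrow> \<exists>y\<in>W. dist y x < r0 / 4"
      by (rule separated_net[OF z subset_refl r4 r04]) (rule that)
    have "real (card W) * (r0 / 4) ^ n \<le> C\<^sup>2 * 4 ^ n * r0 ^ n"
      using W r0 by (intro packing_separated[OF W(2) _ r4 W(3) z]) auto
    then have cardW: "real (card W) \<le> C\<^sup>2 * 16 ^ n"
    proof -
      assume "real (card W) * (r0 / 4) ^ n \<le> C\<^sup>2 * 4 ^ n * r0 ^ n"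
      then have "real (card W) * r0 ^ n \<le> (C\<^sup>2 * (4 ^ n * 4 ^ n)) * r0 ^ n"
        by (simp add: power_divide field_simps)
      also have "(4::real) ^ n * 4 ^ n = 16 ^ n" by (simp flip: power_mult_distrib)
      finally show ?thesis using r0 by simp
    qed
    have sumY': "(\<Sum>k<m. real (card (Y k)) * ?s k) \<le> C\<^sup>2 * 16 ^ n * KY * r0 ^ n"
    proof -
      have W_E: "w \<in> E" if "w \<in> W" for w using W that by auto
      have Yw: "(\<Sum>k<m. real (card (Y k \<inter> ball w (r0 / 4))) * ?s k) \<le> KY * r0 ^ n" if w: "w \<in> W" for w
      proof (rule sumY[rule_format, OF W_E[OF w] adm], intro conjI ballI impI)
        fix k assume k: "k < m"
        show "finite (Y k \<inter> ball w (r0 / 4))" using X_fin[OF k] by (simp add: Y_def)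
        show "Y k \<inter> ball w (r0 / 4) \<subseteq> E \<inter> ball w (r0 / 4)" using X_sub[OF k] by (auto simp: Y_def)
        show "r0 / 2 ^ k \<le> dist x y"
          if "x \<in> Y k \<inter> ball w (r0 / 4)" "y \<in> Y k \<inter> ball w (r0 / 4)" "x \<noteq> y" for x y
          using that X_sep[OF k] by (simp add: Y_def)
        show "\<exists>t. r0 / 2 ^ Suc k < t \<and> t \<le> r0 / 2 ^ k \<and> 5 * \<Lambda> * (r0 / 2 ^ k) < r0
            \<and> (y, \<Lambda> * t) \<notin> BAUPP n \<mu> e'" if "y \<in> Y k \<inter> ball w (r0 / 4)" for y
          using that small unfolding Y_def by blast
      qed
      have "(\<Sum>k<m. real (card (Y k)) * ?s k) \<le> (\<Sum>k<m. \<Sum>w\<in>W. real (card (Y k \<inter> ball w (r0 / 4))) * ?s k)"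
      proof (rule sum_mono)
        fix k assume "k \<in> {..<m}"
        then have k: "k < m" by simp
        have "Y k \<subseteq> (\<Union>w\<in>W. Y k \<inter> ball w (r0 / 4))"
          using W(4) X_sub[OF k] by (fastforce simp: Y_def)
        then have "card (Y k) \<le> card (\<Union>w\<in>W. Y k \<inter> ball w (r0 / 4))"
          using X_fin[OF k] W(2) by (intro card_mono) (auto simp: Y_def)
        also have "\<dots> \<le> (\<Sum>w\<in>W. card (Y k \<inter> ball w (r0 / 4)))" by (rule card_UN_le[OF W(2)])
        finally have "real (card (Y k)) \<le> (\<Sum>w\<in>W. real (card (Y k \<inter> ball w (r0 / 4))))"
          by (metis of_nat_le_iff of_nat_sum)
        then have "real (card (Y k)) * ?s k \<le> (\<Sum>w\<in>W. real (card (Y k \<inter> ball w (r0 / 4)))) * ?s k"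
          using r0 by (intro mult_right_mono) auto
        then show "real (card (Y k)) * ?s k \<le> (\<Sum>w\<in>W. real (card (Y k \<inter> ball w (r0 / 4))) * ?s k)"
          by (simp only: sum_distrib_right)
      qed
      also have "\<dots> = (\<Sum>w\<in>W. \<Sum>k<m. real (card (Y k \<inter> ball w (r0 / 4))) * ?s k)" by (rule sum.swap)
      also have "\<dots> \<le> (\<Sum>w\<in>W. KY * r0 ^ n)" by (intro sum_mono Yw)
      also have "\<dots> = real (card W) * (KY * r0 ^ n)" by simp
      also have "\<dots> \<le> C\<^sup>2 * 16 ^ n * (KY * r0 ^ n)" using cardW KY r0 by (intro mult_right_mono) auto
      finally show ?thesis by simp
    qed
    have "(\<Sum>k<m. real (card (X k)) * ?s k)
        \<le> (\<Sum>k<m. (if k < k0 then C\<^sup>2 * 4 ^ n * r0 ^ n else 0) + real (card (Y k)) * ?s k + real (card (Z k)) * ?s k)"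
    proof (rule sum_mono)
      fix k assume "k \<in> {..<m}"
      then have k: "k < m" by simp
      show "real (card (X k)) * ?s k
          \<le> (if k < k0 then C\<^sup>2 * 4 ^ n * r0 ^ n else 0) + real (card (Y k)) * ?s k + real (card (Z k)) * ?s k"
      proof (cases "k < k0")
        case True
        have "real (card (X k)) * ?s k \<le> C\<^sup>2 * 4 ^ n * r0 ^ n"
        proof (rule packing_separated[OF X_fin[OF k] _ _ X_sep[OF k] z])
          show "X k \<subseteq> E" using X_sub[OF k] by blast
          show "admissible_radius E (r0 / 2 ^ k)" using sk[of k] by (intro admissible_mono[OF adm])
          show "dist z x < r0" if "x \<in> X k" for x using X_sub[OF k] that by auto
        qed (use sk in auto)
        moreover have "0 \<le> real (card (Y k)) * ?s k" "0 \<le> real (card (Z k)) * ?s k" using r0 by auto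
        ultimately show ?thesis using True by simp
      next
        case False
        then have "X k \<subseteq> Y k \<union> Z k" by (auto simp: Z_def)
        then have "card (X k) \<le> card (Y k \<union> Z k)"
          using X_fin[OF k] by (intro card_mono) (auto simp: Y_def Z_def)
        also have "\<dots> \<le> card (Y k) + card (Z k)" by (rule card_Un_le)
        finally have "real (card (X k)) * ?s k \<le> (real (card (Y k)) + real (card (Z k))) * ?s k"
          using r0 by (intro mult_right_mono) auto
        then show ?thesis using False by (simp add: distrib_right)
      qed
    qed
    also have "\<dots> = (\<Sum>k<m. if k < k0 then C\<^sup>2 * 4 ^ n * r0 ^ n else 0)
        + (\<Sum>k<m. real (card (Y k)) * ?s k) + (\<Sum>k<m. real (card (Z k)) * ?s k)"
      by (simp add: sum.distrib)
    also have "(\<Sum>k<m. if k < k0 then C\<^sup>2 * 4 ^ n * r0 ^ n else 0) \<le> real k0 * (C\<^sup>2 * 4 ^ n * r0 ^ n)"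
    proof -
      have "(\<Sum>k<m. if k < k0 then C\<^sup>2 * 4 ^ n * r0 ^ n else 0) = (\<Sum>k\<in>{k\<in>{..<m}. k < k0}. C\<^sup>2 * 4 ^ n * r0 ^ n)"
        by (rule sum.inter_filter[symmetric]) simp
      also have "\<dots> \<le> (\<Sum>k<k0. C\<^sup>2 * 4 ^ n * r0 ^ n)" using r0 by (intro sum_mono2) auto
      finally show ?thesis by simp
    qed
    finally have "(\<Sum>k<m. real (card (X k)) * ?s k)
        \<le> real k0 * (C\<^sup>2 * 4 ^ n * r0 ^ n) + C\<^sup>2 * 16 ^ n * KY * r0 ^ n + KZ * r0 ^ n"
      using sumY' sumZ' by linarith
    then show "(\<Sum>k<m. real (card (X k)) * ?s k) \<le> K * r0 ^ n"
      by (simp add: K_def algebra_simps)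
  qed
qed

text \<open>The points having a bad scale in \<open>(s (Suc k), s k]\<close> are covered by balls
  around a net \<open>X k\<close>, and this interval has measure at most 1 for
  \<open>dt / t\<close>. The inner integral at \<open>x\<close> is thus at most the number of net
  balls containing \<open>x\<close>. Upper regularity turns the integral of this number into the
  packing sum, and lower regularity replaces \<open>r ^ n\<close> by the mass of the ball, whence
  \<open>C\<^sup>2 * K\<close>.\<close>

lemma BWGL_condition_holds:
  assumes E: "E = msupp \<mu>" and baupp: "BAUPP_condition n \<mu>" and riesz: "riesz_L2_bounded n \<mu>"
  shows "BWGL_condition n \<mu>"
  unfolding BWGL_condition_def
proof (intro allI impI)
  fix e :: real assume e: "0 < e"
  let ?G = "BWGL n \<mu> e"
  obtain K where K: "0 \<le> K" and sumX: "\<forall>z\<in>E. \<forall>r0. admissible_radius E r0 \<longrightarrow> (\<forall>m X.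
    (\<forall>k<m. finite (X k) \<and> X k \<subseteq> E \<inter> ball z r0
      \<and> (\<forall>x\<in>X k. \<forall>y\<in>X k. x \<noteq> y \<longrightarrow> r0 / 2 ^ k \<le> dist x y)
      \<and> (\<forall>x\<in>X k. \<exists>t. r0 / 2 ^ Suc k < t \<and> t \<le> r0 / 2 ^ k \<and> (x, t) \<notin> ?G))
    \<longrightarrow> (\<Sum>k<m. real (card (X k)) * (r0 / 2 ^ k) ^ n) \<le> K * r0 ^ n)"
    using BWGL_sum_bound[OF E e baupp riesz] by (elim exE conjE) (rule that)
  show "bad_set_carleson \<mu> ?G"
    unfolding bad_set_carleson_def E[symmetric]
  proof (rule exI[of _ "C\<^sup>2 * K"], intro ballI allI impI)
    fix z r assume z: "z \<in> E" and adm: "admissible_radius E r"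
    have r: "0 < r" using adm by (simp add: admissible_radius_def)
    define s where "s k = r / 2 ^ k" for k :: nat
    have s: "0 < s k" "s k \<le> r" "s (Suc k) = s k / 2" for k
      using r divide_left_mono[of 1 "2 ^ k" r] by (auto simp: s_def)
    define bad where "bad k = {x \<in> E \<inter> ball z r. \<exists>t. s (Suc k) < t \<and> t \<le> s k \<and> (x, t) \<notin> ?G}" for k
    have "\<forall>k. \<exists>X. X \<subseteq> bad k \<and> finite X \<and> (\<forall>x\<in>X. \<forall>y\<in>X. x \<noteq> y \<longrightarrow> s k \<le> dist x y)
        \<and> (\<forall>x\<in>bad k. \<exists>y\<in>X. dist y x < s k)"
    proof (rule allI)
      fix k
      have "bad k \<subseteq> E \<inter> ball z r" by (auto simp: bad_def)
      moreover have "admissible_radius E (s k)" using s by (intro admissible_mono[OF adm])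
      ultimately show "\<exists>X. X \<subseteq> bad k \<and> finite X \<and> (\<forall>x\<in>X. \<forall>y\<in>X. x \<noteq> y \<longrightarrow> s k \<le> dist x y)
        \<and> (\<forall>x\<in>bad k. \<exists>y\<in>X. dist y x < s k)"
        by (rule separated_net[OF z _ _ s(2)]) (intro exI conjI ballI impI)
    qed
    from choice[OF this] obtain X where "\<forall>k. X k \<subseteq> bad k \<and> finite (X k)
        \<and> (\<forall>x\<in>X k. \<forall>y\<in>X k. x \<noteq> y \<longrightarrow> s k \<le> dist x y) \<and> (\<forall>x\<in>bad k. \<exists>y\<in>X k. dist y x < s k)"
      by (elim exE) (rule that)
    then have X: "X k \<subseteq> bad k" "finite (X k)"
        "x \<in> X k \<Longrightarrow> y \<in> X k \<Longrightarrow> x \<noteq> y \<Longrightarrow> s k \<le> dist x y"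
        "x \<in> bad k \<Longrightarrow> \<exists>y\<in>X k. dist y x < s k" for k x y
      by blast+
    have partial: "(\<Sum>k<m. real (card (X k)) * s k ^ n) \<le> K * r ^ n" for m
      unfolding s_def
    proof (rule sumX[rule_format, OF z adm], intro conjI ballI impI)
      fix k assume "k < m"
      show "finite (X k)" by (rule X)
      show "X k \<subseteq> E \<inter> ball z r" using X(1)[of k] by (auto simp: bad_def)
      show "r / 2 ^ k \<le> dist x y" if "x \<in> X k" "y \<in> X k" "x \<noteq> y" for x y
        using X(3)[OF that] by (simp add: s_def)
      show "\<exists>t. r / 2 ^ Suc k < t \<and> t \<le> r / 2 ^ k \<and> (x, t) \<notin> ?G" if "x \<in> X k" for x
        using X(1)[of k] that unfolding bad_def s_def by blast
    qed
    define f where "f k x = (\<Sum>y\<in>X k. indicator (ball y (s k)) x :: ennreal)" for k x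
    have inner: "(\<integral>\<^sup>+t\<in>{0<..<r}. indicator (- ?G) (x, t) * ennreal (1 / t) \<partial>lborel) \<le> (\<Sum>k. f k x)"
      if x: "x \<in> E \<inter> ball z r" for x
    proof -
      \<comment> \<open>As \<open>x\<close> is fixed, membership in \<open>bad k\<close> is a
        constant factor and \<open>h k\<close> is a step function of \<open>t\<close>. On its
        interval \<open>1 / t\<close> is at most \<open>2 / s k\<close>.\<close>
      define h where "h k t = (indicator (bad k) x * ennreal (2 / s k)) * indicator {s (Suc k)<..s k} t" for k t
      have "(\<integral>\<^sup>+t\<in>{0<..<r}. indicator (- ?G) (x, t) * ennreal (1 / t) \<partial>lborel) \<le> (\<integral>\<^sup>+t. (\<Sum>k. h k t) \<partial>lborel)"
      proof (rule nn_integral_mono)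
        fix t :: real
        show "indicator (- ?G) (x, t) * ennreal (1 / t) * indicator {0<..<r} t \<le> (\<Sum>k. h k t)"
        proof (cases "t \<in> {0<..<r} \<and> (x, t) \<notin> ?G")
          case True
          then have t: "0 < t" "1 \<le> r / t" by auto
          obtain k where k: "2 ^ k \<le> r / t" "r / t < 2 ^ Suc k"
            using geometric_bracket[OF t(2), of 2] by auto
          have tk: "s (Suc k) < t" "t \<le> s k"
            using k t(1) by (auto simp: s_def field_simps)
          have "1 / t \<le> 2 / s k"
            using tk s[of k] t(1) by (simp add: field_simps)
          then have "ennreal (1 / t) \<le> ennreal (2 / s k)" by (rule ennreal_leI)
          moreover have "x \<in> bad k" using x True tk by (auto simp: bad_def)
          ultimately have "indicator (- ?G) (x, t) * ennreal (1 / t) * indicator {0<..<r} t \<le> h k t"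
            using True tk by (simp add: h_def)
          also have "\<dots> \<le> (\<Sum>k. h k t)" using sum_le_suminf[of "\<lambda>k. h k t" "{k}"] by simp
          finally show ?thesis .
        qed auto
      qed
      also have "\<dots> = (\<Sum>k. \<integral>\<^sup>+t. h k t \<partial>lborel)"
        unfolding h_def by (intro nn_integral_suminf) measurable
      also have "\<dots> = (\<Sum>k. indicator (bad k) x * ennreal (2 / s k) * emeasure lborel {s (Suc k)<..s k})"
        unfolding h_def by (intro suminf_cong nn_integral_cmult_indicator) simp
      also have "\<dots> \<le> (\<Sum>k. f k x)"
      proof (rule suminf_le)
        fix k
        have "s k - s k / 2 = s k / 2" by simp
        then have "emeasure lborel {s (Suc k)<..s k} = ennreal (s k / 2)"
          unfolding s(3) using s(1)[of k] by (subst emeasure_lborel_Ioc) auto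
        then have "ennreal (2 / s k) * emeasure lborel {s (Suc k)<..s k} = ennreal (2 / s k * (s k / 2))"
          using s(1)[of k] by (subst ennreal_mult) auto
        also have "\<dots> = 1" using s[of k] by simp
        finally have 1: "ennreal (2 / s k) * emeasure lborel {s (Suc k)<..s k} = 1" .
        show "indicator (bad k) x * ennreal (2 / s k) * emeasure lborel {s (Suc k)<..s k} \<le> f k x"
        proof (cases "x \<in> bad k")
          case True
          then obtain y where y: "y \<in> X k" "dist y x < s k" using X(4) by blast
          have "(1::ennreal) = indicator (ball y (s k)) x" using y by simp
          also have "\<dots> \<le> f k x" unfolding f_def using y X(2) by (intro member_le_sum) auto
          finally show ?thesis using True 1 by (simp add: mult.assoc)
        qed simp
      qed auto
      finally show ?thesis .
    qed
    have "AE x in \<mu>. x \<in> E"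
      using null closed_E by (intro AE_I[of _ _ "- E"]) (auto simp: sets_\<mu> borel_closed)
    then have "(\<integral>\<^sup>+x\<in>ball z r. (\<integral>\<^sup>+t\<in>{0<..<r}. indicator (- ?G) (x, t) * ennreal (1 / t) \<partial>lborel) \<partial>\<mu>)
        \<le> (\<integral>\<^sup>+x. (\<Sum>k. f k x) \<partial>\<mu>)"
      using inner by (intro nn_integral_mono_AE) (auto elim!: eventually_mono simp: indicator_def)
    also have "\<dots> = (\<Sum>k. \<integral>\<^sup>+x. f k x \<partial>\<mu>)"
      unfolding f_def by (intro nn_integral_suminf borel_measurable_sum borel_measurable_indicator) (simp add: sets_\<mu>)
    also have "\<dots> \<le> ennreal (C * K * r ^ n)"
    proof (rule suminf_le_const)
      fix m
      have fk: "(\<integral>\<^sup>+x. f k x \<partial>\<mu>) \<le> ennreal (C * (real (card (X k)) * s k ^ n))" for k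
      proof -
        have "(\<integral>\<^sup>+x. f k x \<partial>\<mu>) = (\<Sum>y\<in>X k. emeasure \<mu> (ball y (s k)))"
          unfolding f_def by (subst nn_integral_sum) (auto simp: sets_\<mu>)
        also have "\<dots> \<le> (\<Sum>y\<in>X k. ennreal (C * s k ^ n))"
        proof (rule sum_mono)
          fix y assume "y \<in> X k"
          then have "y \<in> E" using X(1)[of k] by (auto simp: bad_def)
          then show "emeasure \<mu> (ball y (s k)) \<le> ennreal (C * s k ^ n)" using s by (intro upper)
        qed
        also have "\<dots> = ennreal (\<Sum>y\<in>X k. C * s k ^ n)"
          using C_ge s(1)[of k] by (intro sum_ennreal) auto
        also have "(\<Sum>y\<in>X k. C * s k ^ n) = C * (real (card (X k)) * s k ^ n)" by simp
        finally show ?thesis .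
      qed
      have "(\<Sum>k<m. \<integral>\<^sup>+x. f k x \<partial>\<mu>) \<le> (\<Sum>k<m. ennreal (C * (real (card (X k)) * s k ^ n)))"
        by (intro sum_mono fk)
      also have "\<dots> = ennreal (\<Sum>k<m. C * (real (card (X k)) * s k ^ n))"
        using C_ge s(1) by (intro sum_ennreal) (auto simp: less_imp_le)
      also have "(\<Sum>k<m. C * (real (card (X k)) * s k ^ n)) = C * (\<Sum>k<m. real (card (X k)) * s k ^ n)"
        by (simp add: sum_distrib_left)
      also have "ennreal \<dots> \<le> ennreal (C * (K * r ^ n))"
        using partial[of m] C_ge by (intro ennreal_leI mult_left_mono) auto
      finally show "(\<Sum>k<m. \<integral>\<^sup>+x. f k x \<partial>\<mu>) \<le> ennreal (C * K * r ^ n)" by (simp add: mult.assoc)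
    qed auto
    also have "\<dots> = ennreal (C\<^sup>2 * K) * ennreal (r ^ n / C)"
      using C_ge K r by (subst ennreal_mult[symmetric]) (auto simp: power2_eq_square field_simps)
    also have "\<dots> \<le> ennreal (C\<^sup>2 * K) * emeasure \<mu> (ball z r)"
      by (intro mult_left_mono lower z adm) auto
    finally show "(\<integral>\<^sup>+x\<in>ball z r. (\<integral>\<^sup>+t\<in>{0<..<r}. indicator (- ?G) (x, t) * ennreal (1 / t) \<partial>lborel) \<partial>\<mu>)
        \<le> ennreal (C\<^sup>2 * K) * emeasure \<mu> (ball z r)" .
  qed
qed

end

section \<open>The support and uniform regularity constants\<close>

lemma closed_msupp: "closed (msupp M)"
proof -
  have "- msupp M = \<Union>{U. open U \<and> emeasure M U = 0}"
    by (auto simp: msupp_def zero_less_iff_neq_zero)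
  then show ?thesis by (simp add: closed_def open_Union)
qed

lemma emeasure_Compl_msupp:
  fixes M :: "'a::euclidean_space measure"
  assumes "sets M = sets borel"
  shows "emeasure M (- msupp M) = 0"
proof -
  let ?F = "{U. open U \<and> emeasure M U = 0}"
  have eq: "- msupp M = \<Union>?F" by (auto simp: msupp_def zero_less_iff_neq_zero)
  obtain F' where F': "F' \<subseteq> ?F" "countable F'" "\<Union>F' = \<Union>?F" by (rule Lindelof[of ?F]) auto
  have "(\<Union>U\<in>F'. U) \<in> null_sets M"
    using F' assms by (intro null_sets_UN') (auto simp: null_sets_def)
  then show ?thesis using F'(3) eq by (auto simp: null_sets_def)
qed

lemma ahlfors_of_ahlfors_regular:
  fixes \<mu> :: "'a::euclidean_space measure"
  assumes n: "n \<ge> 1" and dim: "DIM('a) = n + 1" and radon: "radon_measure \<mu>" and reg: "ahlfors_regular n \<mu>"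
    and ex: "admissible_radius (msupp \<mu>) r1"
  shows "\<exists>C. ahlfors \<mu> (msupp \<mu>) n C"
proof -
  have sets: "sets \<mu> = sets borel" using radon by (simp add: radon_measure_def)
  have r1: "0 < r1" using ex by (simp add: admissible_radius_def)
  obtain C0 where C0: "1 \<le> C0" and bds: "\<And>x r. x \<in> msupp \<mu> \<Longrightarrow> admissible_radius (msupp \<mu>) r \<Longrightarrow>
      ennreal (inverse C0 * r ^ n) \<le> emeasure \<mu> (ball x r) \<and> emeasure \<mu> (ball x r) \<le> ennreal (C0 * r ^ n)"
    using reg unfolding ahlfors_regular_def by blast
  have "\<exists>C1\<ge>C0. \<forall>x\<in>msupp \<mu>. \<forall>r>0. emeasure \<mu> (ball x r) \<le> ennreal (C1 * r ^ n)"
  proof (cases "bounded (msupp \<mu>)")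
    case False
    then show ?thesis using bds by (intro exI[of _ C0]) (auto simp: admissible_radius_def)
  next
    case True
    define D where "D = diameter (msupp \<mu>)"
    have D: "0 < D" using ex True by (auto simp: D_def admissible_radius_def)
    have "compact (msupp \<mu>)" using True closed_msupp by (simp add: compact_eq_bounded_closed)
    then have fin: "emeasure \<mu> (msupp \<mu>) < \<infinity>" using radon by (simp add: radon_measure_def)
    define m where "m = measure \<mu> (msupp \<mu>)"
    have m: "emeasure \<mu> (msupp \<mu>) = ennreal m" "0 \<le> m"
      using fin by (auto simp: m_def intro: emeasure_eq_ennreal_measure)
    \<comment> \<open>For radii above the diameter \<open>D\<close> a ball has at most the total
      mass \<open>m\<close>, which equals \<open>m / D ^ n * D ^ n\<close>; the second entry of the
      maximum covers this case.\<close>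
    define C1 where "C1 = max C0 (m / D ^ n)"
    have "emeasure \<mu> (ball x r) \<le> ennreal (C1 * r ^ n)" if x: "x \<in> msupp \<mu>" and r: "0 < r" for x r
    proof (cases "r \<le> D")
      case True
      then have "emeasure \<mu> (ball x r) \<le> ennreal (C0 * r ^ n)"
        using bds[OF x] r by (auto simp: admissible_radius_def D_def)
      also have "\<dots> \<le> ennreal (C1 * r ^ n)"
        using r by (intro ennreal_leI mult_right_mono) (auto simp: C1_def)
      finally show ?thesis .
    next
      case False
      have "emeasure \<mu> (ball x r) \<le> emeasure \<mu> (msupp \<mu> \<union> - msupp \<mu>)"
        by (intro emeasure_mono) (auto simp: sets)
      also have "\<dots> \<le> emeasure \<mu> (msupp \<mu>) + emeasure \<mu> (- msupp \<mu>)"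
        using closed_msupp[of \<mu>] by (intro emeasure_subadditive) (auto simp: sets borel_closed)
      also have "\<dots> = ennreal m" using m emeasure_Compl_msupp[OF sets] by simp
      also have "m \<le> C1 * r ^ n"
      proof -
        have "m = m / D ^ n * D ^ n" using D by simp
        also have "\<dots> \<le> C1 * r ^ n"
          using False D m C0 by (intro mult_mono power_mono) (auto simp: C1_def)
        finally show ?thesis .
      qed
      then have "ennreal m \<le> ennreal (C1 * r ^ n)" by (rule ennreal_leI)
      finally show ?thesis .
    qed
    then show ?thesis by (intro exI[of _ C1]) (auto simp: C1_def)
  qed
  then obtain C1 where C1: "C0 \<le> C1" and up: "\<And>x r. x \<in> msupp \<mu> \<Longrightarrow> 0 < r \<Longrightarrow> emeasure \<mu> (ball x r) \<le> ennreal (C1 * r ^ n)"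
    by blast
  have "ahlfors \<mu> (msupp \<mu>) n C1"
  proof
    show "ennreal (r ^ n / C1) \<le> emeasure \<mu> (ball u r)"
      if "u \<in> msupp \<mu>" "admissible_radius (msupp \<mu>) r" for u r
    proof -
      have "r ^ n / C1 \<le> inverse C0 * r ^ n"
        using C0 C1 that(2) by (auto simp: divide_inverse mult.commute admissible_radius_def intro!: mult_right_mono)
      then show ?thesis using bds[OF that] ennreal_leI order_trans by blast
    qed
  qed (use sets closed_msupp emeasure_Compl_msupp[OF sets] up C0 C1 n dim in auto)
  then show ?thesis ..
qed

theorem theorem1p1:
  fixes n :: nat and \<mu> :: "'a::euclidean_space measure"
  assumes "n \<ge> 1"
    and "DIM('a) = n + 1"
    and "radon_measure \<mu>"
    and "ahlfors_regular n \<mu>"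
    and "BAUPP_condition n \<mu>"
    and "riesz_L2_bounded n \<mu>"
  shows "BWGL_condition n \<mu>"
proof (cases "\<exists>r. admissible_radius (msupp \<mu>) r")
  case True
  then obtain C where "ahlfors \<mu> (msupp \<mu>) n C"
    using ahlfors_of_ahlfors_regular[OF assms(1-4)] by blast
  then interpret ahlfors \<mu> "msupp \<mu>" n C .
  show ?thesis using BWGL_condition_holds[OF refl assms(5,6)] .
next
  \<comment> \<open>No radius is admissible exactly when the support is bounded with diameter 0,
    that is, has at most one point; the Carleson condition is then vacuous.\<close>
  case False
  then show ?thesis by (auto simp: BWGL_condition_def bad_set_carleson_def)
qed

end
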